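(* Let $n\ge2$, let $G\subsetneq\mathbb{R}^n$ be a proper subdomain, and let $f:G\to G'$ with $G'=f(G)$ a proper subdomain of $\mathbb{R}^n$. Suppose that $f\in OC^1(G)$ and that $f$ satisfies the weak uniform boundedness property on $G$ with a constant $c$, i.e. $r_G(x,y)\le 1/2$ implies $r_{G'}(f(x),f(y))\le c$ for all $x,y\in G$. Then: (e) $f:(G,k_G)\to(G',k_{G'})$ is Lipschitz, i.e. there is $L>0$ with $k_{G'}(f(x),f(y))\le L\,k_G(x,y)$ for all $x,y\in G$. (f) If in addition $f$ is $K$-quasiconformal, then $f:(G,k_G)\to(f(G),k_{f(G)})$ is a pseudo-isometry.
   Context: For a proper subdomain $D\subsetneq\mathbb{R}^n$ and $x,y\in D$: $d(x)=d(x,\partial D)$ is the Euclidean distance to the boundary; $r_D(x,y)=\dfrac{|x-y|}{\min\{d(x),d(y)\}}$; $k_D(x,y)=\inf_\gamma\int_\gamma \frac{ds}{d(z,\partial D)}$ (infimum over rectifiable curves in $D$ joining $x$ to $y$) is the quasihyperbolic metric. For $x\in G$ let $B_x=B^n(x,d(x)/2)$ and $\mathrm{osc}_{V}f=\sup\{|f(s)-f(t)|: s,t\in V\}$. $OC^1(G)$ is the class of $C^1$ mappings $f$ on $G$ for which there is a constant $c_1$ such that $d(x)\,|f'(x)|\le c_1\,\mathrm{osc}_{B_x}f$ for every $x\in G$, where $|f'(x)|=\max_{|v|=1}|f'(x)v|$. A map $f:(M,d_M)\to(N,d_N)$ between metric spaces is a pseudo-isometry if there are positive constants $a,b$ with $a^{-1}d_M(x,y)-b\le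 d_N(f(x),f(y))\le a\,d_M(x,y)$ for all $x,y\in M$. A homeomorphism $f:G\to G'$ between domains of $\mathbb{R}^n$ is $K$-quasiconformal ($K\ge1$) if it is ACL$^n$ (absolutely continuous on almost all lines parallel to the axes, with partial derivatives locally in $L^n$) and $|f'(x)|^n\le K J_f(x)$, $J_f(x)\le K\,l(f'(x))^n$ a.e., where $l(f'(x))=\min_{|v|=1}|f'(x)v|$ and $J_f$ is the Jacobian determinant. *)

theory Defs
  imports "HOL-Analysis.Analysis"
begin

definition proper_subdomain :: "'a::euclidean_space set \<Rightarrow> bool" where
  "proper_subdomain D \<longleftrightarrow> open D \<and> connected D \<and> D \<noteq> {} \<and> D \<noteq> UNIV"

definition bdist :: "'a::euclidean_space set \<Rightarrow> 'a \<Rightarrow> real" where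
  "bdist D x = infdist x (frontier D)"

definition rel_dist :: "'a::euclidean_space set \<Rightarrow> 'a \<Rightarrow> 'a \<Rightarrow> real" where
  "rel_dist D x y = norm (x - y) / min (bdist D x) (bdist D y)"

definition inscribed_lengths :: "(real \<Rightarrow> 'a::euclidean_space) \<Rightarrow> real \<Rightarrow> real \<Rightarrow> real set" where
  "inscribed_lengths g a b =
     {(\<Sum>i<m. dist (g (t i)) (g (t (Suc i)))) | (m::nat) (t::nat \<Rightarrow> real).
        mono_on {..m} t \<and> t ` {..m} \<subseteq> {a..b}}"

definition curve_length :: "(real \<Rightarrow> 'a::euclidean_space) \<Rightarrow> real \<Rightarrow> real \<Rightarrow> real" where
  "curve_length g a b = Sup (inscribed_lengths g a b)"

definition rectifiable :: "(real \<Rightarrow> 'a::euclidean_space) \<Rightarrow> bool" where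
  "rectifiable g \<longleftrightarrow> path g \<and> bdd_above (inscribed_lengths g 0 1)"

text \<open>For a rectifiable path \<open>g\<close>, the arc length function \<open>s t = curve_length g 0 t\<close> is
  continuous, maps \<open>{0..1}\<close> onto \<open>{0..curve_length g 0 1}\<close>, and \<open>g\<close> is constant on its
  level sets. So the choice of \<open>t\<close> below is immaterial, and the result is the unique map
  \<open>g0\<close> on \<open>{0..curve_length g 0 1}\<close> with \<open>g = g0 \<circ> s\<close> on \<open>{0..1}\<close>.\<close>

definition arc_length_param :: "(real \<Rightarrow> 'a::euclidean_space) \<Rightarrow> real \<Rightarrow> 'a" where
  "arc_length_param g s = g (SOME t. t \<in> {0..1} \<and> curve_length g 0 t = s)"

definition curve_integral :: "(real \<Rightarrow> 'a::euclidean_space) \<Rightarrow> ('a \<Rightarrow> real) \<Rightarrow> real" where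
  "curve_integral g \<rho> = integral {0..curve_length g 0 1} (\<lambda>s. \<rho> (arc_length_param g s))"

definition qh_dist :: "'a::euclidean_space set \<Rightarrow> 'a \<Rightarrow> 'a \<Rightarrow> real" where
  "qh_dist D x y =
     Inf {curve_integral g (\<lambda>z. 1 / bdist D z) | g.
            rectifiable g \<and> path_image g \<subseteq> D \<and> pathstart g = x \<and> pathfinish g = y}"

definition osc :: "'a set \<Rightarrow> ('a \<Rightarrow> 'b::real_normed_vector) \<Rightarrow> real" where
  "osc V f = (SUP (s, t)\<in>V \<times> V. norm (f s - f t))"

definition C1_on :: "(real^'n) set \<Rightarrow> (real^'n \<Rightarrow> real^'n) \<Rightarrow> bool" where
  "C1_on G f \<longleftrightarrow>
     (\<forall>x\<in>G. f differentiable (at x)) \<and> continuous_on G (\<lambda>x. jacobian f (at x))"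

definition OC1 :: "(real^'n) set \<Rightarrow> (real^'n \<Rightarrow> real^'n) set" where
  "OC1 G = {f. C1_on G f \<and>
     (\<exists>c1. \<forall>x\<in>G. bdist G x * onorm (frechet_derivative f (at x))
                    \<le> c1 * osc (ball x (bdist G x / 2)) f)}"

definition weak_uniform_bounded ::
  "real \<Rightarrow> 'a::euclidean_space set \<Rightarrow> 'a set \<Rightarrow> ('a \<Rightarrow> 'a) \<Rightarrow> bool" where
  "weak_uniform_bounded c G G' f \<longleftrightarrow>
     (\<forall>x\<in>G. \<forall>y\<in>G. rel_dist G x y \<le> 1/2 \<longrightarrow> rel_dist G' (f x) (f y) \<le> c)"

definition pseudo_isometry ::
  "'a set \<Rightarrow> ('a \<Rightarrow> 'a \<Rightarrow> real) \<Rightarrow> 'b set \<Rightarrow> ('b \<Rightarrow> 'b \<Rightarrow> real) \<Rightarrow> ('a \<Rightarrow> 'b) \<Rightarrow> bool" where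
  "pseudo_isometry M dM N dN f \<longleftrightarrow> f \<in> M \<rightarrow> N \<and>
     (\<exists>a>0. \<exists>b>0. \<forall>x\<in>M. \<forall>y\<in>M.
        inverse a * dM x y - b \<le> dN (f x) (f y) \<and> dN (f x) (f y) \<le> a * dM x y)"

definition abs_continuous_on_interval :: "real \<Rightarrow> real \<Rightarrow> (real \<Rightarrow> 'a::metric_space) \<Rightarrow> bool" where
  "abs_continuous_on_interval a b g \<longleftrightarrow>
     (\<forall>\<epsilon>>0. \<exists>\<delta>>0. \<forall>(m::nat) s t.
        (\<forall>i<m. a \<le> s i \<and> s i \<le> t i \<and> t i \<le> b) \<and>
        disjoint_family_on (\<lambda>i. {s i<..<t i}) {..<m} \<and>
        (\<Sum>i<m. t i - s i) < \<delta>
        \<longrightarrow> (\<Sum>i<m. dist (g (s i)) (g (t i))) < \<epsilon>)"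

text \<open>\<open>f\<close> is ACL if it is continuous and, for every closed box in \<open>G\<close> and every coordinate
  direction \<open>i\<close>, absolutely continuous on almost every segment of the box parallel to the
  \<open>i\<close>-th axis. The segments are indexed by their remaining coordinates \<open>y\<close>, and ``almost
  every'' refers to the \<open>(n-1)\<close>-dimensional Lebesgue measure in \<open>y\<close>.\<close>

definition ACL_on :: "(real^'n) set \<Rightarrow> (real^'n \<Rightarrow> real^'n) \<Rightarrow> bool" where
  "ACL_on G f \<longleftrightarrow> continuous_on G f \<and>
     (\<forall>a b. cbox a b \<subseteq> G \<longrightarrow> (\<forall>i.
        AE y in Pi\<^sub>M (- {i}) (\<lambda>_. lborel).
          (\<forall>j. j \<noteq> i \<longrightarrow> y j \<in> {a $ j..b $ j}) \<longrightarrow>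
          abs_continuous_on_interval (a $ i) (b $ i)
            (\<lambda>t. f (\<chi> j. if j = i then t else y j))))"

definition partial_deriv :: "(real^'n \<Rightarrow> real^'n) \<Rightarrow> 'n \<Rightarrow> real^'n \<Rightarrow> real^'n" where
  "partial_deriv f j x = vector_derivative (\<lambda>t. f (x + t *\<^sub>R axis j 1)) (at 0)"

definition ACLn_on :: "(real^'n) set \<Rightarrow> (real^'n \<Rightarrow> real^'n) \<Rightarrow> bool" where
  "ACLn_on G f \<longleftrightarrow> ACL_on G f \<and>
     (\<forall>j C. compact C \<and> C \<subseteq> G \<longrightarrow>
        partial_deriv f j \<in> borel_measurable (lebesgue_on C) \<and>
        integrable (lebesgue_on C) (\<lambda>x. norm (partial_deriv f j x) ^ CARD('n)))"

text \<open>The formal derivative, i.e. the matrix of partial derivatives. For an ACL map the partial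
  derivatives exist almost everywhere, whereas \<open>f\<close> need not be assumed (totally)
  differentiable; at points of differentiability it is the Jacobian matrix.\<close>

definition formal_deriv :: "(real^'n \<Rightarrow> real^'n) \<Rightarrow> real^'n \<Rightarrow> real^'n^'n" where
  "formal_deriv f x = (\<chi> i j. partial_deriv f j x $ i)"

definition min_stretch :: "real^'n^'n \<Rightarrow> real" where
  "min_stretch A = (INF v\<in>sphere 0 1. norm (A *v v))"

definition quasiconformal ::
  "real \<Rightarrow> (real^'n) set \<Rightarrow> (real^'n) set \<Rightarrow> (real^'n \<Rightarrow> real^'n) \<Rightarrow> bool" where
  "quasiconformal K G G' f \<longleftrightarrow> K \<ge> 1 \<and> (\<exists>g. homeomorphism G G' f g) \<and> ACLn_on G f \<and>
     (AE x in lebesgue_on G.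
        onorm ((*v) (formal_deriv f x)) ^ CARD('n) \<le> K * det (formal_deriv f x) \<and>
        det (formal_deriv f x) \<le> K * min_stretch (formal_deriv f x) ^ CARD('n))"

end

theory Submission
  imports Defs
begin

text \<open>Two steps along a chain inside \<open>B\<^sub>x\<close> turn weak uniform boundedness into
  \<open>osc f \<le> C d(f x)\<close> on \<open>B\<^sub>x\<close>, so \<open>f \<in> OC\<^sup>1\<close> gives \<open>d(x) |f'(x)| \<le> C d(f x)\<close>; integrating this along
  curves proves that \<open>f\<close> is Lipschitz for the quasihyperbolic metrics.

  For the lower bound it suffices that \<open>|f x - f y| \<le> t d(f x)\<close> forces \<open>|x - y| < d(x)/2\<close>, with
  \<open>t\<close> depending only on \<open>n\<close> and \<open>K\<close>. Compose \<open>f\<close> with a logarithmic cut-off function of a ring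
  around \<open>f x\<close>. By quasiconformality and change of variables the composition \<open>u\<close> has small
  \<open>n\<close>-energy when \<open>t\<close> is small. But if \<open>|x - y| \<ge> d(x)/2\<close>, then \<open>u\<close> equals \<open>1\<close> on a continuum
  joining \<open>x\<close> and \<open>y\<close>, and \<open>0\<close> on an unbounded connected set containing a boundary point nearest to
  \<open>x\<close> (the complement of a topological closed ball is connected). A Loewner type estimate, obtained
  by integrating along cones with vertices on these two sets, bounds the energy from below.\<close>

section \<open>Arc length\<close>

text \<open>The inverse of \<open>f\<close> need not be Lipschitz even locally (\<open>x |x|\<close>
  near the origin is C^1 and quasiconformal, with vanishing derivative there), so a lower bound
  linear in \<open>k_G\<close> can fail and an additive constant must appear. It comes from rounding
  when a curve in the image is cut into pieces of fixed quasihyperbolic length. For the same reason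
  the inverse is never differentiated: functions on the image are pulled back to \<open>G\<close>,
  where C^1 regularity gives the chain rule and the change of variables formula. Energies take the
  place of moduli of curve families because a function differentiable everywhere can be integrated
  along each single segment, without exceptional sets. A boundary point nearest to \<open>x\<close>
  makes the sizes of the two connected sets and their distance comparable with \<open>d(x)\<close>,
  as a scale invariant estimate requires. Dimension at least 2 enters twice: the energy of the
  cut-off, of order \<open>N^(1-n)\<close>, has to tend to 0, and removing a topological ball must
  not disconnect the space.\<close>

lemma inscribed_lengths_memI:
  assumes "mono_on {..m} t" "t ` {..m} \<subseteq> {a..b}"
  shows "(\<Sum>i<m. dist (g (t i)) (g (t (Suc i)))) \<in> inscribed_lengths g a b"
  using assms unfolding inscribed_lengths_def by blast

lemma inscribed_lengths_subset:
  assumes "{a..b} \<subseteq> {c..d}"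
  shows "inscribed_lengths g a b \<subseteq> inscribed_lengths g c d"
  using assms unfolding inscribed_lengths_def by (auto; blast)

lemma bdd_above_inscribed_lengths_subset:
  assumes "bdd_above (inscribed_lengths g c d)" "{a..b} \<subseteq> {c..d}"
  shows "bdd_above (inscribed_lengths g a b)"
  using bdd_above_mono[OF assms(1) inscribed_lengths_subset[OF assms(2)]] .

lemma zero_in_inscribed_lengths: "a \<le> b \<Longrightarrow> 0 \<in> inscribed_lengths g a b"
  using inscribed_lengths_memI[of 0 "\<lambda>_. a" a b g] by (simp add: mono_on_def)

lemma inscribed_sum_le_curve_length:
  assumes "bdd_above (inscribed_lengths g a b)" "mono_on {..m} t" "t ` {..m} \<subseteq> {a..b}"
  shows "(\<Sum>i<m. dist (g (t i)) (g (t (Suc i)))) \<le> curve_length g a b"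
  unfolding curve_length_def by (intro cSup_upper inscribed_lengths_memI assms)

lemma curve_length_nonneg:
  assumes "bdd_above (inscribed_lengths g a b)" "a \<le> b"
  shows "0 \<le> curve_length g a b"
  unfolding curve_length_def by (intro cSup_upper zero_in_inscribed_lengths assms)

lemma dist_le_curve_length:
  assumes "bdd_above (inscribed_lengths g a b)" "a \<le> b"
  shows "dist (g a) (g b) \<le> curve_length g a b"
proof -
  have "(\<Sum>i<1. dist (g ((\<lambda>i. if i = 0 then a else b) i)) (g ((\<lambda>i. if i = 0 then a else b) (Suc i))))
        \<le> curve_length g a b"
    by (rule inscribed_sum_le_curve_length) (use assms in \<open>auto simp: mono_on_def\<close>)
  then show ?thesis by simp
qed

lemma inscribed_lengths_le_increment:
  assumes "\<And>u v. a \<le> u \<Longrightarrow> u \<le> v \<Longrightarrow> v \<le> b \<Longrightarrow> dist (g u) (g v) \<le> \<phi> v - (\<phi> u :: real)"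
    and "\<And>u v. a \<le> u \<Longrightarrow> u \<le> v \<Longrightarrow> v \<le> b \<Longrightarrow> \<phi> u \<le> \<phi> v"
    and "x \<in> inscribed_lengths g a b"
  shows "x \<le> \<phi> b - \<phi> a"
proof -
  obtain m t where t: "mono_on {..m} t" "t ` {..m} \<subseteq> {a..b}"
    and x: "x = (\<Sum>i<(m::nat). dist (g (t i)) (g (t (Suc i))))"
    using assms(3) unfolding inscribed_lengths_def by blast
  have in_ab: "a \<le> t i" "t i \<le> b" if "i \<le> m" for i using t(2) that by auto
  have "x \<le> (\<Sum>i<m. \<phi> (t (Suc i)) - \<phi> (t i))"
    unfolding x by (intro sum_mono assms(1) in_ab) (use t(1) in \<open>auto intro: mono_onD\<close>)
  also have "\<dots> = \<phi> (t m) - \<phi> (t 0)" by (rule sum_lessThan_telescope)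
  also have "\<dots> \<le> \<phi> b - \<phi> a"
    using assms(2)[of "t m" b] assms(2)[of a "t 0"] in_ab[of 0] in_ab[of m] by auto
  finally show ?thesis .
qed

text \<open>\<open>\<phi>\<close> stands for an upper bound of the arc length up to a parameter. The
  choices made later are zero on a degenerate interval, a linear function for a Lipschitz curve, and
  a multiple of the arc length of the original curve for an image curve.\<close>

lemma curve_length_le_increment:
  assumes "\<And>u v. a \<le> u \<Longrightarrow> u \<le> v \<Longrightarrow> v \<le> b \<Longrightarrow> dist (g u) (g v) \<le> \<phi> v - (\<phi> u :: real)"
    and "a \<le> b"
  shows "bdd_above (inscribed_lengths g a b)" "curve_length g a b \<le> \<phi> b - \<phi> a"
proof -
  have mono: "\<phi> u \<le> \<phi> v" if "a \<le> u" "u \<le> v" "v \<le> b" for u v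
    using assms(1)[OF that] zero_le_dist[of "g u" "g v"] by linarith
  note * = inscribed_lengths_le_increment[of a b g \<phi>, OF assms(1) mono]
  show "bdd_above (inscribed_lengths g a b)"
    using * by (intro bdd_aboveI[of _ "\<phi> b - \<phi> a"]) auto
  show "curve_length g a b \<le> \<phi> b - \<phi> a"
    unfolding curve_length_def
    by (rule cSup_least) (use zero_in_inscribed_lengths[OF assms(2)] * in auto)
qed

section \<open>Splitting and concatenating subdivisions\<close>

lemma mono_on_min_max:
  fixes t :: "nat \<Rightarrow> real"
  assumes "mono_on A t"
  shows "mono_on A (\<lambda>i. min (t i) b)" "mono_on A (\<lambda>i. max (t i) b)"
  using assms unfolding mono_on_def by (meson min.mono max.mono order_refl)+

text \<open>Clamping the subdivision points to \<open>{a..b}\<close> and to \<open>{b..c}\<close> splits an inscribed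
  polygon without inserting a point into the subdivision.\<close>

lemma inscribed_sum_split:
  assumes "mono_on {..m} t"
  shows "(\<Sum>i<m. dist (g (t i)) (g (t (Suc i))))
    \<le> (\<Sum>i<m. dist (g (min (t i) b)) (g (min (t (Suc i)) b)))
      + (\<Sum>i<m. dist (g (max (t i) b)) (g (max (t (Suc i)) (b::real))))"
proof -
  have "dist (g (t i)) (g (t (Suc i))) \<le> dist (g (min (t i) b)) (g (min (t (Suc i)) b))
      + dist (g (max (t i) b)) (g (max (t (Suc i)) b))" if "i < m" for i
  proof -
    have "t i \<le> t (Suc i)" using assms that by (auto intro: mono_onD)
    then show ?thesis
      using dist_triangle[of "g (t i)" "g (t (Suc i))" "g b"]
      by (cases "t i \<le> b"; cases "t (Suc i) \<le> b") (auto simp: min_def max_def)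
  qed
  then show ?thesis by (subst sum.distrib[symmetric]) (auto intro: sum_mono)
qed

lemma inscribed_lengths_add_upper:
  assumes "bdd_above (inscribed_lengths g a b)" "bdd_above (inscribed_lengths g b c)"
    and "a \<le> b" "b \<le> c" "x \<in> inscribed_lengths g a c"
  shows "x \<le> curve_length g a b + curve_length g b c"
proof -
  obtain m t where t: "mono_on {..m} t" "t ` {..m} \<subseteq> {a..c}"
    and x: "x = (\<Sum>i<(m::nat). dist (g (t i)) (g (t (Suc i))))"
    using assms(5) unfolding inscribed_lengths_def by blast
  have "x \<le> (\<Sum>i<m. dist (g (min (t i) b)) (g (min (t (Suc i)) b)))
      + (\<Sum>i<m. dist (g (max (t i) b)) (g (max (t (Suc i)) b)))"
    unfolding x by (rule inscribed_sum_split[OF t(1)])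
  also have "\<dots> \<le> curve_length g a b + curve_length g b c"
  proof (rule add_mono)
    show "(\<Sum>i<m. dist (g (min (t i) b)) (g (min (t (Suc i)) b))) \<le> curve_length g a b"
      by (rule inscribed_sum_le_curve_length[of g a b m "\<lambda>i. min (t i) b"])
        (use assms mono_on_min_max[OF t(1)] t(2) in \<open>auto simp: image_subset_iff min_le_iff_disj\<close>)
    show "(\<Sum>i<m. dist (g (max (t i) b)) (g (max (t (Suc i)) b))) \<le> curve_length g b c"
      by (rule inscribed_sum_le_curve_length[of g b c m "\<lambda>i. max (t i) b"])
        (use assms mono_on_min_max[OF t(1)] t(2) in \<open>auto simp: image_subset_iff\<close>)
  qed
  finally show ?thesis .
qed

lemma bdd_above_inscribed_lengths_trans:
  assumes "bdd_above (inscribed_lengths g a b)" "bdd_above (inscribed_lengths g b c)"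
    and "a \<le> b" "b \<le> c"
  shows "bdd_above (inscribed_lengths g a c)"
  using inscribed_lengths_add_upper[OF assms] by (intro bdd_aboveI) auto

text \<open>Concatenation leaves an edge between the last point of one subdivision and the first
  point of the other. It only enlarges the sum, so an inequality is enough for suprema and neither
  subdivision has to contain \<open>b\<close>.\<close>

lemma inscribed_lengths_append:
  assumes "x \<in> inscribed_lengths g a b" "y \<in> inscribed_lengths g b c" "a \<le> b" "b \<le> c"
  obtains z where "z \<in> inscribed_lengths g a c" "x + y \<le> z"
proof -
  obtain m t where t: "mono_on {..m} t" "t ` {..m} \<subseteq> {a..b}"
    and x: "x = (\<Sum>i<(m::nat). dist (g (t i)) (g (t (Suc i))))"
    using assms(1) unfolding inscribed_lengths_def by blast
  obtain k s where s: "mono_on {..k} s" "s ` {..k} \<subseteq> {b..c}"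
    and y: "y = (\<Sum>i<(k::nat). dist (g (s i)) (g (s (Suc i))))"
    using assms(2) unfolding inscribed_lengths_def by blast
  \<comment> \<open>Index \<open>m\<close> holds the last point of \<open>t\<close> and
    \<open>Suc m\<close> the first point of \<open>s\<close>: the extra edge has index
    \<open>m\<close>, and there are \<open>Suc m + k\<close> edges in all.\<close>
  define r where "r i = (if i \<le> m then t i else s (i - Suc m))" for i
  define z where "z = (\<Sum>i<Suc m + k. dist (g (r i)) (g (r (Suc i))))"
  have t1: "a \<le> t i" "t i \<le> b" if "i \<le> m" for i using t(2) that by auto
  have s1: "b \<le> s i" "s i \<le> c" if "i \<le> k" for i using s(2) that by auto
  have mono: "mono_on {..Suc m + k} r"
  proof (rule mono_onI)
    fix i j assume ij: "i \<in> {..Suc m + k}" "j \<in> {..Suc m + k}" "i \<le> j"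
    consider "j \<le> m" | "i \<le> m" "\<not> j \<le> m" | "\<not> i \<le> m" by linarith
    then show "r i \<le> r j"
    proof cases
      case 1 then show ?thesis using ij mono_onD[OF t(1), of i j] by (simp add: r_def)
    next
      case 2 then show ?thesis using t1(2)[of i] s1(1)[of "j - Suc m"] ij by (force simp: r_def)
    next
      case 3 then show ?thesis using ij mono_onD[OF s(1), of "i - Suc m" "j - Suc m"]
        by (simp add: r_def diff_le_mono)
    qed
  qed
  have rng: "r ` {..Suc m + k} \<subseteq> {a..c}"
  proof (safe)
    fix i assume "i \<le> Suc m + k"
    then show "r i \<in> {a..c}" using t1[of i] s1[of "i - Suc m"] assms(3,4) by (cases "i \<le> m") (force simp: r_def)+
  qed
  have split: "(\<Sum>i<p + q. f i) = (\<Sum>i<p. f i) + (\<Sum>i<q. f (p + i))" for p q and f :: "nat \<Rightarrow> real"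
    by (induction q) auto
  have "z = (\<Sum>i<Suc m. dist (g (r i)) (g (r (Suc i)))) + (\<Sum>i<k. dist (g (r (Suc m + i))) (g (r (Suc (Suc m + i)))))"
    unfolding z_def by (rule split)
  also have "(\<Sum>i<k. dist (g (r (Suc m + i))) (g (r (Suc (Suc m + i))))) = y"
    unfolding y by (intro sum.cong) (auto simp: r_def)
  also have "(\<Sum>i<Suc m. dist (g (r i)) (g (r (Suc i)))) = x + dist (g (r m)) (g (r (Suc m)))"
    unfolding x by (auto simp: r_def intro!: sum.cong)
  finally have "x + y \<le> z" by simp
  moreover have "z \<in> inscribed_lengths g a c"
    unfolding z_def by (rule inscribed_lengths_memI[OF mono rng])
  ultimately show thesis by (intro that)
qed

lemma curve_length_add:
  assumes "bdd_above (inscribed_lengths g a c)" "a \<le> b" "b \<le> c"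
  shows "curve_length g a c = curve_length g a b + curve_length g b c"
proof (rule antisym)
  have bdd: "bdd_above (inscribed_lengths g a b)" "bdd_above (inscribed_lengths g b c)"
    using assms by (auto intro!: bdd_above_inscribed_lengths_subset[OF assms(1)])
  show "curve_length g a c \<le> curve_length g a b + curve_length g b c"
    unfolding curve_length_def[of g a c]
    by (rule cSup_least)
      (use zero_in_inscribed_lengths[of a c g] inscribed_lengths_add_upper[OF bdd assms(2,3)] assms in auto)
  have sum_le: "x + y \<le> curve_length g a c" if xy: "x \<in> inscribed_lengths g a b" "y \<in> inscribed_lengths g b c" for x y
  proof -
    obtain z where "z \<in> inscribed_lengths g a c" "x + y \<le> z"
      using inscribed_lengths_append[OF xy assms(2,3)] by blast
    then show ?thesis
      using cSup_upper[OF _ assms(1)] unfolding curve_length_def by fastforce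
  qed
  then have "x \<le> curve_length g a c - curve_length g b c" if "x \<in> inscribed_lengths g a b" for x
  proof -
    have "curve_length g b c \<le> curve_length g a c - x"
      unfolding curve_length_def[of g b c]
      using zero_in_inscribed_lengths[OF assms(3), of g] sum_le[OF that]
      by (intro cSup_least) (auto simp: le_diff_eq add.commute)
    then show ?thesis by simp
  qed
  then have "curve_length g a b \<le> curve_length g a c - curve_length g b c"
    unfolding curve_length_def[of g a b]
    by (intro cSup_least) (use zero_in_inscribed_lengths[of a b g] assms in auto)
  then show "curve_length g a b + curve_length g b c \<le> curve_length g a c" by simp
qed

lemma rectifiable_bdd:
  assumes "rectifiable g" "0 \<le> a" "b \<le> 1"
  shows "bdd_above (inscribed_lengths g a b)"
  by (rule bdd_above_inscribed_lengths_subset[of g 0 1]) (use assms in \<open>auto simp: rectifiable_def\<close>)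

lemma curve_length_diff:
  assumes "rectifiable g" "0 \<le> u" "u \<le> v" "v \<le> 1"
  shows "curve_length g 0 v - curve_length g 0 u = curve_length g u v"
  using curve_length_add[of g 0 v u] rectifiable_bdd[OF assms(1), of 0 v] assms by simp

lemma curve_length_refl: "curve_length g a a = 0"
proof -
  have "curve_length g a a \<le> 0 - 0"
    by (rule curve_length_le_increment(2)[where \<phi> = "\<lambda>_. 0"]) (auto dest: antisym)
  moreover have "bdd_above (inscribed_lengths g a a)"
    by (rule curve_length_le_increment(1)[where \<phi> = "\<lambda>_. 0"]) (auto dest: antisym)
  ultimately show ?thesis using curve_length_nonneg[of g a a] by simp
qed

lemma curve_length_mono:
  assumes "rectifiable g" "0 \<le> u" "u \<le> v" "v \<le> 1"
  shows "curve_length g 0 u \<le> curve_length g 0 v"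
  using curve_length_diff[OF assms] curve_length_nonneg[OF rectifiable_bdd, OF assms(1,2), of v] assms by simp

text \<open>A subdivision that is optimal up to \<open>\<epsilon>\<close> is, after clamping, optimal up to \<open>\<epsilon>\<close> on
  every \<open>{u..v}\<close>; as it has a fixed number \<open>m\<close> of edges, uniform continuity of the curve bounds
  the clamped polygon.\<close>

lemma continuous_on_curve_length:
  assumes g: "rectifiable g"
  shows "continuous_on {0..1} (curve_length g 0)"
proof -
  let ?s = "curve_length g 0"
  have bdd: "bdd_above (inscribed_lengths g 0 1)" using g by (simp add: rectifiable_def)
  have ucont: "uniformly_continuous_on {0..1} g"
    using g unfolding rectifiable_def path_def by (intro compact_uniformly_continuous) auto
  have small: "\<exists>\<delta>>0. \<forall>u\<ge>0. \<forall>v\<le>1. u \<le> v \<longrightarrow> v - u < \<delta> \<longrightarrow> ?s v - ?s u < \<epsilon>" if \<epsilon>: "\<epsilon> > 0" for \<epsilon>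
  proof -
    have "?s 1 - \<epsilon>/2 < Sup (inscribed_lengths g 0 1)" using \<epsilon> by (simp add: curve_length_def)
    then obtain x where x: "x \<in> inscribed_lengths g 0 1" "?s 1 - \<epsilon>/2 < x"
      using less_cSupD[of "inscribed_lengths g 0 1" "?s 1 - \<epsilon>/2"] zero_in_inscribed_lengths[of 0 1 g] by auto
    then obtain m t where t: "mono_on {..m} t" "t ` {..m} \<subseteq> {0..1}"
      and xs: "x = (\<Sum>i<(m::nat). dist (g (t i)) (g (t (Suc i))))"
      unfolding inscribed_lengths_def by blast
    \<comment> \<open>One half of \<open>\<epsilon>\<close> pays for the defect of the subdivision,
      the other half is shared by its \<open>m\<close> edges; \<open>m + 1\<close> avoids a division
      by zero.\<close>
    define \<eta> where "\<eta> = \<epsilon> / (2 * (real m + 1))"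
    have "\<eta> > 0" using \<epsilon> by (simp add: \<eta>_def)
    then obtain \<delta> where \<delta>: "\<delta> > 0" "\<And>u v. u \<in> {0..1} \<Longrightarrow> v \<in> {0..1} \<Longrightarrow> dist u v < \<delta> \<Longrightarrow> dist (g u) (g v) < \<eta>"
      using ucont unfolding uniformly_continuous_on_def by metis
    have "?s v - ?s u < \<epsilon>" if uv: "0 \<le> u" "v \<le> 1" "u \<le> v" "v - u < \<delta>" for u v
    proof -
      define p where "p i = min (t i) u" for i
      define q where "q i = max (t i) u" for i
      have ti: "0 \<le> t i" "t i \<le> 1" if "i \<le> m" for i using t(2) that by auto
      have tm: "t i \<le> t j" if "i \<le> j" "j \<le> m" for i j using t(1) that by (auto intro: mono_onD)
      have qm: "mono_on {..m} q" unfolding q_def by (rule mono_on_min_max[OF t(1)])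
      have 1: "x \<le> (\<Sum>i<m. dist (g (p i)) (g (p (Suc i)))) + (\<Sum>i<m. dist (g (q i)) (g (q (Suc i))))"
        unfolding xs p_def q_def by (rule inscribed_sum_split[OF t(1)])
      have 2: "(\<Sum>i<m. dist (g (q i)) (g (q (Suc i)))) \<le>
          (\<Sum>i<m. dist (g (min (q i) v)) (g (min (q (Suc i)) v)))
         + (\<Sum>i<m. dist (g (max (q i) v)) (g (max (q (Suc i)) v)))"
        by (rule inscribed_sum_split[OF qm])
      have 3: "(\<Sum>i<m. dist (g (p i)) (g (p (Suc i)))) \<le> curve_length g 0 u"
        by (rule inscribed_sum_le_curve_length[OF rectifiable_bdd[OF g]])
          (use uv ti mono_on_min_max[OF t(1)] in \<open>auto simp: p_def[abs_def] image_subset_iff min_le_iff_disj\<close>)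
      have 4: "(\<Sum>i<m. dist (g (max (q i) v)) (g (max (q (Suc i)) v))) \<le> curve_length g v 1"
        by (rule inscribed_sum_le_curve_length[OF rectifiable_bdd[OF g], of v 1 m "\<lambda>i. max (q i) v"])
          (use uv ti mono_on_min_max[OF qm] in \<open>auto simp: q_def image_subset_iff\<close>)
      have 5: "(\<Sum>i<m. dist (g (min (q i) v)) (g (min (q (Suc i)) v))) \<le> (\<Sum>i<m. \<eta>)"
      proof (rule sum_mono)
        fix i assume "i \<in> {..<m}"
        have "u \<le> min (q j) v" "min (q j) v \<le> v" for j using uv by (auto simp: q_def)
        from this[of i] this[of "Suc i"] show "dist (g (min (q i) v)) (g (min (q (Suc i)) v)) \<le> \<eta>"
          using uv by (intro less_imp_le[OF \<delta>(2)]) (auto simp: dist_real_def abs_if)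
      qed
      have 6: "(\<Sum>i<m. \<eta>) \<le> \<epsilon>/2" using \<epsilon> by (simp add: \<eta>_def field_simps)
      have 7: "curve_length g v 1 = ?s 1 - ?s v" using curve_length_diff[OF g, of v 1] uv by simp
      \<comment> \<open>Altogether \<open>?s 1 - \<epsilon>/2 < x \<le> ?s u + \<epsilon>/2 + (?s 1
        - ?s v)\<close>.\<close>
      show ?thesis using 1 2 3 4 5 6 7 x(2) by linarith
    qed
    then show ?thesis using \<delta>(1) by blast
  qed
  show ?thesis
    unfolding continuous_on_iff
  proof (intro ballI allI impI)
    fix x \<epsilon> :: real assume x: "x \<in> {0..1}" and "\<epsilon> > 0"
    from small[OF this(2)] obtain \<delta> where "\<delta> > 0"
      and \<delta>': "\<forall>u\<ge>0. \<forall>v\<le>1. u \<le> v \<longrightarrow> v - u < \<delta> \<longrightarrow> ?s v - ?s u < \<epsilon>"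
      by blast
    then have \<delta>: "\<delta> > 0" "\<And>u v. 0 \<le> u \<Longrightarrow> v \<le> 1 \<Longrightarrow> u \<le> v \<Longrightarrow> v - u < \<delta> \<Longrightarrow> ?s v - ?s u < \<epsilon>"
      by simp_all
    have "dist (?s y) (?s x) < \<epsilon>" if "y \<in> {0..1}" "dist y x < \<delta>" for y
    proof (cases "x \<le> y")
      case True
      then show ?thesis using \<delta>(2)[of x y] curve_length_mono[OF g, of x y] x that by (auto simp: dist_real_def)
    next
      case False
      then show ?thesis using \<delta>(2)[of y x] curve_length_mono[OF g, of y x] x that by (auto simp: dist_real_def)
    qed
    then show "\<exists>d>0. \<forall>y\<in>{0..1}. dist y x < d \<longrightarrow> dist (?s y) (?s x) < \<epsilon>" using \<delta>(1) by blast
  qed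
qed

lemma arc_length_param_curve_length:
  assumes g: "rectifiable g" and t: "t \<in> {0..1}"
  shows "arc_length_param g (curve_length g 0 t) = g t"
proof -
  define r where "r = (SOME r. r \<in> {0..1} \<and> curve_length g 0 r = curve_length g 0 t)"
  have r: "r \<in> {0..1}" "curve_length g 0 r = curve_length g 0 t"
    using someI[of "\<lambda>r. r \<in> {0..1} \<and> curve_length g 0 r = curve_length g 0 t" t] t unfolding r_def by auto
  \<comment> \<open>Equal arc length at \<open>u \<le> v\<close> leaves length zero between them, so
    the chord vanishes.\<close>
  have "g u = g v" if "0 \<le> u" "u \<le> v" "v \<le> 1" "curve_length g 0 u = curve_length g 0 v" for u v
    using curve_length_diff[OF g that(1-3)] dist_le_curve_length[OF rectifiable_bdd[OF g that(1,3)] that(2)] that(4)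
    by simp
  from this[of r t] this[of t r] r t have "g r = g t" by (metis atLeastAtMost_iff linear)
  then show ?thesis unfolding arc_length_param_def r_def by simp
qed

lemma curve_length_onto:
  assumes "rectifiable g" "\<sigma> \<in> {0..curve_length g 0 1}"
  obtains t where "t \<in> {0..1}" "curve_length g 0 t = \<sigma>"
  using IVT'[of "curve_length g 0" 0 \<sigma> 1] continuous_on_curve_length[OF assms(1)] assms(2)
  by (auto simp: curve_length_refl)

lemma arc_length_param_lipschitz:
  assumes g: "rectifiable g" and "\<sigma> \<in> {0..curve_length g 0 1}" "\<tau> \<in> {0..curve_length g 0 1}"
  shows "dist (arc_length_param g \<sigma>) (arc_length_param g \<tau>) \<le> dist \<sigma> \<tau>"
proof -
  obtain u v where uv: "u \<in> {0..1}" "curve_length g 0 u = \<sigma>" "v \<in> {0..1}" "curve_length g 0 v = \<tau>"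
    using curve_length_onto[OF g] assms(2,3) by metis
  have "dist (g u) (g v) \<le> dist (curve_length g 0 u) (curve_length g 0 v)"
    if "0 \<le> u" "u \<le> v" "v \<le> 1" for u v
    using curve_length_diff[OF g that(1-3)] dist_le_curve_length[OF rectifiable_bdd[OF g that(1,3)] that(2)]
    by (simp add: dist_real_def)
  from this[of u v] this[of v u] uv show ?thesis
    using arc_length_param_curve_length[OF g, of u] arc_length_param_curve_length[OF g, of v]
    by (cases "u \<le> v") (auto simp: dist_commute)
qed

lemma continuous_on_arc_length_param:
  assumes "rectifiable g"
  shows "continuous_on {0..curve_length g 0 1} (arc_length_param g)"
  unfolding continuous_on_iff
  using arc_length_param_lipschitz[OF assms] by (meson dist_commute le_less_trans)

lemma arc_length_param_image:
  assumes "rectifiable g"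
  shows "arc_length_param g ` {0..curve_length g 0 1} \<subseteq> path_image g"
proof
  fix z assume "z \<in> arc_length_param g ` {0..curve_length g 0 1}"
  then obtain \<sigma> where "\<sigma> \<in> {0..curve_length g 0 1}" "z = arc_length_param g \<sigma>" by blast
  then show "z \<in> path_image g"
    using curve_length_onto[OF assms] arc_length_param_curve_length[OF assms]
    by (metis imageI path_image_def)
qed

section \<open>Curve integrals\<close>

text \<open>Its increments are the integrals over subarcs, so a subarc can be measured without a
  parametrisation of its own.\<close>

definition partial_curve_integral :: "(real \<Rightarrow> 'a::euclidean_space) \<Rightarrow> ('a \<Rightarrow> real) \<Rightarrow> real \<Rightarrow> real" where
  "partial_curve_integral g \<rho> t = integral {0..curve_length g 0 t} (\<lambda>s. \<rho> (arc_length_param g s))"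

lemma partial_curve_integral_0 [simp]: "partial_curve_integral g \<rho> 0 = 0"
  by (simp add: partial_curve_integral_def curve_length_refl)

lemma partial_curve_integral_1 [simp]: "partial_curve_integral g \<rho> 1 = curve_integral g \<rho>"
  by (simp add: partial_curve_integral_def curve_integral_def)

lemma partial_curve_integral_increment:
  assumes g: "rectifiable g" and \<rho>: "continuous_on (path_image g) \<rho>"
    and uv: "0 \<le> u" "u \<le> v" "v \<le> 1"
  shows "(\<And>t. u \<le> t \<Longrightarrow> t \<le> v \<Longrightarrow> \<rho> (g t) \<le> M) \<Longrightarrow>
      partial_curve_integral g \<rho> v - partial_curve_integral g \<rho> u \<le> M * curve_length g u v"
    and "(\<And>t. u \<le> t \<Longrightarrow> t \<le> v \<Longrightarrow> M \<le> \<rho> (g t)) \<Longrightarrow>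
      M * curve_length g u v \<le> partial_curve_integral g \<rho> v - partial_curve_integral g \<rho> u"
proof -
  let ?s = "curve_length g 0" and ?h = "\<lambda>s. \<rho> (arc_length_param g s)"
  have s: "0 \<le> ?s u" "?s u \<le> ?s v" "?s v \<le> ?s 1"
    using curve_length_mono[OF g, of 0 u] curve_length_mono[OF g, of u v]
      curve_length_mono[OF g, of v 1] uv by (auto simp: curve_length_refl)
  have cont: "continuous_on {0..?s 1} ?h"
    using continuous_on_compose2[OF \<rho> continuous_on_arc_length_param[OF g] arc_length_param_image[OF g]] .
  have int0: "?h integrable_on {0..?s v}" and int: "?h integrable_on {?s u..?s v}"
    using s by (auto intro!: integrable_continuous_real continuous_on_subset[OF cont])
  have diff: "partial_curve_integral g \<rho> v - partial_curve_integral g \<rho> u = integral {?s u..?s v} ?h"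
    using Henstock_Kurzweil_Integration.integral_combine[OF s(1,2) int0] by (simp add: partial_curve_integral_def)
  have len: "curve_length g u v = ?s v - ?s u" using curve_length_diff[OF g uv] by simp
  have val: "\<exists>t. u \<le> t \<and> t \<le> v \<and> ?h \<sigma> = \<rho> (g t)" if \<sigma>: "\<sigma> \<in> {?s u..?s v}" for \<sigma>
  proof -
    have "continuous_on {u..v} ?s"
      using continuous_on_curve_length[OF g] by (rule continuous_on_subset) (use uv in auto)
    then obtain t where "u \<le> t" "t \<le> v" "?s t = \<sigma>"
      using IVT'[of ?s u \<sigma> v] \<sigma> uv by auto
    then show ?thesis using arc_length_param_curve_length[OF g, of t] uv by auto
  qed
  show "partial_curve_integral g \<rho> v - partial_curve_integral g \<rho> u \<le> M * curve_length g u v"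
    if "\<And>t. u \<le> t \<Longrightarrow> t \<le> v \<Longrightarrow> \<rho> (g t) \<le> M"
  proof -
    have "integral {?s u..?s v} ?h \<le> integral {?s u..?s v} (\<lambda>_. M)"
      by (rule integral_le[OF int]) (use val that in fastforce)+
    then show ?thesis using s(2) by (simp add: diff len mult.commute)
  qed
  show "M * curve_length g u v \<le> partial_curve_integral g \<rho> v - partial_curve_integral g \<rho> u"
    if "\<And>t. u \<le> t \<Longrightarrow> t \<le> v \<Longrightarrow> M \<le> \<rho> (g t)"
  proof -
    have "integral {?s u..?s v} (\<lambda>_. M) \<le> integral {?s u..?s v} ?h"
      by (rule integral_le[OF _ int]) (use val that in fastforce)+
    then show ?thesis using s(2) by (simp add: diff len mult.commute)
  qed
qed

text \<open>An inequality between increments passes from two adjacent intervals to their union, so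
  bisection extends it from small intervals to all of \<open>{a..b}\<close>. No differentiability is
  involved; arc length as a function of the parameter need not have it.\<close>

lemma local_increment_le:
  fixes \<Phi> \<Psi> :: "real \<Rightarrow> real"
  assumes "a \<le> b"
    and "\<And>t. a \<le> t \<Longrightarrow> t \<le> b \<Longrightarrow> \<exists>\<delta>>0. \<forall>u v. a \<le> u \<and> u \<le> t \<and> t \<le> v \<and> v \<le> b \<and> v - u < \<delta> \<longrightarrow> \<Phi> v - \<Phi> u \<le> \<Psi> v - \<Psi> u"
  shows "\<Phi> b - \<Phi> a \<le> \<Psi> b - \<Psi> a"
proof -
  have "a \<le> a \<and> b \<le> b \<longrightarrow> \<Phi> b - \<Phi> a \<le> \<Psi> b - \<Psi> a"
  proof (rule Bolzano[OF assms(1), where P = "\<lambda>u v. a \<le> u \<and> v \<le> b \<longrightarrow> \<Phi> v - \<Phi> u \<le> \<Psi> v - \<Psi> u"])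
    fix t assume "a \<le> t" "t \<le> b"
    from assms(2)[OF this] show "\<exists>d>0. \<forall>u v. u \<le> t \<and> t \<le> v \<and> v - u < d \<longrightarrow>
        a \<le> u \<and> v \<le> b \<longrightarrow> \<Phi> v - \<Phi> u \<le> \<Psi> v - \<Psi> u"
      by (elim exE conjE, intro exI conjI) (assumption, blast)
  qed auto
  then show ?thesis by simp
qed

lemma path_locally_near:
  fixes \<rho> :: "'a::euclidean_space \<Rightarrow> real"
  assumes "path g" "continuous_on (path_image g) \<rho>" "t \<in> {0..1}" "\<epsilon> > 0"
  shows "\<exists>\<delta>>0. \<forall>r\<in>{0..1}. \<bar>r - t\<bar> < \<delta> \<longrightarrow> \<bar>\<rho> (g r) - \<rho> (g t)\<bar> < \<epsilon>"
proof -
  have "continuous_on {0..1} (\<lambda>r. \<rho> (g r))"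
    using continuous_on_compose2[OF assms(2)] assms(1) by (auto simp: path_def path_image_def)
  then show ?thesis using assms(3,4) unfolding continuous_on_iff dist_real_def by blast
qed

text \<open>This is \<open>dI = \<rho> ds\<close> without derivatives, for short intervals
  containing \<open>t\<close>, which is the form that bisection asks for.\<close>

lemma partial_curve_integral_local_le:
  assumes g: "rectifiable g" and \<rho>: "continuous_on (path_image g) \<rho>" and t: "t \<in> {0..1}" and \<epsilon>: "\<epsilon> > 0"
  shows "\<exists>\<delta>>0. \<forall>u v. 0 \<le> u \<and> u \<le> t \<and> t \<le> v \<and> v \<le> 1 \<and> v - u < \<delta> \<longrightarrow>
    partial_curve_integral g \<rho> v - partial_curve_integral g \<rho> u \<le> (\<rho> (g t) + \<epsilon>) * curve_length g u v
    \<and> (\<rho> (g t) - \<epsilon>) * curve_length g u v \<le> partial_curve_integral g \<rho> v - partial_curve_integral g \<rho> u"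
proof -
  have "path g" using g by (simp add: rectifiable_def)
  then obtain \<delta> where \<delta>: "\<delta> > 0" "\<And>r. r \<in> {0..1} \<Longrightarrow> \<bar>r - t\<bar> < \<delta> \<Longrightarrow> \<bar>\<rho> (g r) - \<rho> (g t)\<bar> < \<epsilon>"
    using path_locally_near[OF _ \<rho> t \<epsilon>] by blast
  show ?thesis
  proof (intro exI[of _ \<delta>] conjI allI impI \<delta>(1))
    fix u v assume uv: "0 \<le> u \<and> u \<le> t \<and> t \<le> v \<and> v \<le> 1 \<and> v - u < \<delta>"
    have *: "\<rho> (g r) \<le> \<rho> (g t) + \<epsilon>" "\<rho> (g t) - \<epsilon> \<le> \<rho> (g r)" if "u \<le> r" "r \<le> v" for r
    proof -
      have "r \<in> {0..1}" "\<bar>r - t\<bar> < \<delta>" using that uv by auto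
      from \<delta>(2)[OF this] show "\<rho> (g r) \<le> \<rho> (g t) + \<epsilon>" "\<rho> (g t) - \<epsilon> \<le> \<rho> (g r)" by auto
    qed
    show "partial_curve_integral g \<rho> v - partial_curve_integral g \<rho> u \<le> (\<rho> (g t) + \<epsilon>) * curve_length g u v"
      by (rule partial_curve_integral_increment(1)[OF g \<rho>]) (use uv * in auto)
    show "(\<rho> (g t) - \<epsilon>) * curve_length g u v \<le> partial_curve_integral g \<rho> v - partial_curve_integral g \<rho> u"
      by (rule partial_curve_integral_increment(2)[OF g \<rho>]) (use uv * in auto)
  qed
qed

text \<open>The curve integral dominates every function on the parameter interval whose increments
  are infinitesimally bounded by \<open>\<rho> ds\<close>. All changes of the curve (images, reparametrisations,
  concatenations) are handled through this principle.\<close>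

lemma increment_le_curve_integral:
  assumes g: "rectifiable g" and \<rho>: "continuous_on (path_image g) \<rho>"
    and \<Phi>: "\<And>t \<epsilon>. 0 \<le> t \<Longrightarrow> t \<le> 1 \<Longrightarrow> 0 < \<epsilon> \<Longrightarrow> \<exists>\<delta>>0. \<forall>u v. 0 \<le> u \<and> u \<le> t \<and> t \<le> v \<and> v \<le> 1 \<and> v - u < \<delta> \<longrightarrow>
      \<Phi> v - \<Phi> u \<le> (\<rho> (g t) + \<epsilon>) * curve_length g u v"
  shows "\<Phi> 1 - \<Phi> 0 \<le> curve_integral g \<rho>"
proof -
  let ?L = "curve_length g 0 1"
  have *: "\<Phi> 1 - \<Phi> 0 \<le> curve_integral g \<rho> + 2 * \<epsilon> * ?L" if \<epsilon>: "\<epsilon> > 0" for \<epsilon>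
  proof -
    \<comment> \<open>One \<open>\<epsilon>\<close> comes from the hypothesis on
      \<open>\<Phi>\<close>, the other from the local lower bound of the integral.\<close>
    have "\<Phi> 1 - \<Phi> 0 \<le> (partial_curve_integral g \<rho> 1 + 2 * \<epsilon> * curve_length g 0 1)
       - (partial_curve_integral g \<rho> 0 + 2 * \<epsilon> * curve_length g 0 0)"
    proof (rule local_increment_le)
      fix t :: real assume t: "0 \<le> t" "t \<le> 1"
      obtain \<delta>1 where \<delta>1: "\<delta>1 > 0" "\<And>u v. 0 \<le> u \<and> u \<le> t \<and> t \<le> v \<and> v \<le> 1 \<and> v - u < \<delta>1 \<Longrightarrow>
          \<Phi> v - \<Phi> u \<le> (\<rho> (g t) + \<epsilon>) * curve_length g u v"
        using \<Phi>[OF t \<epsilon>] by blast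
      obtain \<delta>2 where \<delta>2: "\<delta>2 > 0" "\<And>u v. 0 \<le> u \<and> u \<le> t \<and> t \<le> v \<and> v \<le> 1 \<and> v - u < \<delta>2 \<Longrightarrow>
          (\<rho> (g t) - \<epsilon>) * curve_length g u v \<le> partial_curve_integral g \<rho> v - partial_curve_integral g \<rho> u"
        using partial_curve_integral_local_le[OF g \<rho> _ \<epsilon>, of t] t by auto
      show "\<exists>\<delta>>0. \<forall>u v. 0 \<le> u \<and> u \<le> t \<and> t \<le> v \<and> v \<le> 1 \<and> v - u < \<delta> \<longrightarrow>
          \<Phi> v - \<Phi> u \<le> (partial_curve_integral g \<rho> v + 2 * \<epsilon> * curve_length g 0 v)
            - (partial_curve_integral g \<rho> u + 2 * \<epsilon> * curve_length g 0 u)"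
      proof (intro exI[of _ "min \<delta>1 \<delta>2"] conjI allI impI)
        fix u v assume uv: "0 \<le> u \<and> u \<le> t \<and> t \<le> v \<and> v \<le> 1 \<and> v - u < min \<delta>1 \<delta>2"
        then have "\<Phi> v - \<Phi> u \<le> (\<rho> (g t) - \<epsilon>) * curve_length g u v + 2 * \<epsilon> * curve_length g u v"
          using \<delta>1(2)[of u v] by (simp add: algebra_simps)
        also have "\<dots> \<le> (partial_curve_integral g \<rho> v - partial_curve_integral g \<rho> u) + 2 * \<epsilon> * curve_length g u v"
          using \<delta>2(2)[of u v] uv by simp
        also have "curve_length g u v = curve_length g 0 v - curve_length g 0 u"
          using curve_length_diff[OF g, of u v] uv by simp
        finally show "\<Phi> v - \<Phi> u \<le> (partial_curve_integral g \<rho> v + 2 * \<epsilon> * curve_length g 0 v)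
            - (partial_curve_integral g \<rho> u + 2 * \<epsilon> * curve_length g 0 u)"
          by (simp add: algebra_simps)
      qed (use \<delta>1 \<delta>2 in auto)
    qed simp
    then show ?thesis by (simp add: curve_length_refl)
  qed
  have L: "?L \<ge> 0" using curve_length_nonneg[OF rectifiable_bdd[OF g]] by simp
  show ?thesis
  proof (rule field_le_epsilon)
    fix e :: real assume "e > 0"
    then have "2 * (e / (2 * (?L + 1))) * ?L \<le> e" using L by (simp add: field_simps)
    then show "\<Phi> 1 - \<Phi> 0 \<le> curve_integral g \<rho> + e"
      using *[of "e / (2 * (?L + 1))"] \<open>e > 0\<close> L by (smt (verit, best) divide_pos_pos)
  qed
qed

lemma curve_integral_bounds:
  assumes "rectifiable g" "continuous_on (path_image g) \<rho>"
  shows "(\<And>z. z \<in> path_image g \<Longrightarrow> \<rho> z \<le> M) \<Longrightarrow> curve_integral g \<rho> \<le> M * curve_length g 0 1"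
    and "(\<And>z. z \<in> path_image g \<Longrightarrow> 0 \<le> \<rho> z) \<Longrightarrow> 0 \<le> curve_integral g \<rho>"
  using partial_curve_integral_increment(1)[OF assms, of 0 1 M]
    partial_curve_integral_increment(2)[OF assms, of 0 1 0]
  by (auto simp: path_image_def)

section \<open>Reparametrisation, concatenation and images of curves\<close>

lemma curve_length_compose_le:
  assumes g: "bdd_above (inscribed_lengths g (\<phi> a) (\<phi> b))" and "mono_on {a..b} \<phi>" "a \<le> b"
  shows "curve_length (\<lambda>t. g (\<phi> t)) a b \<le> curve_length g (\<phi> a) (\<phi> b)"
    and "bdd_above (inscribed_lengths (\<lambda>t. g (\<phi> t)) a b)"
proof -
  have "x \<in> inscribed_lengths g (\<phi> a) (\<phi> b)" if x: "x \<in> inscribed_lengths (\<lambda>t. g (\<phi> t)) a b" for x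
  proof -
    obtain m t where t: "mono_on {..m} t" "t ` {..m} \<subseteq> {a..b}"
      and xs: "x = (\<Sum>i<(m::nat). dist (g (\<phi> (t i))) (g (\<phi> (t (Suc i)))))"
      using x unfolding inscribed_lengths_def by blast
    show ?thesis unfolding xs
    proof (rule inscribed_lengths_memI[of m "\<lambda>i. \<phi> (t i)"])
      show "mono_on {..m} (\<lambda>i. \<phi> (t i))"
      proof (rule mono_onI)
        fix r s assume "r \<in> {..m}" "s \<in> {..m}" "r \<le> s"
        then show "\<phi> (t r) \<le> \<phi> (t s)"
          using t by (intro mono_onD[OF assms(2)] mono_onD[OF t(1)]) (auto simp: image_subset_iff)
      qed
      show "(\<lambda>i. \<phi> (t i)) ` {..m} \<subseteq> {\<phi> a..\<phi> b}"
        using t(2) assms(3) by (auto simp: image_subset_iff intro!: mono_onD[OF assms(2)])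
    qed
  qed
  then have sub: "inscribed_lengths (\<lambda>t. g (\<phi> t)) a b \<subseteq> inscribed_lengths g (\<phi> a) (\<phi> b)" by blast
  then show "bdd_above (inscribed_lengths (\<lambda>t. g (\<phi> t)) a b)" using g by (rule bdd_above_mono[rotated])
  show "curve_length (\<lambda>t. g (\<phi> t)) a b \<le> curve_length g (\<phi> a) (\<phi> b)"
    unfolding curve_length_def using zero_in_inscribed_lengths[OF assms(3), of "\<lambda>t. g (\<phi> t)"] sub g
    by (intro cSup_subset_mono) auto
qed

lemma inscribed_lengths_cong:
  assumes "\<And>t. a \<le> t \<Longrightarrow> t \<le> b \<Longrightarrow> g t = h t"
  shows "inscribed_lengths g a b = inscribed_lengths h a b"
proof -
  have "inscribed_lengths g a b \<subseteq> inscribed_lengths h a b"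
    if eq: "\<And>t. a \<le> t \<Longrightarrow> t \<le> b \<Longrightarrow> g t = h t" for g h :: "real \<Rightarrow> 'a"
  proof
    fix x assume "x \<in> inscribed_lengths g a b"
    then obtain m t where t: "mono_on {..m} t" "t ` {..m} \<subseteq> {a..b}"
      and x: "x = (\<Sum>i<(m::nat). dist (g (t i)) (g (t (Suc i))))"
      unfolding inscribed_lengths_def by blast
    have "g (t i) = h (t i)" if "i \<le> m" for i using t(2) that by (intro eq) auto
    then have "x = (\<Sum>i<m. dist (h (t i)) (h (t (Suc i))))" unfolding x by simp
    then show "x \<in> inscribed_lengths h a b" using inscribed_lengths_memI[OF t] by simp
  qed
  from this[of g h] this[of h g] assms show ?thesis by force
qed

text \<open>\<open>P\<close> runs through \<open>g\<close> at double speed on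
  \<open>{b..b + 1/2}\<close>; \<open>b = 0\<close> and \<open>b = 1/2\<close> are the two halves of
  a joined path. The increments of the integral along \<open>P\<close> are fed into the domination
  principle for \<open>g\<close>, after comparing the lengths of corresponding subarcs by
  reparametrisation.\<close>

lemma curve_integral_subarc_le:
  assumes P: "rectifiable P" and g: "rectifiable g" and \<rho>: "continuous_on (path_image P) \<rho>"
    and nn: "\<And>z. z \<in> path_image P \<Longrightarrow> 0 \<le> \<rho> z"
    and b: "0 \<le> b" "b \<le> 1/2"
    and P_g: "\<And>t. t \<in> {0..1} \<Longrightarrow> P (b + t / 2) = g t"
  shows "partial_curve_integral P \<rho> (b + 1/2) - partial_curve_integral P \<rho> b \<le> curve_integral g \<rho>"
proof -
  have sub: "path_image g \<subseteq> path_image P"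
  proof
    fix z assume "z \<in> path_image g"
    then obtain t where "t \<in> {0..1}" "z = g t" by (auto simp: path_image_def)
    then show "z \<in> path_image P" using P_g[of t] b unfolding path_image_def
      by (intro image_eqI[of _ _ "b + t/2"]) auto
  qed
  have "partial_curve_integral P \<rho> (b + 1 / 2) - partial_curve_integral P \<rho> (b + 0 / 2) \<le> curve_integral g \<rho>"
  proof (rule increment_le_curve_integral[OF g continuous_on_subset[OF \<rho> sub]])
    fix t \<epsilon> :: real assume t: "0 \<le> t" "t \<le> 1" and \<epsilon>: "0 < \<epsilon>"
    have t': "b + t/2 \<in> {0..1}" using t b by auto
    obtain \<delta> where \<delta>: "\<delta> > 0" "\<And>u v. 0 \<le> u \<and> u \<le> b + t/2 \<and> b + t/2 \<le> v \<and> v \<le> 1 \<and> v - u < \<delta> \<Longrightarrow>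
        partial_curve_integral P \<rho> v - partial_curve_integral P \<rho> u \<le> (\<rho> (P (b + t/2)) + \<epsilon>) * curve_length P u v"
      using partial_curve_integral_local_le[OF P \<rho> t' \<epsilon>] by blast
    show "\<exists>\<delta>>0. \<forall>u v. 0 \<le> u \<and> u \<le> t \<and> t \<le> v \<and> v \<le> 1 \<and> v - u < \<delta> \<longrightarrow>
        partial_curve_integral P \<rho> (b + v / 2) - partial_curve_integral P \<rho> (b + u / 2) \<le> (\<rho> (g t) + \<epsilon>) * curve_length g u v"
    proof (intro exI[of _ \<delta>] conjI allI impI \<delta>(1))
      fix u v assume uv: "0 \<le> u \<and> u \<le> t \<and> t \<le> v \<and> v \<le> 1 \<and> v - u < \<delta>"
      have "partial_curve_integral P \<rho> (b + v/2) - partial_curve_integral P \<rho> (b + u/2)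
          \<le> (\<rho> (g t) + \<epsilon>) * curve_length P (b + u/2) (b + v/2)"
        using \<delta>(2)[of "b + u/2" "b + v/2"] uv b P_g[of t] t by auto
      also have "\<dots> \<le> (\<rho> (g t) + \<epsilon>) * curve_length g u v"
      proof (rule mult_left_mono)
        let ?\<phi> = "\<lambda>s. 2 * (s - b)"
        have "curve_length P (b + u/2) (b + v/2) = curve_length (\<lambda>s. g (?\<phi> s)) (b + u/2) (b + v/2)"
          unfolding curve_length_def
        proof (intro arg_cong[of _ _ Sup] inscribed_lengths_cong)
          fix s assume "b + u/2 \<le> s" "s \<le> b + v/2"
          then show "P s = g (?\<phi> s)" using P_g[of "?\<phi> s"] uv by (auto simp: field_simps)
        qed
        also have "\<dots> \<le> curve_length g (?\<phi> (b + u/2)) (?\<phi> (b + v/2))"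
          by (rule curve_length_compose_le(1)) (use uv rectifiable_bdd[OF g, of u v] in \<open>auto simp: mono_on_def\<close>)
        finally show "curve_length P (b + u/2) (b + v/2) \<le> curve_length g u v" by simp
        have "g t \<in> path_image P" using t sub by (auto simp: path_image_def)
        then show "0 \<le> \<rho> (g t) + \<epsilon>" using nn \<epsilon> by (simp add: add_nonneg_nonneg)
      qed
      finally show "partial_curve_integral P \<rho> (b + v / 2) - partial_curve_integral P \<rho> (b + u / 2) \<le> (\<rho> (g t) + \<epsilon>) * curve_length g u v" .
    qed
  qed
  then show ?thesis by simp
qed

lemma rectifiable_join:
  assumes g: "rectifiable g" and h: "rectifiable h" and "pathfinish g = pathstart h"
  shows "rectifiable (g +++ h)"
proof -
  have "bdd_above (inscribed_lengths (\<lambda>t. g (2 * t)) 0 (1/2))"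
    by (rule curve_length_compose_le(2)) (use rectifiable_bdd[OF g] in \<open>auto simp: mono_on_def\<close>)
  moreover have "inscribed_lengths (\<lambda>t. g (2 * t)) 0 (1/2) = inscribed_lengths (g +++ h) 0 (1/2)"
    by (rule inscribed_lengths_cong) (auto simp: joinpaths_def)
  moreover have "bdd_above (inscribed_lengths (\<lambda>t. h (2 * t - 1)) (1/2) 1)"
    by (rule curve_length_compose_le(2)) (use rectifiable_bdd[OF h] in \<open>auto simp: mono_on_def\<close>)
  moreover have "inscribed_lengths (\<lambda>t. h (2 * t - 1)) (1/2) 1 = inscribed_lengths (g +++ h) (1/2) 1"
  proof (rule inscribed_lengths_cong)
    fix t :: real assume "1/2 \<le> t" "t \<le> 1"
    then show "h (2 * t - 1) = (g +++ h) t"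
      using assms(3) by (cases "t = 1/2") (auto simp: joinpaths_def pathfinish_def pathstart_def field_simps)
  qed
  ultimately have "bdd_above (inscribed_lengths (g +++ h) 0 1)"
    using bdd_above_inscribed_lengths_trans[of "g +++ h" 0 "1/2" 1] by simp
  then show ?thesis using assms by (auto simp: rectifiable_def intro!: path_join_imp)
qed

lemma curve_integral_join_le:
  assumes g: "rectifiable g" and h: "rectifiable h" and gh: "pathfinish g = pathstart h"
    and \<rho>: "continuous_on (path_image g \<union> path_image h) \<rho>"
    and nn: "\<And>z. z \<in> path_image g \<union> path_image h \<Longrightarrow> 0 \<le> \<rho> z"
  shows "curve_integral (g +++ h) \<rho> \<le> curve_integral g \<rho> + curve_integral h \<rho>"
proof -
  note P = rectifiable_join[OF g h gh]
  have im: "path_image (g +++ h) = path_image g \<union> path_image h" using gh by (rule path_image_join)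
  have 1: "(g +++ h) (0 + t / 2) = g t" if "t \<in> {0..1}" for t
    using that by (auto simp: joinpaths_def)
  have 2: "(g +++ h) (1/2 + t / 2) = h t" if "t \<in> {0..1}" for t
    using that gh by (cases "t = 0") (auto simp: joinpaths_def pathfinish_def pathstart_def field_simps)
  show ?thesis
    using curve_integral_subarc_le[of "g +++ h" g \<rho> 0, OF P g _ _ _ _ 1]
      curve_integral_subarc_le[of "g +++ h" h \<rho> "1/2", OF P h _ _ _ _ 2] \<rho> nn
    by (simp add: im)
qed

lemma rectifiable_linepath: "rectifiable (linepath x y)"
  and curve_length_linepath_le: "curve_length (linepath x y) 0 1 \<le> dist x y"
proof -
  have d: "dist (linepath x y u) (linepath x y v) \<le> dist x y * v - dist x y * u" if "u \<le> v" for u v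
  proof -
    have "linepath x y u - linepath x y v = (v - u) *\<^sub>R (x - y)"
      by (simp add: linepath_def algebra_simps)
    then have "dist (linepath x y u) (linepath x y v) = (v - u) * dist x y"
      using that by (simp add: dist_norm)
    then show ?thesis by (simp add: algebra_simps)
  qed
  show "rectifiable (linepath x y)"
    using curve_length_le_increment(1)[of 0 1 "linepath x y" "\<lambda>t. dist x y * t", OF d]
    by (simp add: rectifiable_def)
  show "curve_length (linepath x y) 0 1 \<le> dist x y"
    using curve_length_le_increment(2)[of 0 1 "linepath x y" "\<lambda>t. dist x y * t", OF d] by simp
qed

lemma rectifiable_path: "rectifiable g \<Longrightarrow> path g"
  by (simp add: rectifiable_def)

text \<open>The chain rule \<open>ds' \<le> N ds\<close> for arc length, with \<open>N\<close> a
  pointwise Lipschitz constant such as the norm of a derivative. The curve need not be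
  differentiable, so the rule is used only in the limit of short arcs.\<close>

lemma curve_integral_image_le:
  fixes f :: "'a::euclidean_space \<Rightarrow> 'b::euclidean_space"
  assumes g: "rectifiable g" and f: "continuous_on (path_image g) f"
    and lip: "\<And>z \<epsilon>. z \<in> path_image g \<Longrightarrow> 0 < \<epsilon> \<Longrightarrow>
      \<exists>r>0. \<forall>a\<in>ball z r \<inter> path_image g. \<forall>b\<in>ball z r \<inter> path_image g. dist (f a) (f b) \<le> (N z + \<epsilon>) * dist a b"
    and N: "\<And>z. z \<in> path_image g \<Longrightarrow> 0 \<le> N z"
    and \<rho>: "continuous_on (path_image g) \<rho>" and \<rho>': "continuous_on (f ` path_image g) \<rho>'"
    and nn: "\<And>z. z \<in> path_image g \<Longrightarrow> 0 \<le> \<rho>' (f z)"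
    and le: "\<And>z. z \<in> path_image g \<Longrightarrow> \<rho>' (f z) * N z \<le> \<rho> z"
  shows "rectifiable (f \<circ> g)" and "curve_integral (f \<circ> g) \<rho>' \<le> curve_integral g \<rho>"
proof -
  have pg: "path g" using g by (rule rectifiable_path)
  have pfg: "path (f \<circ> g)" using pg f by (rule path_continuous_image)
  have im: "path_image (f \<circ> g) = f ` path_image g" by (rule path_image_compose)
  have gt: "g t \<in> path_image g" if "0 \<le> t" "t \<le> 1" for t using that by (auto simp: path_image_def)
  have len: "\<exists>\<delta>>0. \<forall>u v. 0 \<le> u \<and> u \<le> t \<and> t \<le> v \<and> v \<le> 1 \<and> v - u < \<delta> \<longrightarrow>
      bdd_above (inscribed_lengths (f \<circ> g) u v) \<and>
      curve_length (f \<circ> g) u v \<le> (N (g t) + \<epsilon>) * curve_length g u v"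
    if t: "0 \<le> t" "t \<le> 1" and \<epsilon>: "\<epsilon> > 0" for t \<epsilon>
  proof -
    obtain r where r: "r > 0" "\<And>a b. a \<in> ball (g t) r \<Longrightarrow> a \<in> path_image g \<Longrightarrow> b \<in> ball (g t) r \<Longrightarrow> b \<in> path_image g \<Longrightarrow>
        dist (f a) (f b) \<le> (N (g t) + \<epsilon>) * dist a b"
      using lip[OF gt[OF t] \<epsilon>] by blast
    have "continuous_on {0..1} g" using pg by (simp add: path_def)
    then obtain \<delta> where \<delta>: "\<delta> > 0" "\<And>s. s \<in> {0..1} \<Longrightarrow> dist s t < \<delta> \<Longrightarrow> dist (g s) (g t) < r"
      using t r(1) unfolding continuous_on_iff by (metis atLeastAtMost_iff)
    have "bdd_above (inscribed_lengths (f \<circ> g) u v) \<and>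
      curve_length (f \<circ> g) u v \<le> (N (g t) + \<epsilon>) * curve_length g u v"
      if uv: "0 \<le> u" "u \<le> t" "t \<le> v" "v \<le> 1" "v - u < \<delta>" for u v
    proof -
      have near: "g s \<in> ball (g t) r" "g s \<in> path_image g" if "u \<le> s" "s \<le> v" for s
      proof -
        have "s \<in> {0..1}" "dist s t < \<delta>" using that uv by (auto simp: dist_real_def)
        then show "g s \<in> ball (g t) r" "g s \<in> path_image g" using \<delta>(2)[of s] gt[of s] by (auto simp: dist_commute)
      qed
      have d: "dist ((f \<circ> g) p) ((f \<circ> g) q)
          \<le> (N (g t) + \<epsilon>) * curve_length g 0 q - (N (g t) + \<epsilon>) * curve_length g 0 p"
        if "u \<le> p" "p \<le> q" "q \<le> v" for p q
      proof -
        have "dist ((f \<circ> g) p) ((f \<circ> g) q) \<le> (N (g t) + \<epsilon>) * dist (g p) (g q)"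
          using r(2)[of "g p" "g q"] near that by auto
        also have "\<dots> \<le> (N (g t) + \<epsilon>) * curve_length g p q"
          using dist_le_curve_length[OF rectifiable_bdd[OF g], of p q] that uv N[OF gt[OF t]] \<epsilon>
          by (intro mult_left_mono) auto
        also have "curve_length g p q = curve_length g 0 q - curve_length g 0 p"
          using curve_length_diff[OF g, of p q] that uv by simp
        finally show ?thesis by (simp add: algebra_simps)
      qed
      have "u \<le> v" using uv by simp
      note * = curve_length_le_increment[of u v "f \<circ> g" "\<lambda>s. (N (g t) + \<epsilon>) * curve_length g 0 s", OF d this]
      have "(N (g t) + \<epsilon>) * curve_length g u v = (N (g t) + \<epsilon>) * curve_length g 0 v - (N (g t) + \<epsilon>) * curve_length g 0 u"
        using curve_length_diff[OF g, of u v] uv by (simp add: algebra_simps)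
      then show ?thesis using * by simp
    qed
    then show ?thesis using \<delta>(1) by (intro exI[of _ \<delta>]) simp
  qed
  \<comment> \<open>Finite length holds near every parameter and is inherited by unions of adjacent
    intervals, so bisection makes it global.\<close>
  have "0 \<le> (0::real) \<and> (1::real) \<le> 1 \<longrightarrow> bdd_above (inscribed_lengths (f \<circ> g) 0 1)"
  proof (rule Bolzano[where P = "\<lambda>u v. 0 \<le> u \<and> v \<le> 1 \<longrightarrow> bdd_above (inscribed_lengths (f \<circ> g) u v)"])
    fix t :: real assume "0 \<le> t" "t \<le> 1"
    then obtain d where "d > 0" "\<forall>u v. 0 \<le> u \<and> u \<le> t \<and> t \<le> v \<and> v \<le> 1 \<and> v - u < d \<longrightarrow>
        bdd_above (inscribed_lengths (f \<circ> g) u v) \<and> curve_length (f \<circ> g) u v \<le> (N (g t) + 1) * curve_length g u v"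
      using len[of t 1] by auto
    then show "\<exists>d>0. \<forall>u v. u \<le> t \<and> t \<le> v \<and> v - u < d \<longrightarrow>
        0 \<le> u \<and> v \<le> 1 \<longrightarrow> bdd_above (inscribed_lengths (f \<circ> g) u v)"
      by (intro exI[of _ d]) simp
  next
    fix a b c assume "0 \<le> a \<and> b \<le> 1 \<longrightarrow> bdd_above (inscribed_lengths (f \<circ> g) a b)"
      "0 \<le> b \<and> c \<le> 1 \<longrightarrow> bdd_above (inscribed_lengths (f \<circ> g) b c)" "a \<le> b" "b \<le> c"
    then show "0 \<le> a \<and> c \<le> 1 \<longrightarrow> bdd_above (inscribed_lengths (f \<circ> g) a c)"
      using bdd_above_inscribed_lengths_trans[of "f \<circ> g" a b c] by auto
  qed auto
  then show rfg: "rectifiable (f \<circ> g)" using pfg by (simp add: rectifiable_def)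
  have "partial_curve_integral (f \<circ> g) \<rho>' 1 - partial_curve_integral (f \<circ> g) \<rho>' 0 \<le> curve_integral g \<rho>"
  proof (rule increment_le_curve_integral[OF g \<rho>])
    fix t \<epsilon> :: real assume t: "0 \<le> t" "t \<le> 1" and \<epsilon>: "0 < \<epsilon>"
    define R where "R = \<rho>' (f (g t))"
    define M where "M = N (g t)"
    have RM: "0 \<le> R" "0 \<le> M" "R * M \<le> \<rho> (g t)" using nn N le gt[OF t] by (auto simp: R_def M_def)
    \<comment> \<open>Chosen so that \<open>(R + \<eta>) * (M + \<eta>) \<le> R * M + \<eta> * (R +
      M + 1) \<le> R * M + \<epsilon>\<close>; the cap at 1 gives
      \<open>\<eta> * \<eta> \<le> \<eta>\<close>.\<close>
    define \<eta> where "\<eta> = min 1 (\<epsilon> / (R + M + 1))"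
    have \<eta>: "\<eta> > 0" "\<eta> \<le> 1" using \<epsilon> RM by (auto simp: \<eta>_def)
    have "\<eta> * (R + M + 1) \<le> \<epsilon> / (R + M + 1) * (R + M + 1)"
      using RM by (intro mult_right_mono) (auto simp: \<eta>_def)
    also have "\<dots> = \<epsilon>" using RM by simp
    finally have "\<eta> * (R + M + 1) \<le> \<epsilon>" .
    moreover have "\<eta> * \<eta> \<le> \<eta>" using \<eta> by (simp add: mult_left_le)
    ultimately have prod: "(R + \<eta>) * (M + \<eta>) \<le> \<rho> (g t) + \<epsilon>" using RM(3) by (simp add: algebra_simps)
    obtain \<delta>1 where \<delta>1: "\<delta>1 > 0" "\<And>u v. 0 \<le> u \<and> u \<le> t \<and> t \<le> v \<and> v \<le> 1 \<and> v - u < \<delta>1 \<Longrightarrow>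
        curve_length (f \<circ> g) u v \<le> (M + \<eta>) * curve_length g u v"
      using len[OF t \<eta>(1)] unfolding M_def by blast
    have "t \<in> {0..1}" "continuous_on (path_image (f \<circ> g)) \<rho>'" using t \<rho>' im by auto
    from partial_curve_integral_local_le[OF rfg this(2,1) \<eta>(1)]
    obtain \<delta>2 where "\<delta>2 > 0" and *: "\<forall>u v. 0 \<le> u \<and> u \<le> t \<and> t \<le> v \<and> v \<le> 1 \<and> v - u < \<delta>2 \<longrightarrow>
        partial_curve_integral (f \<circ> g) \<rho>' v - partial_curve_integral (f \<circ> g) \<rho>' u
          \<le> (\<rho>' ((f \<circ> g) t) + \<eta>) * curve_length (f \<circ> g) u v
        \<and> (\<rho>' ((f \<circ> g) t) - \<eta>) * curve_length (f \<circ> g) u v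
          \<le> partial_curve_integral (f \<circ> g) \<rho>' v - partial_curve_integral (f \<circ> g) \<rho>' u"
      by (elim exE conjE)
    then have \<delta>2: "\<delta>2 > 0" "\<And>u v. 0 \<le> u \<and> u \<le> t \<and> t \<le> v \<and> v \<le> 1 \<and> v - u < \<delta>2 \<Longrightarrow>
        partial_curve_integral (f \<circ> g) \<rho>' v - partial_curve_integral (f \<circ> g) \<rho>' u \<le> (R + \<eta>) * curve_length (f \<circ> g) u v"
      by (simp_all add: R_def)
    show "\<exists>\<delta>>0. \<forall>u v. 0 \<le> u \<and> u \<le> t \<and> t \<le> v \<and> v \<le> 1 \<and> v - u < \<delta> \<longrightarrow>
        partial_curve_integral (f \<circ> g) \<rho>' v - partial_curve_integral (f \<circ> g) \<rho>' u \<le> (\<rho> (g t) + \<epsilon>) * curve_length g u v"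
    proof (intro exI[of _ "min \<delta>1 \<delta>2"] conjI allI impI)
      fix u v assume uv: "0 \<le> u \<and> u \<le> t \<and> t \<le> v \<and> v \<le> 1 \<and> v - u < min \<delta>1 \<delta>2"
      have L: "0 \<le> curve_length g u v" using curve_length_nonneg[OF rectifiable_bdd[OF g]] uv by auto
      have "partial_curve_integral (f \<circ> g) \<rho>' v - partial_curve_integral (f \<circ> g) \<rho>' u
          \<le> (R + \<eta>) * curve_length (f \<circ> g) u v" using \<delta>2(2)[of u v] uv by simp
      also have "\<dots> \<le> (R + \<eta>) * ((M + \<eta>) * curve_length g u v)"
        using \<delta>1(2)[of u v] uv RM \<eta> by (intro mult_left_mono) auto
      also have "\<dots> \<le> (\<rho> (g t) + \<epsilon>) * curve_length g u v"
        using mult_right_mono[OF prod L] by (simp add: mult.assoc)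
      finally show "partial_curve_integral (f \<circ> g) \<rho>' v - partial_curve_integral (f \<circ> g) \<rho>' u \<le> (\<rho> (g t) + \<epsilon>) * curve_length g u v" .
    qed (use \<delta>1 \<delta>2 in auto)
  qed
  then show "curve_integral (f \<circ> g) \<rho>' \<le> curve_integral g \<rho>" by simp
qed

section \<open>The quasihyperbolic metric\<close>

lemma proper_subdomainD:
  assumes "proper_subdomain D"
  shows "open D" "connected D" "D \<noteq> {}" "frontier D \<noteq> {}" "frontier D \<inter> D = {}"
  using assms frontier_eq_empty[of D] frontier_disjoint_eq[of D] by (auto simp: proper_subdomain_def)

lemma bdist_pos:
  assumes "proper_subdomain D" "x \<in> D"
  shows "0 < bdist D x"
  unfolding bdist_def using proper_subdomainD[OF assms(1)] assms(2)
  by (intro infdist_pos_not_in_closed) auto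

lemma bdist_le_add_dist: "bdist D x \<le> bdist D y + dist x y"
  unfolding bdist_def by (rule infdist_triangle)

lemma continuous_on_bdist: "continuous_on S (bdist D)"
  unfolding bdist_def by (intro continuous_intros)

lemma continuous_on_inverse_bdist:
  assumes "proper_subdomain D" "S \<subseteq> D"
  shows "continuous_on S (\<lambda>z. 1 / bdist D z)"
  using bdist_pos[OF assms(1)] assms(2) by (intro continuous_intros continuous_on_bdist) force

lemma bdist_attained:
  assumes "proper_subdomain D"
  obtains z where "z \<notin> D" "dist x z = bdist D x"
  using infdist_attains_inf[OF frontier_closed proper_subdomainD(4)[OF assms], of x] proper_subdomainD(5)[OF assms]
  unfolding bdist_def by (metis IntI empty_iff)

text \<open>\<open>bdist\<close> measures the distance to the frontier; a ball about a point of
  \<open>D\<close> that misses the frontier lies in \<open>D\<close> because balls are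
  connected.\<close>

lemma ball_bdist_subset:
  assumes "proper_subdomain D" "x \<in> D"
  shows "ball x (bdist D x) \<subseteq> D"
proof (rule ccontr)
  assume n: "\<not> ball x (bdist D x) \<subseteq> D"
  then have "0 < bdist D x" by (metis ball_empty empty_subsetI not_le)
  then have "ball x (bdist D x) \<inter> D \<noteq> {}" using assms(2) by (metis IntI centre_in_ball empty_iff)
  then have "ball x (bdist D x) \<inter> frontier D \<noteq> {}" using n by (intro connected_Int_frontier) auto
  then show False using infdist_le[of _ "frontier D" x] unfolding bdist_def by force
qed

definition joining_curves :: "'a::euclidean_space set \<Rightarrow> 'a \<Rightarrow> 'a \<Rightarrow> (real \<Rightarrow> 'a) set" where
  "joining_curves D x y = {g. rectifiable g \<and> path_image g \<subseteq> D \<and> pathstart g = x \<and> pathfinish g = y}"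

lemma qh_dist_eq: "qh_dist D x y = (INF g\<in>joining_curves D x y. curve_integral g (\<lambda>z. 1 / bdist D z))"
  unfolding qh_dist_def joining_curves_def by (rule arg_cong[of _ _ Inf]) auto

lemma curve_integral_qh_nonneg:
  assumes "proper_subdomain D" "g \<in> joining_curves D x y"
  shows "0 \<le> curve_integral g (\<lambda>z. 1 / bdist D z)"
  using assms by (intro curve_integral_bounds(2) continuous_on_inverse_bdist)
    (auto simp: joining_curves_def bdist_def infdist_nonneg)

lemma qh_dist_le_curve_integral:
  assumes "proper_subdomain D" "g \<in> joining_curves D x y"
  shows "qh_dist D x y \<le> curve_integral g (\<lambda>z. 1 / bdist D z)"
  unfolding qh_dist_eq
  by (rule cINF_lower[OF bdd_belowI2[of _ 0] assms(2)]) (rule curve_integral_qh_nonneg[OF assms(1)])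

text \<open>Otherwise the infimum would be taken over the empty set. A polynomial path has a bounded
  derivative on the unit interval, hence is Lipschitz and rectifiable, which continuity alone would
  not give.\<close>

lemma joining_curves_nonempty:
  assumes D: "proper_subdomain D" and "x \<in> D" "y \<in> D"
  shows "joining_curves D x y \<noteq> {}"
proof -
  obtain g where g: "polynomial_function g" "path_image g \<subseteq> D" "pathstart g = x" "pathfinish g = y"
    using connected_open_polynomial_connected proper_subdomainD(1,2)[OF D] assms(2,3) by blast
  obtain g' where g': "polynomial_function g'" "\<And>t. (g has_vector_derivative g' t) (at t)"
    using has_vector_derivative_polynomial_function[OF g(1)] by blast
  have "compact (g' ` {0..1})"
    using g'(1) by (intro compact_continuous_image continuous_on_polymonial_function) auto
  then obtain B where B: "\<And>t. t \<in> {0..1} \<Longrightarrow> norm (g' t) \<le> B"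
    using compact_imp_bounded bounded_iff by (metis imageI)
  have "norm (g v - g u) \<le> B * norm (v - u)" if "0 \<le> u" "u \<le> v" "v \<le> 1" for u v
  proof (rule differentiable_bound[of "{0..1}" g "\<lambda>t s. s *\<^sub>R g' t"])
    show "(g has_derivative (\<lambda>s. s *\<^sub>R g' t)) (at t within {0..1})" for t
      using g'(2)[of t] unfolding has_vector_derivative_def by (rule has_derivative_at_withinI)
    show "onorm (\<lambda>s. s *\<^sub>R g' t) \<le> B" if "t \<in> {0..1}" for t
      using mult_right_mono[OF B[OF that] abs_ge_zero] by (intro onorm_le) (simp add: mult.commute)
  qed (use that in auto)
  then have "dist (g u) (g v) \<le> B * v - B * u" if "0 \<le> u" "u \<le> v" "v \<le> 1" for u v
    using that by (fastforce simp: dist_norm norm_minus_commute algebra_simps)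
  then have "bdd_above (inscribed_lengths g 0 1)"
    by (intro curve_length_le_increment(1)[of 0 1 g "\<lambda>t. B * t"]) auto
  then have "g \<in> joining_curves D x y"
    using g path_polynomial_function[OF g(1)] by (simp add: joining_curves_def rectifiable_def)
  then show ?thesis by blast
qed

lemma qh_dist_nonneg:
  assumes "proper_subdomain D" "x \<in> D" "y \<in> D"
  shows "0 \<le> qh_dist D x y"
  unfolding qh_dist_eq
  by (rule cINF_greatest[OF joining_curves_nonempty[OF assms]]) (rule curve_integral_qh_nonneg[OF assms(1)])

lemma qh_dist_approx:
  assumes "proper_subdomain D" "x \<in> D" "y \<in> D" "\<epsilon> > 0"
  obtains g where "g \<in> joining_curves D x y" "curve_integral g (\<lambda>z. 1 / bdist D z) < qh_dist D x y + \<epsilon>"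
proof -
  have "(INF g\<in>joining_curves D x y. curve_integral g (\<lambda>z. 1 / bdist D z)) < qh_dist D x y + \<epsilon>"
    using assms(4) by (simp add: qh_dist_eq)
  then show thesis
    using that cINF_less_iff[OF joining_curves_nonempty[OF assms(1-3)] bdd_belowI2[of _ 0 "\<lambda>g. curve_integral g (\<lambda>z. 1 / bdist D z)"]]
      curve_integral_qh_nonneg[OF assms(1)] by (metis (no_types, lifting))
qed

lemma qh_dist_triangle:
  assumes D: "proper_subdomain D" and xyz: "x \<in> D" "y \<in> D" "z \<in> D"
  shows "qh_dist D x z \<le> qh_dist D x y + qh_dist D y z"
proof (rule field_le_epsilon)
  fix e :: real assume "e > 0"
  then have e: "e / 2 > 0" by simp
  obtain g where g: "g \<in> joining_curves D x y" "curve_integral g (\<lambda>z. 1 / bdist D z) < qh_dist D x y + e/2"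
    using qh_dist_approx[OF D xyz(1,2) e] .
  obtain h where h: "h \<in> joining_curves D y z" "curve_integral h (\<lambda>z. 1 / bdist D z) < qh_dist D y z + e/2"
    using qh_dist_approx[OF D xyz(2,3) e] .
  have gh: "rectifiable g" "rectifiable h" "pathfinish g = pathstart h" and im: "path_image g \<union> path_image h \<subseteq> D"
    using g(1) h(1) by (auto simp: joining_curves_def)
  have "g +++ h \<in> joining_curves D x z"
    using g(1) h(1) rectifiable_join[OF gh] by (auto simp: joining_curves_def path_image_join)
  then have "qh_dist D x z \<le> curve_integral (g +++ h) (\<lambda>z. 1 / bdist D z)"
    by (rule qh_dist_le_curve_integral[OF D])
  also have "\<dots> \<le> curve_integral g (\<lambda>z. 1 / bdist D z) + curve_integral h (\<lambda>z. 1 / bdist D z)"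
    by (rule curve_integral_join_le[OF gh continuous_on_inverse_bdist[OF D im]]) (simp add: bdist_def infdist_nonneg)
  finally show "qh_dist D x z \<le> qh_dist D x y + qh_dist D y z + e" using g(2) h(2) by simp
qed

text \<open>On the segment the boundary distance stays at least \<open>bdist D x / 2\<close>, so a
  density of at most \<open>2 / bdist D x\<close> is integrated over a length of at most
  \<open>bdist D x / 2\<close>.\<close>

lemma qh_dist_le_1:
  assumes D: "proper_subdomain D" and x: "x \<in> D" and y: "dist x y \<le> bdist D x / 2"
  shows "qh_dist D x y \<le> 1"
proof -
  have pos: "0 < bdist D x" using bdist_pos[OF D x] .
  have seg: "dist x z \<le> dist x y" if "z \<in> path_image (linepath x y)" for z
    using segment_bound(1)[of z x y] that by (simp add: dist_norm norm_minus_commute)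
  have bd: "bdist D x / 2 \<le> bdist D z" if "z \<in> path_image (linepath x y)" for z
    using seg[OF that] bdist_le_add_dist[of D x z] y by linarith
  have sub: "path_image (linepath x y) \<subseteq> D"
  proof
    fix z assume "z \<in> path_image (linepath x y)"
    then have "z \<in> ball x (bdist D x)" using seg[of z] y pos by auto
    then show "z \<in> D" using ball_bdist_subset[OF D x] by blast
  qed
  have "qh_dist D x y \<le> curve_integral (linepath x y) (\<lambda>z. 1 / bdist D z)"
    by (rule qh_dist_le_curve_integral[OF D]) (use sub rectifiable_linepath in \<open>auto simp: joining_curves_def\<close>)
  also have "\<dots> \<le> (2 / bdist D x) * curve_length (linepath x y) 0 1"
  proof (rule curve_integral_bounds(1)[OF rectifiable_linepath continuous_on_inverse_bdist[OF D sub]])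
    fix z assume "z \<in> path_image (linepath x y)"
    from bd[OF this] show "1 / bdist D z \<le> 2 / bdist D x" using pos by (simp add: field_simps)
  qed
  also have "\<dots> \<le> (2 / bdist D x) * (bdist D x / 2)"
    using pos curve_length_linepath_le[of x y] y by (intro mult_left_mono) auto
  finally show ?thesis using pos by simp
qed

section \<open>The Lipschitz estimate\<close>

lemma C1_on_has_derivative:
  assumes "C1_on G f" "x \<in> G"
  shows "(f has_derivative (\<lambda>h. jacobian f (at x) *v h)) (at x)"
  using assms jacobian_works[of f "at x"] by (simp add: C1_on_def)

lemma frechet_derivative_eq_jacobian:
  assumes "C1_on G f" "x \<in> G"
  shows "frechet_derivative f (at x) = (*v) (jacobian f (at x))"
  using frechet_derivative_at[OF C1_on_has_derivative[OF assms]] by simp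

lemma C1_on_continuous:
  assumes "C1_on G f"
  shows "continuous_on G f"
  using assms unfolding C1_on_def
  by (intro continuous_at_imp_continuous_on ballI differentiable_imp_continuous_within) auto

lemma onorm_matrix_le:
  fixes A :: "real^'n^'m"
  shows "onorm ((*v) A) \<le> real CARD('m) * real CARD('n) * norm A"
proof (rule onorm_le_matrix_component)
  show "\<bar>A $ i $ j\<bar> \<le> norm A" for i j
    using component_le_norm_cart[of "A $ i" j] Finite_Cartesian_Product.norm_nth_le[of A i] by linarith
qed

text \<open>Lengths of image curves require a bound for all pairs \<open>a\<close>, \<open>b\<close>
  near \<open>z\<close>. Differentiability at \<open>z\<close> would only compare points with
  \<open>z\<close> itself; continuity of the derivative gives the rest.\<close>

lemma C1_on_local_lipschitz:
  fixes f :: "real^'n \<Rightarrow> real^'n"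
  assumes G: "open G" and f: "C1_on G f" and z: "z \<in> G" and \<epsilon>: "\<epsilon> > 0"
  shows "\<exists>r>0. \<forall>a\<in>ball z r. \<forall>b\<in>ball z r. dist (f a) (f b) \<le> (onorm (frechet_derivative f (at z)) + \<epsilon>) * dist a b"
proof -
  let ?J = "\<lambda>x. jacobian f (at x)"
  \<comment> \<open>The factor by which the operator norm is bounded in terms of the matrix norm, in
    which continuity of the Jacobian is expressed.\<close>
  let ?c = "real CARD('n) * real CARD('n)"
  have c: "?c > 0" by simp
  obtain r1 where r1: "r1 > 0" "ball z r1 \<subseteq> G" using G z open_contains_ball by metis
  have "continuous_on G ?J" using f by (simp add: C1_on_def)
  moreover have "\<epsilon> / ?c > 0" using \<epsilon> c by simp
  ultimately obtain r2 where r2: "r2 > 0" "\<And>w. w \<in> G \<Longrightarrow> dist w z < r2 \<Longrightarrow> dist (?J w) (?J z) < \<epsilon> / ?c"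
    using z unfolding continuous_on_iff by metis
  let ?r = "min r1 r2"
  have "dist (f a) (f b) \<le> (onorm (frechet_derivative f (at z)) + \<epsilon>) * dist a b"
    if ab: "a \<in> ball z ?r" "b \<in> ball z ?r" for a b
    unfolding dist_norm
  proof (rule differentiable_bound[OF convex_ball, of z ?r f "\<lambda>x h. ?J x *v h"])
    fix w assume w: "w \<in> ball z ?r"
    then have wG: "w \<in> G" using r1 by auto
    show "(f has_derivative (\<lambda>h. ?J w *v h)) (at w within ball z ?r)"
      by (rule has_derivative_at_withinI[OF C1_on_has_derivative[OF f wG]])
    have "onorm ((*v) (?J w - ?J z)) \<le> ?c * norm (?J w - ?J z)" by (rule onorm_matrix_le)
    also have "\<dots> \<le> ?c * (\<epsilon> / ?c)"
      using r2(2)[OF wG] w by (intro mult_left_mono) (auto simp: dist_norm dist_commute norm_minus_commute)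
    finally have d: "onorm ((*v) (?J w - ?J z)) \<le> \<epsilon>" by simp
    have "onorm (\<lambda>h. ?J w *v h) = onorm (\<lambda>h. ?J z *v h + (?J w - ?J z) *v h)"
      by (simp add: matrix_vector_mult_diff_rdistrib)
    also have "\<dots> \<le> onorm ((*v) (?J z)) + onorm ((*v) (?J w - ?J z))"
      by (rule onorm_triangle) (simp_all add: matrix_vector_mul_bounded_linear)
    finally show "onorm (\<lambda>h. ?J w *v h) \<le> onorm (frechet_derivative f (at z)) + \<epsilon>"
      using d by (simp add: frechet_derivative_eq_jacobian[OF f z])
  qed (use ab in auto)
  then show ?thesis using r1(1) r2(1) by (intro exI[of _ ?r]) auto
qed

lemma weak_uniform_boundedD:
  assumes G: "proper_subdomain G" "proper_subdomain G'" and G': "G' = f ` G"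
    and w: "weak_uniform_bounded c G G' f"
    and xy: "x \<in> G" "y \<in> G" "2 * dist x y \<le> bdist G x" "2 * dist x y \<le> bdist G y"
  shows "dist (f x) (f y) \<le> c * bdist G' (f x)"
proof -
  have pos: "0 < bdist G x" "0 < bdist G y" "0 < bdist G' (f x)" "0 < bdist G' (f y)"
    using bdist_pos G G' xy by auto
  have "rel_dist G x y \<le> 1/2"
    using xy pos by (auto simp: rel_dist_def dist_norm field_simps min_def)
  then have "rel_dist G' (f x) (f y) \<le> c" using w xy by (auto simp: weak_uniform_bounded_def)
  then have "dist (f x) (f y) \<le> c * min (bdist G' (f x)) (bdist G' (f y))"
    using pos by (auto simp: rel_dist_def dist_norm field_simps min_def split: if_splits)
  moreover have "0 \<le> c"
  proof -
    have "0 \<le> rel_dist G' (f x) (f y)" using pos by (simp add: rel_dist_def)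
    then show ?thesis using \<open>rel_dist G' (f x) (f y) \<le> c\<close> by simp
  qed
  then have "c * min (bdist G' (f x)) (bdist G' (f y)) \<le> c * bdist G' (f x)"
    by (intro mult_left_mono) auto
  ultimately show ?thesis by simp
qed

text \<open>Points of \<open>B\<^sub>x\<close> may have relative distance up to \<open>1\<close> from \<open>x\<close>, so the weak uniform
  boundedness is applied twice, through the midpoint.\<close>

lemma weak_uniform_bounded_half_ball:
  assumes G: "proper_subdomain G" "proper_subdomain G'" and G': "G' = f ` G"
    and w: "weak_uniform_bounded c G G' f"
    and x: "x \<in> G" and y: "y \<in> ball x (bdist G x / 2)"
  shows "dist (f x) (f y) \<le> (2 * c + c * c) * bdist G' (f x)"
proof -
  let ?m = "midpoint x y"
  have mxy: "dist x ?m = dist x y / 2" "dist ?m y = dist x y / 2"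
    by (auto simp: dist_midpoint)
  have xy: "dist x y < bdist G x / 2" using y by simp
  have inG: "?m \<in> G" "y \<in> G"
    by (rule subsetD[OF ball_bdist_subset[OF G(1) x]]; use xy mxy zero_le_dist[of x y] in \<open>unfold mem_ball, linarith\<close>)+
  \<comment> \<open>Since \<open>dist x y < bdist G x / 2\<close>, the boundary distance exceeds
    \<open>3/4\<close> of \<open>bdist G x\<close> at the midpoint and half of it at
    \<open>y\<close>. Twice the length of a half segment is smaller than either.\<close>
  have b: "bdist G x \<le> bdist G ?m + dist x y / 2" "bdist G x \<le> bdist G y + dist x y"
    using bdist_le_add_dist[of G x ?m] bdist_le_add_dist[of G x y] mxy by auto
  note W = weak_uniform_boundedD[OF G G' w]
  have pos: "0 < bdist G' (f x)" using bdist_pos[OF G(2)] x G' by auto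
  have 1: "dist (f x) (f ?m) \<le> c * bdist G' (f x)"
    by (rule W; (intro x inG)?) (use mxy b xy zero_le_dist[of x y] in linarith)+
  have 2: "dist (f ?m) (f y) \<le> c * bdist G' (f ?m)"
    by (rule W; (intro x inG)?) (use mxy b xy zero_le_dist[of x y] in linarith)+
  have "0 \<le> c * bdist G' (f x)" using 1 zero_le_dist order_trans by blast
  then have c: "0 \<le> c" using pos by (simp add: zero_le_mult_iff)
  \<comment> \<open>The second step is measured at the midpoint, where the boundary distance of the
    image is larger by at most the factor \<open>1 + c\<close>. The total is
    \<open>c + c * (1 + c)\<close>.\<close>
  have "bdist G' (f ?m) \<le> bdist G' (f x) + c * bdist G' (f x)"
    using bdist_le_add_dist[of G' "f ?m" "f x"] 1 by (simp add: dist_commute)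
  then have "c * bdist G' (f ?m) \<le> c * (bdist G' (f x) + c * bdist G' (f x))"
    using c by (rule mult_left_mono)
  then have "dist (f ?m) (f y) \<le> c * bdist G' (f x) + c * c * bdist G' (f x)"
    using 2 by (simp add: algebra_simps)
  then show ?thesis using 1 dist_triangle[of "f x" "f y" "f ?m"] by (simp add: algebra_simps)
qed

lemma OC1_derivative_bound:
  fixes f :: "real^'n \<Rightarrow> real^'n"
  assumes G: "proper_subdomain G" "proper_subdomain G'" and G': "G' = f ` G"
    and f: "f \<in> OC1 G" and w: "weak_uniform_bounded c G G' f"
  obtains C where "C > 0"
    "\<And>x. x \<in> G \<Longrightarrow> bdist G x * onorm (frechet_derivative f (at x)) \<le> C * bdist G' (f x)"
proof -
  obtain c1 where c1: "\<And>x. x \<in> G \<Longrightarrow>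
      bdist G x * onorm (frechet_derivative f (at x)) \<le> c1 * osc (ball x (bdist G x / 2)) f"
    using f by (auto simp: OC1_def)
  let ?q = "2 * c + c * c"
  \<comment> \<open>The sign of \<open>c1\<close> is unknown, hence the absolute values. The factor
    2 passes from distances to \<open>f x\<close> to an oscillation, and the final 1 makes the
    constant positive.\<close>
  let ?C = "\<bar>c1\<bar> * (2 * \<bar>?q\<bar>) + 1"
  show thesis
  proof (rule that[of ?C])
    fix x assume x: "x \<in> G"
    let ?B = "ball x (bdist G x / 2)"
    have pos: "0 < bdist G' (f x)" "0 < bdist G x" using bdist_pos G x G' by auto
    have near: "dist (f x) (f s) \<le> \<bar>?q\<bar> * bdist G' (f x)" if "s \<in> ?B" for s
      using weak_uniform_bounded_half_ball[OF G G' w x that] pos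
      by (meson abs_ge_self less_imp_le mult_right_mono order_trans)
    have pair: "norm (f s - f t) \<le> 2 * \<bar>?q\<bar> * bdist G' (f x)" if "s \<in> ?B" "t \<in> ?B" for s t
      using near[OF that(1)] near[OF that(2)] dist_triangle3[of "f s" "f t" "f x"] by (simp add: dist_norm)
    have xB: "x \<in> ?B" using pos by simp
    have "osc ?B f \<le> 2 * \<bar>?q\<bar> * bdist G' (f x)"
      unfolding osc_def using xB pair by (intro cSUP_least) auto
    \<comment> \<open>By \<open>pair\<close> the set under the supremum is bounded, so the supremum
      is genuine and lies above its members.\<close>
    moreover have "0 \<le> osc ?B f"
    proof -
      have "norm (f x - f x) \<le> osc ?B f"
        unfolding osc_def
        using cSUP_upper[of "(x, x)" "?B \<times> ?B" "\<lambda>(s, t). norm (f s - f t)"] xB pair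
        by (force intro: bdd_aboveI2[of _ _ "2 * \<bar>?q\<bar> * bdist G' (f x)"])
      then show ?thesis by simp
    qed
    ultimately have "c1 * osc ?B f \<le> \<bar>c1\<bar> * (2 * \<bar>?q\<bar> * bdist G' (f x))"
      by (intro mult_mono) auto
    then show "bdist G x * onorm (frechet_derivative f (at x)) \<le> ?C * bdist G' (f x)"
      using c1[OF x] pos by (simp add: algebra_simps)
  qed (simp add: add_nonneg_pos)
qed

text \<open>With the density \<open>1 / (C * bdist G' w)\<close> on the image curve, the derivative
  bound says exactly that image density times local stretching is at most
  \<open>1 / bdist G z\<close>, which is what the comparison of curve integrals needs.\<close>

lemma qh_lipschitz:
  fixes f :: "real^'n \<Rightarrow> real^'n"
  assumes G: "proper_subdomain G" "proper_subdomain G'" and G': "G' = f ` G"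
    and f: "f \<in> OC1 G" and w: "weak_uniform_bounded c G G' f"
  shows "\<exists>L>0. \<forall>x\<in>G. \<forall>y\<in>G. qh_dist G' (f x) (f y) \<le> L * qh_dist G x y"
proof -
  obtain C where C: "C > 0"
    "\<And>x. x \<in> G \<Longrightarrow> bdist G x * onorm (frechet_derivative f (at x)) \<le> C * bdist G' (f x)"
    using OC1_derivative_bound[OF assms] by blast
  have C1: "C1_on G f" using f by (simp add: OC1_def)
  have curve: "qh_dist G' (f x) (f y) / C \<le> curve_integral g (\<lambda>z. 1 / bdist G z)"
    if "x \<in> G" "y \<in> G" and g: "g \<in> joining_curves G x y" for x y g
  proof -
    have rg: "rectifiable g" and sub: "path_image g \<subseteq> G" using g by (auto simp: joining_curves_def)
    have le: "1 / (C * bdist G' (f z)) * onorm (frechet_derivative f (at z)) \<le> 1 / bdist G z"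
      if "z \<in> path_image g" for z
    proof -
      have z: "z \<in> G" using that sub by auto
      then have "0 < bdist G z" "0 < bdist G' (f z)" using bdist_pos G G' by auto
      then show ?thesis using C(2)[OF z] C(1) by (simp add: field_simps)
    qed
    have cont: "continuous_on (f ` path_image g) (\<lambda>w. 1 / (C * bdist G' w))"
      using C(1) bdist_pos[OF G(2)] sub G' by (intro continuous_intros continuous_on_bdist) force
    have lip: "\<exists>r>0. \<forall>a\<in>ball z r \<inter> path_image g. \<forall>b\<in>ball z r \<inter> path_image g.
        dist (f a) (f b) \<le> (onorm (frechet_derivative f (at z)) + \<epsilon>) * dist a b"
      if "z \<in> path_image g" "\<epsilon> > 0" for z \<epsilon>
      using C1_on_local_lipschitz[OF proper_subdomainD(1)[OF G(1)] C1 _ that(2), of z] that(1) sub by blast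
    have nn: "0 \<le> onorm (frechet_derivative f (at z))" if "z \<in> path_image g" for z
      using frechet_derivative_eq_jacobian[OF C1, of z] that sub
      by (auto intro!: onorm_pos_le simp: matrix_vector_mul_bounded_linear)
    have nn': "0 \<le> 1 / (C * bdist G' (f z))" for z
      using C(1) by (simp add: bdist_def infdist_nonneg)
    note * = curve_integral_image_le[OF rg continuous_on_subset[OF C1_on_continuous[OF C1] sub] lip nn
        continuous_on_inverse_bdist[OF G(1) sub] cont nn' le]
    have "f \<circ> g \<in> joining_curves G' (f x) (f y)"
      using *(1) g G' by (auto simp: joining_curves_def path_image_compose pathstart_compose pathfinish_compose)
    then have "qh_dist G' (f x) (f y) \<le> curve_integral (f \<circ> g) (\<lambda>w. 1 / bdist G' w)"
      by (rule qh_dist_le_curve_integral[OF G(2)])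
    then have "qh_dist G' (f x) (f y) / C \<le> (1 / C) * curve_integral (f \<circ> g) (\<lambda>w. 1 / bdist G' w)"
      using C(1) by (simp add: divide_right_mono)
    also have "\<dots> = curve_integral (f \<circ> g) (\<lambda>w. 1 / (C * bdist G' w))"
      unfolding curve_integral_def integral_mult_right[symmetric] by (simp add: field_simps)
    also have "\<dots> \<le> curve_integral g (\<lambda>z. 1 / bdist G z)" by (rule *(2))
    finally show ?thesis .
  qed
  have "qh_dist G' (f x) (f y) \<le> C * qh_dist G x y" if xy: "x \<in> G" "y \<in> G" for x y
  proof -
    have "qh_dist G' (f x) (f y) / C \<le> qh_dist G x y"
      unfolding qh_dist_eq[of G x y]
      by (rule cINF_greatest[OF joining_curves_nonempty[OF G(1) xy]]) (rule curve[OF xy])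
    then show ?thesis using C(1) by (simp add: field_simps)
  qed
  then show ?thesis using C(1) by blast
qed

section \<open>A lower bound for the conformal energy\<close>

text \<open>\<open>F'\<close> need not be continuous, so the fundamental theorem is applied with the
  gauge integral and \<open>F'\<close> is compared with its majorant; an infinite right-hand side is
  trivial. The half-open interval drops \<open>s = 0\<close>, where the factor
  \<open>1 / s^n\<close> of the shells degenerates.\<close>

lemma increment_le_nn_integral:
  fixes F F' Q :: "real \<Rightarrow> real"
  assumes F: "\<And>s. (F has_real_derivative F' s) (at s)" and Q: "Q \<in> borel_measurable borel"
    and le: "\<And>s. 0 \<le> s \<Longrightarrow> s \<le> 1 \<Longrightarrow> \<bar>F' s\<bar> \<le> Q s"
  shows "ennreal \<bar>F 1 - F 0\<bar> \<le> (\<integral>\<^sup>+s. ennreal (Q s) * indicator {0<..1} s \<partial>lborel)"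
proof -
  let ?q = "\<lambda>s. Q s * indicator {0..1} s"
  have nn: "0 \<le> ?q s" for s using le[of s] by (auto simp: indicator_def)
  have [measurable]: "Q \<in> borel_measurable borel" by (rule Q)
  have eq: "(\<integral>\<^sup>+s. ennreal (Q s) * indicator {0<..1} s \<partial>lborel) = (\<integral>\<^sup>+s. ennreal (?q s) \<partial>lborel)"
    using AE_lborel_singleton[of 0] by (intro nn_integral_cong_AE) (auto elim!: eventually_mono simp: indicator_def)
  show ?thesis
  proof (cases "(\<integral>\<^sup>+s. ennreal (?q s) \<partial>lborel) < \<infinity>")
    case False
    then show ?thesis unfolding eq by (simp add: not_less top_unique)
  next
    case True
    then have int: "integrable lborel ?q" using nn by (intro integrableI_nonneg) auto
    have "(?q has_integral (\<integral>s. ?q s \<partial>lborel)) UNIV"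
      using has_integral_integral_lborel[OF int] .
    moreover have "?q = (\<lambda>s. if s \<in> {0..1} then Q s else 0)" by (auto simp: indicator_def)
    ultimately have Qi: "(Q has_integral (\<integral>s. ?q s \<partial>lborel)) {0..1}"
      using has_integral_restrict_UNIV[of "{0..1}" Q] by simp
    have Fi: "(F' has_integral (F 1 - F 0)) {0..1}"
      by (rule fundamental_theorem_of_calculus)
        (use F in \<open>auto simp: has_real_derivative_iff_has_vector_derivative[symmetric] intro: has_field_derivative_at_within\<close>)
    have "norm (integral {0..1} F') \<le> integral {0..1} Q"
      using Qi Fi le by (intro integral_norm_bound_integral) auto
    then have "\<bar>F 1 - F 0\<bar> \<le> (\<integral>s. ?q s \<partial>lborel)"
      using integral_unique[OF Qi] integral_unique[OF Fi] by simp
    then show ?thesis unfolding eq nn_integral_eq_integral[OF int AE_I2[OF nn]] by (rule ennreal_leI)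
  qed
qed

text \<open>The parametrisation \<open>s \<mapsto> e + s^n (w - e)\<close> of the segment is chosen so that, after
  integration over \<open>w\<close> and over a family of vertices \<open>e\<close> on concentric spheres, all powers of
  \<open>s\<close> cancel and no singular kernel appears. The constant \<open>1/4\<close> comes from
  \<open>q \<le> 1/4 + 4^(n-1) q^n\<close>, which replaces Hoelder's inequality.\<close>

lemma segment_increment_le:
  fixes u :: "'a::euclidean_space \<Rightarrow> real"
  assumes u: "\<And>z. (u has_derivative u' z) (at z)" and bound: "\<And>z h. \<bar>u' z h\<bar> \<le> g z * norm h"
    and g: "g \<in> borel_measurable borel" and n: "n \<ge> 1" and D: "norm (w - e) \<le> D"
  shows "ennreal \<bar>u e - u w\<bar> \<le> ennreal (1/4) + ennreal (4 ^ (n - 1) * (real n * D) ^ n) *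
    (\<integral>\<^sup>+s. ennreal (s ^ ((n - 1) * n)) * ennreal (g (e + s ^ n *\<^sub>R (w - e)) ^ n) * indicator {0<..1} s \<partial>lborel)"
proof -
  have g0: "0 \<le> g z" for z
  proof -
    obtain b :: 'a where "b \<in> Basis" using nonempty_Basis by blast
    then have "0 \<le> g z * norm b" using bound[of z b] abs_ge_zero order_trans by blast
    then show ?thesis using \<open>b \<in> Basis\<close> by simp
  qed
  have D0: "0 \<le> D" using D norm_ge_zero order_trans by blast
  define \<gamma> where "\<gamma> s = e + s ^ n *\<^sub>R (w - e)" for s :: real
  define q where "q s = g (\<gamma> s) * (real n * s ^ (n - 1) * norm (w - e))" for s :: real
  define Q where "Q s = 1/4 + 4 ^ (n - 1) * (real n * D) ^ n * (s ^ ((n - 1) * n) * g (\<gamma> s) ^ n)" for s :: real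
  have \<gamma>m[measurable]: "\<gamma> \<in> borel_measurable borel" unfolding \<gamma>_def by measurable
  have [measurable]: "(\<lambda>s. g (\<gamma> s)) \<in> borel_measurable borel"
    using measurable_compose[OF \<gamma>m g] .
  have Qm[measurable]: "Q \<in> borel_measurable borel" unfolding Q_def by measurable
  have \<gamma>d: "(\<gamma> has_derivative (\<lambda>h. (h * (real n * s ^ (n - 1))) *\<^sub>R (w - e))) (at s)" for s
    unfolding \<gamma>_def by (auto intro!: derivative_eq_intros simp: algebra_simps)
  have F: "((\<lambda>s. u (\<gamma> s)) has_real_derivative u' (\<gamma> s) ((real n * s ^ (n - 1)) *\<^sub>R (w - e))) (at s)" for s
  proof -
    have "((\<lambda>s. u (\<gamma> s)) has_derivative (\<lambda>h. u' (\<gamma> s) ((h * (real n * s ^ (n - 1))) *\<^sub>R (w - e)))) (at s)"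
      using has_derivative_compose[OF \<gamma>d u] .
    moreover have "u' (\<gamma> s) ((h * (real n * s ^ (n - 1))) *\<^sub>R (w - e))
        = u' (\<gamma> s) ((real n * s ^ (n - 1)) *\<^sub>R (w - e)) * h" for h
      using linear_scale[OF has_derivative_linear[OF u], of "\<gamma> s" h "(real n * s ^ (n - 1)) *\<^sub>R (w - e)"]
      by simp
    ultimately show ?thesis by (simp add: has_field_derivative_def)
  qed
  have small: "q \<le> 1/4 + 4 ^ (n - 1) * q ^ n" if "0 \<le> q" for q :: real
  proof (cases "q \<le> 1/4")
    case True
    have "0 \<le> 4 ^ (n - 1) * q ^ n" using that by simp
    then show ?thesis using True by linarith
  next
    case False
    have "1 \<le> (4 * q) ^ (n - 1)" using False by (intro one_le_power) simp
    then have "q * 1 \<le> q * (4 * q) ^ (n - 1)" using that by (intro mult_left_mono)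
    also have "q * (4 * q) ^ (n - 1) = 4 ^ (n - 1) * q ^ n"
      using n by (cases n) (auto simp: power_mult_distrib)
    finally show ?thesis by simp
  qed
  have le: "\<bar>u' (\<gamma> s) ((real n * s ^ (n - 1)) *\<^sub>R (w - e))\<bar> \<le> Q s" if s: "0 \<le> s" "s \<le> 1" for s
  proof -
    have "\<bar>u' (\<gamma> s) ((real n * s ^ (n - 1)) *\<^sub>R (w - e))\<bar> \<le> q s"
      using bound[of "\<gamma> s" "(real n * s ^ (n - 1)) *\<^sub>R (w - e)"] s by (simp add: q_def)
    also have "\<dots> \<le> 1/4 + 4 ^ (n - 1) * q s ^ n"
      by (rule small) (use g0 s in \<open>simp add: q_def\<close>)
    also have "q s ^ n = (real n * norm (w - e)) ^ n * (s ^ ((n - 1) * n) * g (\<gamma> s) ^ n)"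
      by (simp add: q_def power_mult_distrib power_mult[symmetric] mult_ac)
    also have "1/4 + 4 ^ (n - 1) * \<dots> \<le> Q s"
      unfolding Q_def mult.assoc
      using D s g0 by (intro add_left_mono mult_left_mono mult_right_mono power_mono) auto
    finally show ?thesis .
  qed
  have "ennreal \<bar>u (\<gamma> 1) - u (\<gamma> 0)\<bar> \<le> (\<integral>\<^sup>+s. ennreal (Q s) * indicator {0<..1} s \<partial>lborel)"
    by (rule increment_le_nn_integral[OF F Qm le])
  also have "\<dots> = (\<integral>\<^sup>+s. ennreal (1/4) * indicator {0<..1::real} s
      + ennreal (4 ^ (n - 1) * (real n * D) ^ n) *
        (ennreal (s ^ ((n - 1) * n)) * ennreal (g (\<gamma> s) ^ n) * indicator {0<..1} s) \<partial>lborel)"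
  proof (rule nn_integral_cong)
    fix s :: real
    have "s \<in> {0<..1} \<Longrightarrow> ennreal (Q s) = ennreal (1/4) + ennreal (4 ^ (n - 1) * (real n * D) ^ n) *
        (ennreal (s ^ ((n - 1) * n)) * ennreal (g (\<gamma> s) ^ n))"
      unfolding Q_def using D0 g0 by (simp add: ennreal_plus ennreal_mult del: ennreal_numeral)
    then show "ennreal (Q s) * indicator {0<..1} s = ennreal (1/4) * indicator {0<..1::real} s
      + ennreal (4 ^ (n - 1) * (real n * D) ^ n) *
        (ennreal (s ^ ((n - 1) * n)) * ennreal (g (\<gamma> s) ^ n) * indicator {0<..1} s)"
      by (simp add: indicator_def)
  qed
  also have "\<dots> = ennreal (1/4) + ennreal (4 ^ (n - 1) * (real n * D) ^ n) *
    (\<integral>\<^sup>+s. ennreal (s ^ ((n - 1) * n)) * ennreal (g (\<gamma> s) ^ n) * indicator {0<..1} s \<partial>lborel)"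
    by (subst nn_integral_add) (simp_all add: nn_integral_cmult)
  finally have "ennreal \<bar>u (\<gamma> 1) - u (\<gamma> 0)\<bar> \<le> ennreal (1/4) + ennreal (4 ^ (n - 1) * (real n * D) ^ n) *
    (\<integral>\<^sup>+s. ennreal (s ^ ((n - 1) * n)) * ennreal (g (\<gamma> s) ^ n) * indicator {0<..1} s \<partial>lborel)" .
  moreover have "\<gamma> 0 = e" "\<gamma> 1 = w" using n by (auto simp: \<gamma>_def power_0_left)
  ultimately have "ennreal \<bar>u e - u w\<bar> \<le> ennreal (1/4) + ennreal (4 ^ (n - 1) * (real n * D) ^ n) *
    (\<integral>\<^sup>+s. ennreal (s ^ ((n - 1) * n)) * ennreal (g (\<gamma> s) ^ n) * indicator {0<..1} s \<partial>lborel)"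
    by (simp only: abs_minus_commute)
  then show ?thesis unfolding \<gamma>_def .
qed

section \<open>Integration over cones and shells\<close>

lemma nn_integral_lborel_affine:
  fixes F :: "'a::euclidean_space \<Rightarrow> ennreal"
  assumes [measurable]: "F \<in> borel_measurable borel" and c: "c > 0"
  shows "(\<integral>\<^sup>+z. F z \<partial>lborel) = ennreal (c ^ DIM('a)) * (\<integral>\<^sup>+w. F (t + c *\<^sub>R w) \<partial>lborel)"
  by (subst lborel_affine[of c t])
    (use c in \<open>simp_all add: nn_integral_density nn_integral_distr nn_integral_cmult\<close>)

text \<open>A normalised integral over a spherical shell. A point at parameter \<open>s\<close> on a
  segment of length at most \<open>D\<close> from a vertex at distance \<open>\<tau>\<close> from
  \<open>x\<close> lies within \<open>D * s^n\<close> of the sphere of radius \<open>\<tau>\<close>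
  about \<open>x\<close>; dividing by \<open>s^n\<close> compensates for this thickness.\<close>

definition shell_integral :: "('a::euclidean_space \<Rightarrow> ennreal) \<Rightarrow> real \<Rightarrow> 'a \<Rightarrow> real \<Rightarrow> real \<Rightarrow> ennreal" where
  "shell_integral F D x s \<tau> = ennreal (1 / s ^ DIM('a)) *
     (\<integral>\<^sup>+z. F z * (if \<bar>\<tau> - dist x z\<bar> \<le> D * s ^ DIM('a) then 1 else 0) \<partial>lborel)"

text \<open>Substituting \<open>z = e + s^n (w - e)\<close> produces the factor
  \<open>s^(-n^2)\<close>, which together with the weight leaves \<open>1 / s^n\<close>. The bound
  no longer mentions the vertex \<open>e\<close>, only its distance \<open>\<tau>\<close> from
  \<open>x\<close>.\<close>

lemma cone_integral_le_shell_integral: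
  fixes F :: "'a::euclidean_space \<Rightarrow> ennreal"
  assumes F[measurable]: "F \<in> borel_measurable borel" and s: "0 < s"
    and B: "\<And>w. w \<in> B \<Longrightarrow> dist e w \<le> D" and x: "dist x e = \<tau>" and [measurable]: "B \<in> sets borel"
  shows "(\<integral>\<^sup>+w. ennreal (s ^ ((DIM('a) - 1) * DIM('a))) * F (e + s ^ DIM('a) *\<^sub>R (w - e)) * indicator B w \<partial>lborel)
    \<le> shell_integral F D x s \<tau>"
proof -
  let ?n = "DIM('a)"
  let ?F = "\<lambda>z. F z * (if \<bar>\<tau> - dist x z\<bar> \<le> D * s ^ ?n then 1 else 0)"
  let ?p = "\<lambda>w. (e - s ^ ?n *\<^sub>R e) + s ^ ?n *\<^sub>R w"
  have p: "e + s ^ ?n *\<^sub>R (w - e) = ?p w" for w by (simp add: algebra_simps)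
  have le: "F (e + s ^ ?n *\<^sub>R (w - e)) * indicator B w \<le> ?F (?p w)" for w
  proof (cases "w \<in> B")
    case True
    have "dist e (?p w) = s ^ ?n * dist e w"
      using s by (simp add: dist_norm p[symmetric] norm_minus_commute)
    also have "\<dots> \<le> D * s ^ ?n" using B[OF True] s by (simp add: mult.commute)
    finally have "\<bar>\<tau> - dist x (?p w)\<bar> \<le> D * s ^ ?n"
      using dist_triangle[of x e "?p w"] dist_triangle[of x "?p w" e] x by (simp add: dist_commute)
    then show ?thesis using True by (simp add: p)
  qed simp
  have [measurable]: "?F \<in> borel_measurable borel" by measurable
  have pow: "s ^ ((?n - 1) * ?n) = 1 / s ^ ?n * (s ^ ?n) ^ ?n"
  proof -
    have "s ^ ?n * s ^ ((?n - 1) * ?n) = s ^ (?n * ?n)"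
      by (simp add: power_add[symmetric] algebra_simps)
    then show ?thesis using s by (simp add: field_simps power_mult)
  qed
  have pow': "ennreal (s ^ ((?n - 1) * ?n)) = ennreal (1 / s ^ ?n) * ennreal ((s ^ ?n) ^ ?n)"
    unfolding pow using s by (intro ennreal_mult) auto
  have "(\<integral>\<^sup>+w. ennreal (s ^ ((?n - 1) * ?n)) * F (e + s ^ ?n *\<^sub>R (w - e)) * indicator B w \<partial>lborel)
     \<le> (\<integral>\<^sup>+w. ennreal (s ^ ((?n - 1) * ?n)) * ?F (?p w) \<partial>lborel)"
    unfolding mult.assoc by (intro nn_integral_mono mult_left_mono le) simp
  also have "\<dots> = ennreal (s ^ ((?n - 1) * ?n)) * (\<integral>\<^sup>+w. ?F (?p w) \<partial>lborel)"
    by (rule nn_integral_cmult) measurable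
  also have "\<dots> = shell_integral F D x s \<tau>"
    unfolding shell_integral_def pow' mult.assoc
    using s by (subst nn_integral_lborel_affine[of ?F "s ^ ?n" "e - s ^ ?n *\<^sub>R e"]) auto
  finally show ?thesis .
qed

text \<open>By Fubini: each \<open>z\<close> lies in the shells for an interval of radii
  \<open>\<tau>\<close> of length \<open>2 * D * s^n\<close>. The factor \<open>s^n\<close> cancels
  the normalisation, so the bound is uniform in \<open>s\<close>.\<close>

lemma integral_shell_integral_le:
  fixes F :: "'a::euclidean_space \<Rightarrow> ennreal"
  assumes F[measurable]: "F \<in> borel_measurable borel" and s: "0 < s" and D: "0 \<le> D"
  shows "(\<integral>\<^sup>+\<tau>. shell_integral F D x s \<tau> \<partial>lborel) \<le> ennreal (2 * D) * (\<integral>\<^sup>+z. F z \<partial>lborel)"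
proof -
  let ?n = "DIM('a)"
  let ?i = "\<lambda>z \<tau>. if \<bar>\<tau> - dist x z\<bar> \<le> D * s ^ ?n then 1 else (0 :: ennreal)"
  have i: "?i z = indicator {dist x z - D * s ^ ?n .. dist x z + D * s ^ ?n}" for z
    by (auto simp: indicator_def fun_eq_iff)
  have "(\<integral>\<^sup>+\<tau>. shell_integral F D x s \<tau> \<partial>lborel)
      = ennreal (1 / s ^ ?n) * (\<integral>\<^sup>+\<tau>. (\<integral>\<^sup>+z. F z * ?i z \<tau> \<partial>lborel) \<partial>lborel)"
    unfolding shell_integral_def by (rule nn_integral_cmult) measurable
  also have "(\<integral>\<^sup>+\<tau>. (\<integral>\<^sup>+z. F z * ?i z \<tau> \<partial>lborel) \<partial>lborel) = (\<integral>\<^sup>+z. (\<integral>\<^sup>+\<tau>. F z * ?i z \<tau> \<partial>lborel) \<partial>lborel)"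
    by (rule lborel_pair.Fubini'[symmetric]) measurable
  also have "\<dots> = (\<integral>\<^sup>+z. F z * ennreal (2 * (D * s ^ ?n)) \<partial>lborel)"
    using D s by (intro nn_integral_cong) (simp add: i nn_integral_cmult)
  also have "\<dots> = ennreal (2 * (D * s ^ ?n)) * (\<integral>\<^sup>+z. F z \<partial>lborel)"
    by (subst nn_integral_multc) (auto simp: mult.commute)
  also have "ennreal (1 / s ^ ?n) * \<dots> = ennreal (2 * D) * (\<integral>\<^sup>+z. F z \<partial>lborel)"
    using s D by (simp add: mult.assoc[symmetric] ennreal_mult[symmetric])
  finally show ?thesis by simp
qed

lemma shell_integral_measurable:
  fixes F :: "'a::euclidean_space \<Rightarrow> ennreal"
  assumes [measurable]: "F \<in> borel_measurable borel"
  shows "case_prod (shell_integral F D x) \<in> borel_measurable (borel \<Otimes>\<^sub>M borel)"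
  unfolding shell_integral_def case_prod_beta by measurable

text \<open>Each \<open>w\<close> in \<open>B\<close> is joined to both vertices. Since
  \<open>u\<close> differs by 1 between them, the two increments add up to at least 1, and the two
  losses of \<open>1/4\<close> leave \<open>1/2\<close>. Integrating over \<open>w\<close> turns the
  segments into cones.\<close>

lemma loewner_vertex_estimate:
  fixes u :: "'a::euclidean_space \<Rightarrow> real"
  assumes u: "\<And>z. (u has_derivative u' z) (at z)" and bound: "\<And>z h. \<bar>u' z h\<bar> \<le> g z * norm h"
    and g[measurable]: "g \<in> borel_measurable borel"
    and B[measurable]: "B \<in> sets borel" and D: "\<And>v w. v \<in> B \<Longrightarrow> w \<in> B \<Longrightarrow> dist v w \<le> D"
    and e: "e \<in> B" "dist x e = \<tau>" "u e = 1" and e': "e' \<in> B" "dist x' e' = \<tau>" "u e' = 0"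
  shows "ennreal (1/2) * emeasure lborel B \<le> ennreal (4 ^ (DIM('a) - 1) * (real DIM('a) * D) ^ DIM('a)) *
    (\<integral>\<^sup>+s. (shell_integral (\<lambda>z. ennreal (g z ^ DIM('a))) D x s \<tau> +
      shell_integral (\<lambda>z. ennreal (g z ^ DIM('a))) D x' s \<tau>) * indicator {0<..1} s \<partial>lborel)"
proof -
  let ?n = "DIM('a)"
  define G where "G z = ennreal (g z ^ ?n)" for z
  define C where "C = ennreal (4 ^ (?n - 1) * (real ?n * D) ^ ?n)"
  define I where "I v w = (\<integral>\<^sup>+s. ennreal (s ^ ((?n - 1) * ?n)) * G (v + s ^ ?n *\<^sub>R (w - v)) * indicator {0<..1} s \<partial>lborel)" for v w
  have [measurable]: "G \<in> borel_measurable borel" unfolding G_def by measurable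
  have n: "1 \<le> ?n" by (simp add: Suc_leI)
  have I_int: "(\<integral>\<^sup>+w. I v w * indicator B w \<partial>lborel) \<le> (\<integral>\<^sup>+s. shell_integral G D y s \<tau> * indicator {0<..1} s \<partial>lborel)"
    if v: "v \<in> B" "dist y v = \<tau>" for v y
  proof -
    have "(\<integral>\<^sup>+w. I v w * indicator B w \<partial>lborel)
      = (\<integral>\<^sup>+w. \<integral>\<^sup>+s. ennreal (s ^ ((?n - 1) * ?n)) * G (v + s ^ ?n *\<^sub>R (w - v)) * indicator {0<..1} s * indicator B w \<partial>lborel \<partial>lborel)"
      unfolding I_def by (intro nn_integral_cong nn_integral_multc[symmetric]) measurable
    also have "\<dots> = (\<integral>\<^sup>+s. \<integral>\<^sup>+w. ennreal (s ^ ((?n - 1) * ?n)) * G (v + s ^ ?n *\<^sub>R (w - v)) * indicator {0<..1} s * indicator B w \<partial>lborel \<partial>lborel)"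
      by (rule lborel_pair.Fubini'[symmetric]) measurable
    also have "\<dots> \<le> (\<integral>\<^sup>+s. shell_integral G D y s \<tau> * indicator {0<..1} s \<partial>lborel)"
    proof (rule nn_integral_mono)
      fix s :: real
      show "(\<integral>\<^sup>+w. ennreal (s ^ ((?n - 1) * ?n)) * G (v + s ^ ?n *\<^sub>R (w - v)) * indicator {0<..1} s * indicator B w \<partial>lborel)
        \<le> shell_integral G D y s \<tau> * indicator {0<..1} s"
      proof (cases "s \<in> {0<..1}")
        case True
        then show ?thesis
          using cone_integral_le_shell_integral[of G s B v D y \<tau>] D[OF v(1)] v(2) by simp
      qed simp
    qed
    finally show ?thesis .
  qed
  have half: "ennreal (1/2) * indicator B w \<le> C * (I e w * indicator B w + I e' w * indicator B w)" for w
  proof (cases "w \<in> B")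
    case True
    have 1: "ennreal \<bar>u v - u w\<bar> \<le> ennreal (1/4) + C * I v w" if "v \<in> B" for v
      unfolding C_def I_def G_def
      by (rule segment_increment_le[OF u bound g n]) (use D[OF that True] in \<open>simp add: dist_norm norm_minus_commute\<close>)
    have "ennreal 1 \<le> ennreal (\<bar>u e - u w\<bar> + \<bar>u e' - u w\<bar>)"
      using e e' by (intro ennreal_leI) simp
    also have "\<dots> \<le> (ennreal (1/4) + C * I e w) + (ennreal (1/4) + C * I e' w)"
      using 1 e(1) e'(1) by (subst ennreal_plus) (auto intro!: add_mono)
    also have "\<dots> = ennreal (1/2) + C * (I e w + I e' w)"
    proof -
      have "ennreal (1/4) + ennreal (1/4) = ennreal (1/2)" by (subst ennreal_plus[symmetric]) auto
      then show ?thesis by (simp add: distrib_left add.assoc add.left_commute)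
    qed
    finally have *: "ennreal 1 \<le> ennreal (1/2) + C * (I e w + I e' w)" .
    \<comment> \<open>Subtracting \<open>1/2\<close> on both sides requires a finite value; the
      infinite case is trivial.\<close>
    have "ennreal (1/2) \<le> C * (I e w + I e' w)"
    proof (cases "C * (I e w + I e' w)" rule: ennreal_cases)
      case (real r)
      have "ennreal (1/2) + ennreal r = ennreal (1/2 + r)"
        using real by (intro ennreal_plus[symmetric]) auto
      with * real(2) have "ennreal 1 \<le> ennreal (1/2 + r)" by (simp only:)
      then have "1 \<le> 1/2 + r" by (rule ennreal_le_iff[THEN iffD1, rotated]) (use real in simp)
      then have "ennreal (1/2) \<le> ennreal r" by (intro ennreal_leI) simp
      then show ?thesis using real(2) by (simp only:)
    qed simp
    then show ?thesis using True by simp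
  qed simp
  have [measurable]: "(\<lambda>w. I v w) \<in> borel_measurable borel" for v
    unfolding I_def by measurable
  have [measurable]: "(\<lambda>s. shell_integral G D y s \<tau>) \<in> borel_measurable borel" for y
    unfolding shell_integral_def by measurable
  have "ennreal (1/2) * emeasure lborel B = (\<integral>\<^sup>+w. ennreal (1/2) * indicator B w \<partial>lborel)"
    by (simp add: nn_integral_cmult)
  also have "\<dots> \<le> (\<integral>\<^sup>+w. C * (I e w * indicator B w + I e' w * indicator B w) \<partial>lborel)"
    by (intro nn_integral_mono half)
  also have "\<dots> = C * ((\<integral>\<^sup>+w. I e w * indicator B w \<partial>lborel) + (\<integral>\<^sup>+w. I e' w * indicator B w \<partial>lborel))"
    by (subst nn_integral_cmult) (simp_all add: nn_integral_add)
  also have "\<dots> \<le> C * ((\<integral>\<^sup>+s. shell_integral G D x s \<tau> * indicator {0<..1} s \<partial>lborel)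
      + (\<integral>\<^sup>+s. shell_integral G D x' s \<tau> * indicator {0<..1} s \<partial>lborel))"
    by (intro mult_left_mono add_mono I_int e e') simp
  also have "\<dots> = C * (\<integral>\<^sup>+s. (shell_integral G D x s \<tau> + shell_integral G D x' s \<tau>) * indicator {0<..1} s \<partial>lborel)"
    by (subst nn_integral_add[symmetric]) (simp_all add: distrib_right)
  finally show ?thesis unfolding C_def G_def .
qed

text \<open>The vertex estimate depends on \<open>e\<close> and \<open>e'\<close> only through
  \<open>\<tau>\<close>, so it can be integrated over \<open>\<tau>\<close> without a measurable
  choice of vertices. The two families of shells contribute \<open>2 * D\<close> each.\<close>

lemma loewner_energy_lower_bound:
  fixes u :: "'a::euclidean_space \<Rightarrow> real"
  assumes u: "\<And>z. (u has_derivative u' z) (at z)" and bound: "\<And>z h. \<bar>u' z h\<bar> \<le> g z * norm h"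
    and g[measurable]: "g \<in> borel_measurable borel"
    and B[measurable]: "B \<in> sets borel" and D: "\<And>v w. v \<in> B \<Longrightarrow> w \<in> B \<Longrightarrow> dist v w \<le> D" "0 \<le> D"
    and E: "\<And>\<tau>. 0 < \<tau> \<Longrightarrow> \<tau> < L \<Longrightarrow> \<exists>e\<in>B. dist x e = \<tau> \<and> u e = 1"
    and F: "\<And>\<tau>. 0 < \<tau> \<Longrightarrow> \<tau> < L \<Longrightarrow> \<exists>e\<in>B. dist x' e = \<tau> \<and> u e = 0" and "0 \<le> L"
  shows "ennreal (1/2) * emeasure lborel B * ennreal L \<le>
    ennreal (4 ^ (DIM('a) - 1) * (real DIM('a) * D) ^ DIM('a)) *
      (ennreal (4 * D) * (\<integral>\<^sup>+z. ennreal (g z ^ DIM('a)) \<partial>lborel))"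
proof -
  let ?n = "DIM('a)"
  define G where "G z = ennreal (g z ^ ?n)" for z
  define C where "C = ennreal (4 ^ (?n - 1) * (real ?n * D) ^ ?n)"
  let ?S = "\<lambda>s \<tau>. shell_integral G D x s \<tau> + shell_integral G D x' s \<tau>"
  have Gm[measurable]: "G \<in> borel_measurable borel" unfolding G_def by measurable
  have [measurable]: "case_prod (shell_integral G D y) \<in> borel_measurable (borel \<Otimes>\<^sub>M borel)" for y
    by (rule shell_integral_measurable) measurable
  have "ennreal (1/2) * emeasure lborel B * ennreal L
      = (\<integral>\<^sup>+\<tau>. ennreal (1/2) * emeasure lborel B * indicator {0<..<L} \<tau> \<partial>lborel)"
    using \<open>0 \<le> L\<close> by (subst nn_integral_cmult) auto
  also have "\<dots> \<le> (\<integral>\<^sup>+\<tau>. C * (\<integral>\<^sup>+s. ?S s \<tau> * indicator {0<..1} s \<partial>lborel) \<partial>lborel)"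
  proof (rule nn_integral_mono)
    fix \<tau> :: real
    show "ennreal (1/2) * emeasure lborel B * indicator {0<..<L} \<tau>
        \<le> C * (\<integral>\<^sup>+s. ?S s \<tau> * indicator {0<..1} s \<partial>lborel)"
    proof (cases "\<tau> \<in> {0<..<L}")
      case True
      then obtain e e' where "e \<in> B" "dist x e = \<tau>" "u e = 1" "e' \<in> B" "dist x' e' = \<tau>" "u e' = 0"
        using E[of \<tau>] F[of \<tau>] by auto
      from loewner_vertex_estimate[OF u bound g B D(1) this] True show ?thesis
        unfolding C_def G_def by simp
    qed simp
  qed
  also have "\<dots> = C * (\<integral>\<^sup>+\<tau>. \<integral>\<^sup>+s. ?S s \<tau> * indicator {0<..1} s \<partial>lborel \<partial>lborel)"
    by (rule nn_integral_cmult) measurable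
  also have "(\<integral>\<^sup>+\<tau>. \<integral>\<^sup>+s. ?S s \<tau> * indicator {0<..1} s \<partial>lborel \<partial>lborel)
      = (\<integral>\<^sup>+s. \<integral>\<^sup>+\<tau>. ?S s \<tau> * indicator {0<..1} s \<partial>lborel \<partial>lborel)"
    by (rule lborel_pair.Fubini') measurable
  also have "C * \<dots> \<le> C * (\<integral>\<^sup>+s. ennreal (4 * D) * (\<integral>\<^sup>+z. G z \<partial>lborel) * indicator {0<..1::real} s \<partial>lborel)"
  proof (intro mult_left_mono nn_integral_mono)
    fix s :: real
    show "(\<integral>\<^sup>+\<tau>. ?S s \<tau> * indicator {0<..1} s \<partial>lborel) \<le> ennreal (4 * D) * (\<integral>\<^sup>+z. G z \<partial>lborel) * indicator {0<..1::real} s"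
    proof (cases "s \<in> {0<..1}")
      case True
      then have "(\<integral>\<^sup>+\<tau>. ?S s \<tau> * indicator {0<..1} s \<partial>lborel)
          = (\<integral>\<^sup>+\<tau>. shell_integral G D x s \<tau> \<partial>lborel) + (\<integral>\<^sup>+\<tau>. shell_integral G D x' s \<tau> \<partial>lborel)"
        by (simp add: nn_integral_add)
      also have "\<dots> \<le> ennreal (2 * D) * (\<integral>\<^sup>+z. G z \<partial>lborel) + ennreal (2 * D) * (\<integral>\<^sup>+z. G z \<partial>lborel)"
        using True D(2) by (intro add_mono integral_shell_integral_le) auto
      also have "\<dots> = (ennreal (2 * D) + ennreal (2 * D)) * (\<integral>\<^sup>+z. G z \<partial>lborel)"
        by (simp add: distrib_right)
      also have "ennreal (2 * D) + ennreal (2 * D) = ennreal (4 * D)"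
        using D(2) by (subst ennreal_plus[symmetric]) auto
      finally show ?thesis using True by simp
    qed simp
  qed simp
  also have "\<dots> = C * (ennreal (4 * D) * (\<integral>\<^sup>+z. G z \<partial>lborel))"
    by (subst nn_integral_cmult) auto
  finally show ?thesis unfolding C_def G_def .
qed

text \<open>With \<open>B\<close> a ball of radius comparable to \<open>d\<close> the powers of \<open>d\<close> cancel: this is the
  conformal invariance of the \<open>n\<close>-energy.\<close>

lemma loewner_constant:
  obtains c0 where "c0 > 0"
    "\<And>u u' g x x' d.
      (\<And>z. ((u :: 'a::euclidean_space \<Rightarrow> real) has_derivative u' z) (at z)) \<Longrightarrow>
      (\<And>z h. \<bar>u' z h\<bar> \<le> g z * norm h) \<Longrightarrow> g \<in> borel_measurable borel \<Longrightarrow>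
      0 < d \<Longrightarrow> dist x x' \<le> d \<Longrightarrow>
      (\<And>\<tau>. 0 < \<tau> \<Longrightarrow> \<tau> < d / 2 \<Longrightarrow> \<exists>e. dist x e = \<tau> \<and> u e = 1) \<Longrightarrow>
      (\<And>\<tau>. 0 < \<tau> \<Longrightarrow> \<tau> < d / 2 \<Longrightarrow> \<exists>e. dist x' e = \<tau> \<and> u e = 0) \<Longrightarrow>
      ennreal c0 \<le> (\<integral>\<^sup>+z. ennreal (g z ^ DIM('a)) \<partial>lborel)"
proof -
  let ?n = "DIM('a)"
  \<comment> \<open>For the ball of radius \<open>2 * d\<close>, its diameter bound
    \<open>4 * d\<close> and \<open>L = d / 2\<close>, the volume side becomes
    \<open>a * d ^ ?n * d\<close> and the factor of the energy \<open>b * d ^ ?n * d\<close>. The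
    radius \<open>2 * d\<close> is large enough to contain the spheres about
    \<open>x'\<close>.\<close>
  define a where "a = unit_ball_vol (real ?n) * 2 ^ ?n / 4"
  define b where "b = 4 ^ (?n - 1) * (real ?n * 4) ^ ?n * 16"
  have ab: "a > 0" "b > 0" by (auto simp: a_def b_def)
  show thesis
  proof (rule that[of "a / b"])
    show "a / b > 0" using ab by simp
    fix u :: "'a \<Rightarrow> real" and u' g x x' and d :: real
    assume u: "\<And>z. (u has_derivative u' z) (at z)" and bound: "\<And>z h. \<bar>u' z h\<bar> \<le> g z * norm h"
      and g: "g \<in> borel_measurable borel" and d: "0 < d" and xx: "dist x x' \<le> d"
      and E: "\<And>\<tau>. 0 < \<tau> \<Longrightarrow> \<tau> < d / 2 \<Longrightarrow> \<exists>e. dist x e = \<tau> \<and> u e = 1"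
      and F: "\<And>\<tau>. 0 < \<tau> \<Longrightarrow> \<tau> < d / 2 \<Longrightarrow> \<exists>e. dist x' e = \<tau> \<and> u e = 0"
    let ?B = "cball x (2 * d)"
    let ?I = "\<integral>\<^sup>+z. ennreal (g z ^ ?n) \<partial>lborel"
    have "ennreal (1/2) * emeasure lborel ?B * ennreal (d/2) \<le>
        ennreal (4 ^ (?n - 1) * (real ?n * (4 * d)) ^ ?n) * (ennreal (4 * (4 * d)) * ?I)"
    proof (rule loewner_energy_lower_bound[OF u bound g])
      show "dist v w \<le> 4 * d" if "v \<in> ?B" "w \<in> ?B" for v w
        using that dist_triangle3[of v w x] by simp
      show "\<exists>e\<in>?B. dist x e = \<tau> \<and> u e = 1" if "0 < \<tau>" "\<tau> < d/2" for \<tau>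
        using E[OF that] that d by force
      show "\<exists>e\<in>?B. dist x' e = \<tau> \<and> u e = 0" if \<tau>: "0 < \<tau>" "\<tau> < d/2" for \<tau>
      proof -
        obtain e where "dist x' e = \<tau>" "u e = 0" using F[OF \<tau>] by blast
        moreover from this have "dist x e \<le> 2 * d" using dist_triangle[of x e x'] xx \<tau> d by linarith
        ultimately show ?thesis by auto
      qed
    qed (use d in auto)
    also have "ennreal (1/2) * emeasure lborel ?B * ennreal (d/2) = ennreal (a * d ^ ?n * d)"
    proof -
      have "emeasure lborel ?B = ennreal (unit_ball_vol (real ?n) * (2 * d) ^ ?n)"
        using d by (simp add: emeasure_cball)
      moreover have "ennreal (1/2) * ennreal V * ennreal (d/2) = ennreal (1/2 * V * (d/2))" if "0 \<le> V" for V
      proof -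
        have "0 \<le> d/2" using d by simp
        from ennreal_mult''[OF this, of "1/2 * V"] ennreal_mult''[OF that, of "1/2"] show ?thesis
          by (simp only:)
      qed
      moreover have "1/2 * (unit_ball_vol (real ?n) * (2 * d) ^ ?n) * (d/2) = a * d ^ ?n * d"
        by (simp add: a_def power_mult_distrib)
      moreover have "0 \<le> unit_ball_vol (real ?n) * (2 * d) ^ ?n" using d by simp
      ultimately show ?thesis by (simp only:)
    qed
    also have "ennreal (4 ^ (?n - 1) * (real ?n * (4 * d)) ^ ?n) * (ennreal (4 * (4 * d)) * ?I)
        = ennreal (b * d ^ ?n * d) * ?I"
    proof -
      have "0 \<le> 4 * (4 * d)" using d by simp
      note m = ennreal_mult''[OF this, of "4 ^ (?n - 1) * (real ?n * (4 * d)) ^ ?n"]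
      have "4 ^ (?n - 1) * (real ?n * (4 * d)) ^ ?n * (4 * (4 * d)) = b * d ^ ?n * d"
        by (simp add: b_def power_mult_distrib)
      then show ?thesis using m by (simp only: mult.assoc[symmetric])
    qed
    finally have *: "ennreal (a * d ^ ?n * d) \<le> ennreal (b * d ^ ?n * d) * ?I" .
    show "ennreal (a / b) \<le> ?I"
    proof (cases ?I rule: ennreal_cases)
      case (real r)
      then have "a * (d ^ ?n * d) \<le> b * r * (d ^ ?n * d)"
        using * d ab by (simp add: ennreal_mult[symmetric] mult_ac)
      then have "a \<le> b * r" using d by simp
      then show ?thesis using real ab by (simp add: field_simps ennreal_leI)
    qed simp
  qed
qed

section \<open>Logarithmic cut-off functions\<close>

lemma has_derivative_max_0_square:
  "((\<lambda>t. (max 0 t)\<^sup>2) has_real_derivative 2 * max 0 t) (at (t :: real))"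
proof -
  consider "t > 0" | "t < 0" | "t = 0" by linarith
  then show ?thesis
  proof cases
    case 1
    have "((\<lambda>t. t\<^sup>2) has_real_derivative 2 * t) (at t)" by (auto intro!: derivative_eq_intros)
    moreover have "\<forall>\<^sub>F s in nhds t. (max 0 s)\<^sup>2 = s\<^sup>2"
      using eventually_nhds_in_open[of "{0<..}" t] 1 by (auto elim!: eventually_mono)
    ultimately show ?thesis using 1 by (subst DERIV_cong_ev[OF refl _ refl]) auto
  next
    case 2
    have "((\<lambda>t. 0) has_real_derivative 0) (at t)" by simp
    moreover have "\<forall>\<^sub>F s in nhds t. (max 0 s)\<^sup>2 = 0"
      using eventually_nhds_in_open[of "{..<0}" t] 2 by (auto elim!: eventually_mono)
    ultimately have "((\<lambda>t. (max 0 t)\<^sup>2) has_real_derivative 0) (at t)"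
      by (rule DERIV_cong_ev[THEN iffD2, OF refl _ refl, rotated])
    then show ?thesis using 2 by simp
  next
    case 3
    have "(\<lambda>h. (max 0 h)\<^sup>2 / h) \<midarrow>0\<rightarrow> (0::real)"
    proof (rule Lim_null_comparison)
      show "\<forall>\<^sub>F h in at 0. norm ((max 0 h)\<^sup>2 / h) \<le> \<bar>h :: real\<bar>"
        by (intro always_eventually allI) (auto simp: max_def power2_eq_square)
      show "((\<lambda>h. \<bar>h :: real\<bar>) \<longlongrightarrow> 0) (at 0)" by (auto intro!: tendsto_eq_intros)
    qed
    then show ?thesis using 3 by (simp add: DERIV_def)
  qed
qed

text \<open>The energy estimate needs a derivative at every point, which rules out a piecewise
  linear step. On \<open>{0..1}\<close> the function is \<open>1 - (1 - t^2)^2\<close>, built from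
  the differentiable square of the positive part; its derivative \<open>4 * t * (1 - t^2)\<close> is
  at most 4.\<close>

lemma smooth_step:
  obtains \<eta> \<eta>' :: "real \<Rightarrow> real" where
    "\<And>t. (\<eta> has_real_derivative \<eta>' t) (at t)" "\<And>t. t \<le> 0 \<Longrightarrow> \<eta> t = 0" "\<And>t. 1 \<le> t \<Longrightarrow> \<eta> t = 1"
    "\<And>t. t \<notin> {0..1} \<Longrightarrow> \<eta>' t = 0" "\<And>t. \<bar>\<eta>' t\<bar> \<le> 4"
proof
  define p :: "real \<Rightarrow> real" where "p t = (max 0 t)\<^sup>2" for t
  define \<eta>' where "\<eta>' t = 2 * max 0 (1 - p t) * (2 * max 0 t)" for t
  have p: "(p has_real_derivative 2 * max 0 t) (at t)" for t
    unfolding p_def using has_derivative_max_0_square .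
  show "((\<lambda>t. 1 - p (1 - p t)) has_real_derivative \<eta>' t) (at t)" for t
    unfolding \<eta>'_def by (rule derivative_eq_intros DERIV_chain2[OF p] p refl | simp)+
  have p1: "1 \<le> p t" if "1 \<le> t" for t using that by (simp add: p_def max_def one_le_power)
  show "1 - p (1 - p t) = 0" if "t \<le> 0" for t using that by (simp add: p_def)
  show "1 - p (1 - p t) = 1" if "1 \<le> t" for t using p1[OF that] by (simp add: p_def[of "1 - p t"] max_def)
  show out: "\<eta>' t = 0" if "t \<notin> {0..1}" for t
    using that p1[of t] by (auto simp: \<eta>'_def max_def)
  show "\<bar>\<eta>' t\<bar> \<le> 4" for t
  proof (cases "t \<in> {0..1}")
    case True
    then have "0 \<le> p t" "p t \<le> 1" by (auto simp: p_def max_def power_le_one)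
    then have "max 0 (1 - p t) * max 0 t \<le> 1 * 1" using True by (intro mult_mono) auto
    moreover have "\<eta>' t = 4 * (max 0 (1 - p t) * max 0 t)" by (simp add: \<eta>'_def)
    moreover have "0 \<le> max 0 (1 - p t) * max 0 t" by simp
    ultimately show ?thesis by linarith
  qed (simp add: out)
qed

text \<open>The logarithmic cut-off function of the annulus \<open>2^-(N+1) D \<le> |w - c| \<le> D/2\<close>; its
  \<open>n\<close>-energy is of order \<open>N^(1-n)\<close>, as can be seen on dyadic shells.\<close>

lemma log_cutoff:
  fixes c :: "'a::euclidean_space"
  assumes D: "0 < D" and N: "0 < N"
  obtains v v' V where
    "\<And>w. ((v :: 'a \<Rightarrow> real) has_derivative v' w) (at w)" "\<And>w h. \<bar>v' w h\<bar> \<le> V w * norm h"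
    "V \<in> borel_measurable borel" "\<And>w. 0 \<le> V w"
    "(\<integral>\<^sup>+w. ennreal (V w ^ DIM('a)) \<partial>lborel) \<le> ennreal (real N * (16 / real N) ^ DIM('a) * unit_ball_vol (real DIM('a)))"
    "\<And>w. dist c w \<le> D / 2 ^ Suc N \<Longrightarrow> v w = 1" "\<And>w. D / 2 \<le> dist c w \<Longrightarrow> v w = 0"
proof -
  let ?n = "DIM('a)"
  obtain \<eta> \<eta>' :: "real \<Rightarrow> real" where \<eta>: "\<And>t. (\<eta> has_real_derivative \<eta>' t) (at t)"
    "\<And>t. t \<le> 0 \<Longrightarrow> \<eta> t = 0" "\<And>t. 1 \<le> t \<Longrightarrow> \<eta> t = 1"
    "\<And>t. t \<notin> {0..1} \<Longrightarrow> \<eta>' t = 0" "\<And>t. \<bar>\<eta>' t\<bar> \<le> 4"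
    using smooth_step by blast
  \<comment> \<open>Normalises the logarithm so that \<open>\<theta>\<close> below is 0 on the
    sphere of radius \<open>D/2\<close> and 1 on the sphere of radius \<open>r\<close>.\<close>
  define \<kappa> where "\<kappa> = 1 / (real N * ln 2)"
  have \<kappa>: "0 < \<kappa>" "\<kappa> \<le> 2 / real N"
  proof -
    show "0 < \<kappa>" using N by (simp add: \<kappa>_def)
    have "1/2 \<le> ln (2::real)" using ln_le_minus_one[of "1/2 :: real"] by (simp add: ln_div)
    then have "real N * (1/2) \<le> real N * ln 2" by (intro mult_left_mono) auto
    then have "1 / (real N * ln 2) \<le> 1 / (real N * (1/2))" using N by (intro divide_left_mono) auto
    then show "\<kappa> \<le> 2 / real N" by (simp add: \<kappa>_def)
  qed
  define r where "r = D / 2 ^ Suc N"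
  have r: "0 < r" using D by (simp add: r_def)
  define \<theta> where "\<theta> w = \<kappa> * (ln (D/2) - ln (norm (w - c)))" for w
  \<comment> \<open>\<open>\<theta> c\<close> involves the default value of \<open>ln 0\<close>, so
    the centre is treated separately.\<close>
  define v where "v w = (if w = c then 1 else \<eta> (\<theta> w))" for w
  \<comment> \<open>The 8 combines the bound 4 for \<open>\<eta>'\<close> with
    \<open>\<kappa> \<le> 2 / real N\<close>.\<close>
  define V where "V w = (if r \<le> dist c w \<and> dist c w \<le> D/2 then 8 / (real N * dist c w) else 0)" for w
  have lnr: "ln (D/2) - ln r = real N * ln 2"
  proof -
    have "D/2 = 2 ^ N * r" by (simp add: r_def)
    then show ?thesis using r by (simp add: ln_mult ln_realpow)
  qed
  have \<theta>1: "1 \<le> \<theta> w \<longleftrightarrow> norm (w - c) \<le> r" if "w \<noteq> c" for w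
  proof -
    have "1 \<le> \<theta> w \<longleftrightarrow> real N * ln 2 \<le> ln (D/2) - ln (norm (w - c))"
      using N by (simp add: \<theta>_def \<kappa>_def field_simps)
    also have "\<dots> \<longleftrightarrow> ln (norm (w - c)) \<le> ln r" using lnr by linarith
    finally show ?thesis using that r by simp
  qed
  have \<theta>0: "\<theta> w \<le> 0 \<longleftrightarrow> D/2 \<le> norm (w - c)" if "w \<noteq> c" for w
  proof -
    have "\<theta> w \<le> 0 \<longleftrightarrow> ln (D/2) \<le> ln (norm (w - c))"
      using \<kappa>(1) by (simp add: \<theta>_def mult_le_0_iff)
    then show ?thesis using that D by simp
  qed
  have one: "v w = 1" if "dist c w \<le> r" for w
    using that \<theta>1[of w] \<eta>(3)[of "\<theta> w"] by (auto simp: v_def dist_norm norm_minus_commute)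
  have zero: "v w = 0" if "D/2 \<le> dist c w" for w
    using that \<theta>0[of w] \<eta>(2)[of "\<theta> w"] D by (auto simp: v_def dist_norm norm_minus_commute)
  define v' where "v' w h = (if w = c then 0 else \<eta>' (\<theta> w) * (- \<kappa> * (h \<bullet> sgn (w - c) / norm (w - c))))" for w h
  have dv: "(v has_derivative v' w) (at w)" for w
  proof (cases "w = c")
    case True
    have "(v has_derivative (\<lambda>_. 0)) (at w)"
      by (rule has_derivative_transform_within_open[OF has_derivative_const[of 1] open_ball[of c r]])
        (use True r one in auto)
    then show ?thesis using True by (simp add: v'_def[abs_def])
  next
    case False
    have "((\<lambda>z. norm (z - c)) has_derivative (\<lambda>h. h \<bullet> sgn (w - c))) (at w)"
      by (rule has_derivative_compose[of "\<lambda>z. z - c" "\<lambda>h. h", OF _ has_derivative_norm])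
        (use False in \<open>auto intro!: derivative_eq_intros\<close>)
    moreover have "(ln has_derivative (*) (inverse (norm (w - c)))) (at (norm (w - c)))"
      using DERIV_ln[of "norm (w - c)"] False by (simp add: has_field_derivative_def)
    ultimately have "((\<lambda>z. ln (norm (z - c))) has_derivative (\<lambda>h. inverse (norm (w - c)) * (h \<bullet> sgn (w - c)))) (at w)"
      by (rule has_derivative_compose)
    then have "(\<theta> has_derivative (\<lambda>h. \<kappa> * (0 - inverse (norm (w - c)) * (h \<bullet> sgn (w - c))))) (at w)"
      unfolding \<theta>_def by (intro has_derivative_mult_right has_derivative_diff has_derivative_const)
    then have "(\<theta> has_derivative (\<lambda>h. - \<kappa> * (h \<bullet> sgn (w - c) / norm (w - c)))) (at w)"
      by (simp add: divide_inverse mult.commute)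
    then have "((\<lambda>z. \<eta> (\<theta> z)) has_derivative (\<lambda>h. \<eta>' (\<theta> w) * (- \<kappa> * (h \<bullet> sgn (w - c) / norm (w - c))))) (at w)"
      by (rule has_derivative_compose[OF _ \<eta>(1)[unfolded has_field_derivative_def]])
    then have "(v has_derivative (\<lambda>h. \<eta>' (\<theta> w) * (- \<kappa> * (h \<bullet> sgn (w - c) / norm (w - c))))) (at w)"
      by (rule has_derivative_transform_within_open[of _ _ _ _ "- {c}"]) (use False in \<open>auto simp: v_def\<close>)
    then show ?thesis using False by (simp add: v'_def[abs_def])
  qed
  have bd: "\<bar>v' w h\<bar> \<le> V w * norm h" for w h
  proof (cases "w \<noteq> c \<and> \<theta> w \<in> {0..1}")
    case False
    then have "v' w h = 0" using \<eta>(4) by (auto simp: v'_def)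
    then show ?thesis using N by (auto simp: V_def)
  next
    case True
    then have w: "w \<noteq> c" "0 < norm (w - c)" by auto
    have "r \<le> dist c w \<and> dist c w \<le> D/2"
    proof -
      have "\<not> norm (w - c) < r"
      proof
        assume "norm (w - c) < r"
        then have "ln (norm (w - c)) < ln r" using w r by simp
        then have "real N * ln 2 < ln (D/2) - ln (norm (w - c))" using lnr by linarith
        then have "1 < \<theta> w" using N by (simp add: \<theta>_def \<kappa>_def field_simps)
        then show False using True by simp
      qed
      moreover have "\<not> D/2 < norm (w - c)"
      proof
        assume "D/2 < norm (w - c)"
        then have "ln (D/2) < ln (norm (w - c))" using D w by simp
        then have "\<theta> w < 0" using \<kappa>(1) by (simp add: \<theta>_def mult_less_0_iff)
        then show False using True by simp
      qed
      ultimately show ?thesis by (simp add: dist_norm norm_minus_commute)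
    qed
    then have Vw: "V w = 8 / (real N * norm (w - c))" by (simp add: V_def dist_norm norm_minus_commute)
    have "\<bar>h \<bullet> sgn (w - c)\<bar> \<le> norm h" using Cauchy_Schwarz_ineq2[of h "sgn (w - c)"] w by (simp add: norm_sgn)
    then have "\<bar>h \<bullet> sgn (w - c)\<bar> / norm (w - c) \<le> norm h / norm (w - c)" by (rule divide_right_mono) simp
    moreover have "\<bar>v' w h\<bar> = \<bar>\<eta>' (\<theta> w)\<bar> * (\<kappa> * (\<bar>h \<bullet> sgn (w - c)\<bar> / norm (w - c)))"
      using w \<kappa>(1) by (simp add: v'_def abs_mult)
    ultimately have "\<bar>v' w h\<bar> \<le> 4 * (2 / real N * (norm h / norm (w - c)))"
      using \<eta>(5)[of "\<theta> w"] \<kappa> w by (simp only:) (intro mult_mono; simp)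
    also have "\<dots> = V w * norm h" using Vw by simp
    finally show ?thesis .
  qed
  have Vm[measurable]: "V \<in> borel_measurable borel" unfolding V_def by measurable
  have V0: "0 \<le> V w" for w by (simp add: V_def)
  \<comment> \<open>On the \<open>k\<close>-th dyadic shell \<open>dist c w\<close> is at least
    \<open>D / 2^(k+2)\<close>, and the shell lies in the ball of radius \<open>D / 2^(k+1)\<close>.
    Height times radius is \<open>16 / real N\<close> for every \<open>k\<close>, so all shells
    contribute the same amount.\<close>
  have shell: "ennreal (V w ^ ?n) \<le> (\<Sum>k<N. ennreal ((8 * 2 ^ (k+2) / (real N * D)) ^ ?n) * indicator (cball c (D / 2 ^ (k+1))) w)" for w
  proof (cases "r \<le> dist c w \<and> dist c w \<le> D/2")
    case False
    then have "V w = 0" by (auto simp: V_def)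
    then show ?thesis by (simp add: power_0_left)
  next
    case True
    have "\<exists>k<N. D / 2 ^ (k+2) \<le> dist c w \<and> dist c w \<le> D / 2 ^ (k+1)"
    proof -
      define k where "k = (LEAST k. D / 2 ^ (k+2) \<le> dist c w)"
      obtain M where M: "N = Suc M" using N by (cases N) auto
      have ex: "D / 2 ^ (M+2) \<le> dist c w" using True M by (simp add: r_def)
      have k: "D / 2 ^ (k+2) \<le> dist c w" "k \<le> M"
        unfolding k_def by (rule LeastI[of _ M], rule ex) (rule Least_le, rule ex)
      have "dist c w \<le> D / 2 ^ (k+1)"
      proof (cases k)
        case 0 then show ?thesis using True by simp
      next
        case (Suc j)
        then have "\<not> D / 2 ^ (j+2) \<le> dist c w" using not_less_Least[of j "\<lambda>k. D / 2 ^ (k+2) \<le> dist c w"] unfolding k_def by simp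
        then show ?thesis using Suc by simp
      qed
      then show ?thesis using k M by (intro exI[of _ k]) auto
    qed
    then obtain k where k: "k < N" "D / 2 ^ (k+2) \<le> dist c w" "dist c w \<le> D / 2 ^ (k+1)" by blast
    have dpos: "0 < dist c w" using True r by linarith
    have "1 / dist c w \<le> 1 / (D / 2 ^ (k+2))" using k(2) D dpos by (intro divide_left_mono) auto
    then have "8 / real N * (1 / dist c w) \<le> 8 / real N * (1 / (D / 2 ^ (k+2)))"
      by (intro mult_left_mono) auto
    then have "V w \<le> 8 * 2 ^ (k+2) / (real N * D)" using True by (simp add: V_def)
    then have "ennreal (V w ^ ?n) \<le> ennreal ((8 * 2 ^ (k+2) / (real N * D)) ^ ?n) * indicator (cball c (D / 2 ^ (k+1))) w"
      using k(3) V0 by (simp add: ennreal_leI power_mono)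
    also have "\<dots> \<le> (\<Sum>k<N. ennreal ((8 * 2 ^ (k+2) / (real N * D)) ^ ?n) * indicator (cball c (D / 2 ^ (k+1))) w)"
      using k(1) by (intro member_le_sum) auto
    finally show ?thesis .
  qed
  have "(\<integral>\<^sup>+w. ennreal (V w ^ ?n) \<partial>lborel)
      \<le> (\<integral>\<^sup>+w. (\<Sum>k<N. ennreal ((8 * 2 ^ (k+2) / (real N * D)) ^ ?n) * indicator (cball c (D / 2 ^ (k+1))) w) \<partial>lborel)"
    by (intro nn_integral_mono shell)
  also have "\<dots> = (\<Sum>k<N. ennreal ((8 * 2 ^ (k+2) / (real N * D)) ^ ?n) * emeasure lborel (cball c (D / 2 ^ (k+1))))"
    by (subst nn_integral_sum, intro borel_measurable_times_ennreal borel_measurable_indicator borel_measurable_const, simp)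
      (intro sum.cong refl nn_integral_cmult_indicator, simp)
  also have "\<dots> = (\<Sum>k<N. ennreal ((16 / real N) ^ ?n * unit_ball_vol (real ?n)))"
  proof (rule sum.cong[OF refl])
    fix k
    have "emeasure lborel (cball c (D / 2 ^ (k+1))) = ennreal (unit_ball_vol (real ?n) * (D / 2 ^ (k+1)) ^ ?n)"
      using D by (intro emeasure_cball) simp
    moreover have "(8 * 2 ^ (k+2) / (real N * D)) ^ ?n * (unit_ball_vol (real ?n) * (D / 2 ^ (k+1)) ^ ?n)
        = (16 / real N) ^ ?n * unit_ball_vol (real ?n)"
    proof -
      have "(8 * 2 ^ (k+2) / (real N * D)) * (D / 2 ^ (k+1)) = 16 / real N" using D by (simp add: field_simps)
      then have "(8 * 2 ^ (k+2) / (real N * D)) ^ ?n * (D / 2 ^ (k+1)) ^ ?n = (16 / real N) ^ ?n"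
        by (metis power_mult_distrib)
      then show ?thesis by (simp add: mult.left_commute mult.commute)
    qed
    ultimately show "ennreal ((8 * 2 ^ (k+2) / (real N * D)) ^ ?n) * emeasure lborel (cball c (D / 2 ^ (k+1)))
        = ennreal ((16 / real N) ^ ?n * unit_ball_vol (real ?n))"
      using D by (metis ennreal_mult'' mult_nonneg_nonneg unit_ball_vol_nonneg of_nat_0_le_iff zero_le_power
          divide_nonneg_nonneg less_imp_le zero_le_numeral)
  qed
  also have "\<dots> = ennreal (\<Sum>k<N. (16 / real N) ^ ?n * unit_ball_vol (real ?n))"
    by (rule sum_ennreal) simp
  also have "(\<Sum>k<N. (16 / real N) ^ ?n * unit_ball_vol (real ?n)) = real N * (16 / real N) ^ ?n * unit_ball_vol (real ?n)"
    by simp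
  finally show thesis
    using that[OF dv bd Vm V0 _ one[unfolded r_def] zero] by blast
qed

section \<open>Distortion of quasiconformal maps\<close>

text \<open>The image of \<open>G\<close> may be smaller than the whole space, hence an inequality.
  Finiteness of the integral supplies the absolute integrability, and invariance of domain the
  measurability of the image.\<close>

lemma nn_integral_change_of_variables_le:
  fixes f :: "real^'m::{finite,wellorder} \<Rightarrow> real^'m::_" and \<phi> :: "real^'m::_ \<Rightarrow> real"
  assumes G: "open G" and der: "\<And>x. x \<in> G \<Longrightarrow> (f has_derivative f' x) (at x)" and inj: "inj_on f G"
    and \<phi>: "\<phi> \<in> borel_measurable borel" "\<And>y. 0 \<le> \<phi> y" "(\<integral>\<^sup>+y. ennreal (\<phi> y) \<partial>lborel) < \<infinity>"
  shows "(\<integral>\<^sup>+x. ennreal (\<bar>det (matrix (f' x))\<bar> * \<phi> (f x)) * indicator G x \<partial>lborel) \<le> (\<integral>\<^sup>+y. ennreal (\<phi> y) \<partial>lborel)"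
proof -
  have contf: "continuous_on G f"
    using der has_derivative_continuous continuous_at_imp_continuous_on by blast
  have opn: "open (f ` G)" by (rule invariance_of_domain[OF contf G inj])
  have intU: "\<phi> integrable_on UNIV" by (rule nn_integral_integrable_on[OF \<phi>])
  then have "\<phi> absolutely_integrable_on UNIV"
    by (subst absolutely_integrable_on_iff_nonneg) (use \<phi>(2) in auto)
  then have abs: "\<phi> absolutely_integrable_on f ` G"
    by (rule set_integrable_subset) (use opn in auto)
  \<comment> \<open>The formula concerns vector-valued integrands, so \<open>\<phi>\<close> is read
    as a map into \<open>real^1\<close>.\<close>
  let ?l = "\<lambda>y. vec (\<phi> y) :: real^1"
  have "?l absolutely_integrable_on f ` G \<and> integral (f ` G) ?l = vec (integral (f ` G) \<phi>)"
    using abs unfolding absolutely_integrable_on_1_iff integral_on_1_eq by (simp add: o_def)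
  then have "(\<lambda>x. \<bar>det (matrix (f' x))\<bar> *\<^sub>R ?l (f x)) absolutely_integrable_on G \<and>
      integral G (\<lambda>x. \<bar>det (matrix (f' x))\<bar> *\<^sub>R ?l (f x)) = vec (integral (f ` G) \<phi>)"
    by (subst has_absolute_integral_change_of_variables)
      (use G inj has_derivative_at_withinI[OF der] in auto)
  then have I: "(\<lambda>x. \<bar>det (matrix (f' x))\<bar> * \<phi> (f x)) integrable_on G"
    "integral G (\<lambda>x. \<bar>det (matrix (f' x))\<bar> * \<phi> (f x)) = integral (f ` G) \<phi>"
    unfolding absolutely_integrable_on_1_iff integral_on_1_eq
    by (auto simp: o_def vec_eq_iff set_lebesgue_integral_eq_integral)
  have "(\<integral>\<^sup>+x. ennreal (\<bar>det (matrix (f' x))\<bar> * \<phi> (f x)) * indicator G x \<partial>lborel) = ennreal (integral (f ` G) \<phi>)"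
    by (rule nn_integral_has_integral_lebesgue') (use \<phi>(2) I integrable_integral[OF I(1)] in auto)
  also have "\<dots> \<le> ennreal (integral UNIV \<phi>)"
    by (intro ennreal_leI integral_subset_le)
      (use \<phi>(2) intU abs in \<open>auto simp: set_lebesgue_integral_eq_integral\<close>)
  also have "\<dots> = (\<integral>\<^sup>+y. ennreal (\<phi> y) \<partial>lborel)"
    using nn_integral_has_integral_lebesgue'[of UNIV \<phi> "integral UNIV \<phi>"] \<phi>(2) integrable_integral[OF intU] by auto
  finally show ?thesis .
qed

lemma connected_meets_sphere:
  fixes x :: "'a::euclidean_space"
  assumes "connected S" "p \<in> S" "q \<in> S" "dist x p \<le> \<tau>" "\<tau> \<le> dist x q"
  shows "\<exists>e\<in>S. dist x e = \<tau>"
proof -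
  have "connected (dist x ` S)"
    by (intro connected_continuous_image assms continuous_intros)
  then have "\<tau> \<in> dist x ` S"
    using connectedD_interval[of "dist x ` S" "dist x p" "dist x q" \<tau>] assms by auto
  then show ?thesis by auto
qed

text \<open>The majorant \<open>g\<close> contains the n-th root of
  \<open>K * \<bar>det (J z)\<bar>\<close> in place of the operator norm, so that its n-th power is
  \<open>K\<close> times the integrand of the change of variables formula. Compactness of
  \<open>S\<close> makes the composition vanish off a compact subset of \<open>G\<close>, which
  keeps the extension by zero differentiable at the boundary.\<close>

lemma cutoff_composition_energy:
  fixes f :: "real^'m::{finite,wellorder} \<Rightarrow> real^'m::_" and J :: "real^'m::_ \<Rightarrow> real^('m::_)^('m::_)"
  assumes G: "open G" and J: "continuous_on G J"
    and der: "\<And>z. z \<in> G \<Longrightarrow> (f has_derivative (\<lambda>h. J z *v h)) (at z)" and inj: "inj_on f G"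
    and K: "0 \<le> K" and qc: "\<And>z h. z \<in> G \<Longrightarrow> norm (J z *v h) ^ CARD('m::_) \<le> K * \<bar>det (J z)\<bar> * norm h ^ CARD('m::_)"
    and v: "\<And>w. ((v :: real^'m::_ \<Rightarrow> real) has_derivative v' w) (at w)" "\<And>w h. \<bar>v' w h\<bar> \<le> V w * norm h"
    and V: "V \<in> borel_measurable borel" "\<And>w. 0 \<le> V w"
    and VI: "(\<integral>\<^sup>+w. ennreal (V w ^ CARD('m::_)) \<partial>lborel) < \<infinity>"
    and S: "compact S" "S \<subseteq> f ` G" "\<And>w. w \<notin> S \<Longrightarrow> v w = 0"
  obtains u' g where
    "\<And>z. ((\<lambda>z. if z \<in> G then v (f z) else 0) has_derivative u' z) (at z)"
    "\<And>z h. \<bar>u' z h\<bar> \<le> g z * norm h" "g \<in> borel_measurable borel"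
    "(\<integral>\<^sup>+z. ennreal (g z ^ CARD('m::_)) \<partial>lborel) \<le> ennreal K * (\<integral>\<^sup>+w. ennreal (V w ^ CARD('m::_)) \<partial>lborel)"
proof -
  let ?n = "CARD('m)"
  let ?u = "\<lambda>z. if z \<in> G then v (f z) else 0"
  have n: "0 < ?n" by simp
  have contf: "continuous_on G f"
    using der has_derivative_continuous continuous_at_imp_continuous_on by blast
  obtain f1 where f1: "homeomorphism G (f ` G) f f1"
    using invariance_of_domain_homeomorphism[OF G contf _ inj] by auto
  define T where "T = f1 ` S"
  have "continuous_on S f1" using f1 S(2) unfolding homeomorphism_def by (metis continuous_on_subset)
  then have "compact T" unfolding T_def using S(1) by (rule compact_continuous_image)
  then have Tc: "open (- T)" by (simp add: compact_imp_closed open_Compl)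
  have outT: "?u z = 0" if "z \<in> - T" for z
  proof (cases "z \<in> G")
    case True
    then have "f z \<notin> S" using that f1 unfolding T_def homeomorphism_def by (metis ComplD imageI)
    then show ?thesis using S(3) by simp
  qed simp
  have TG: "T \<subseteq> G" using f1 S(2) unfolding T_def homeomorphism_def by auto
  define u' where "u' z h = (if z \<in> G then v' (f z) (J z *v h) else 0)" for z h
  define g where "g z = (if z \<in> G then V (f z) * root ?n (K * \<bar>det (J z)\<bar>) else 0)" for z
  have du: "(?u has_derivative u' z) (at z)" for z
  proof (cases "z \<in> G")
    case True
    have "((\<lambda>z. v (f z)) has_derivative (\<lambda>h. v' (f z) (J z *v h))) (at z)"
      by (rule has_derivative_compose[OF der[OF True] v(1)])
    then have "(?u has_derivative (\<lambda>h. v' (f z) (J z *v h))) (at z)"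
      by (rule has_derivative_transform_within_open[OF _ G True]) simp
    then show ?thesis using True by (simp add: u'_def[abs_def])
  next
    case False
    have "z \<in> - T" using False TG by auto
    have "(?u has_derivative (\<lambda>_. 0)) (at z)"
      by (rule has_derivative_transform_within_open[OF has_derivative_const[of 0] Tc \<open>z \<in> - T\<close>])
        (use outT in auto)
    then show ?thesis using False by (simp add: u'_def[abs_def])
  qed
  have bd: "\<bar>u' z h\<bar> \<le> g z * norm h" for z h
  proof (cases "z \<in> G")
    case True
    have "norm (J z *v h) ^ ?n \<le> (root ?n (K * \<bar>det (J z)\<bar>) * norm h) ^ ?n"
      using qc[OF True] K n by (simp add: power_mult_distrib real_root_pow_pos2)
    then have "norm (J z *v h) \<le> root ?n (K * \<bar>det (J z)\<bar>) * norm h"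
      by (rule power_mono_iff[THEN iffD1, rotated -1]) (use K n in auto)
    then have "V (f z) * norm (J z *v h) \<le> V (f z) * (root ?n (K * \<bar>det (J z)\<bar>) * norm h)"
      using V(2) by (intro mult_left_mono)
    then show ?thesis using v(2)[of "f z" "J z *v h"] True by (simp add: u'_def g_def)
  qed (simp add: u'_def g_def)
  have gm: "g \<in> borel_measurable borel"
  proof -
    have "continuous_on G (\<lambda>z. root ?n (K * \<bar>det (J z)\<bar>))"
      unfolding det_def using J by (intro continuous_intros)
    then have 1: "(\<lambda>z. root ?n (K * \<bar>det (J z)\<bar>)) \<in> borel_measurable (restrict_space borel G)"
      by (rule borel_measurable_continuous_on_restrict)
    have 2: "(\<lambda>z. V (f z)) \<in> borel_measurable (restrict_space borel G)"
      using measurable_compose[OF borel_measurable_continuous_on_restrict[OF contf] V(1)] .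
    have "(\<lambda>z. V (f z) * root ?n (K * \<bar>det (J z)\<bar>)) \<in> borel_measurable (restrict_space borel G)"
      using 1 2 by measurable
    then have "(\<lambda>z. indicator G z * (V (f z) * root ?n (K * \<bar>det (J z)\<bar>))) \<in> borel_measurable borel"
      using G by (subst (asm) borel_measurable_restrict_space_iff) auto
    moreover have "g = (\<lambda>z. indicator G z * (V (f z) * root ?n (K * \<bar>det (J z)\<bar>)))"
      by (auto simp: g_def)
    ultimately show ?thesis by simp
  qed
  have "ennreal (g z ^ ?n) \<le> ennreal K * (ennreal (\<bar>det (matrix (\<lambda>h. J z *v h))\<bar> * V (f z) ^ ?n) * indicator G z)" for z
  proof (cases "z \<in> G")
    case True
    have "g z ^ ?n = K * (\<bar>det (J z)\<bar> * V (f z) ^ ?n)"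
      using True K n by (simp add: g_def power_mult_distrib real_root_pow_pos2 mult_ac)
    then show ?thesis using True K V(2) by (simp add: ennreal_mult)
  qed (simp add: g_def)
  then have "(\<integral>\<^sup>+z. ennreal (g z ^ ?n) \<partial>lborel)
      \<le> (\<integral>\<^sup>+z. ennreal K * (ennreal (\<bar>det (matrix (\<lambda>h. J z *v h))\<bar> * V (f z) ^ ?n) * indicator G z) \<partial>lborel)"
    by (rule nn_integral_mono)
  also have "\<dots> = ennreal K * (\<integral>\<^sup>+z. ennreal (\<bar>det (matrix (\<lambda>h. J z *v h))\<bar> * V (f z) ^ ?n) * indicator G z \<partial>lborel)"
  proof (rule nn_integral_cmult)
    have "continuous_on G (\<lambda>z. \<bar>det (J z)\<bar>)"
      unfolding det_def using J by (intro continuous_intros)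
    then have 1: "(\<lambda>z. \<bar>det (J z)\<bar>) \<in> borel_measurable (restrict_space borel G)"
      by (rule borel_measurable_continuous_on_restrict)
    have 2: "(\<lambda>z. V (f z)) \<in> borel_measurable (restrict_space borel G)"
      using measurable_compose[OF borel_measurable_continuous_on_restrict[OF contf] V(1)] .
    have "(\<lambda>z. ennreal (\<bar>det (J z)\<bar> * V (f z) ^ ?n)) \<in> borel_measurable (restrict_space borel G)"
      using 1 2 by measurable
    then show "(\<lambda>z. ennreal (\<bar>det (matrix (\<lambda>h. J z *v h))\<bar> * V (f z) ^ ?n) * indicator G z) \<in> borel_measurable lborel"
      using G by (subst (asm) borel_measurable_restrict_space_iff_ennreal) auto
  qed
  also have "\<dots> \<le> ennreal K * (\<integral>\<^sup>+w. ennreal (V w ^ ?n) \<partial>lborel)"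
    by (intro mult_left_mono nn_integral_change_of_variables_le[OF G der inj _ _ VI])
      (use V in \<open>auto intro: borel_measurable_power\<close>)
  finally show thesis using that[OF du bd gm] by blast
qed

text \<open>The ball of radius \<open>t * D\<close> is the yolk of the egg of radius
  \<open>D\<close>; the point is that \<open>t\<close> does not depend on the map, the domain or the
  scale. Keeping \<open>f\<close> and its derivative \<open>J\<close> as free variables allows a
  transfer to other coordinates.\<close>

lemma quasiconformal_egg_yolk_wellorder:
  fixes K :: real
  assumes n: "CARD('m::{finite,wellorder}) \<ge> 2" and K: "0 \<le> K"
  obtains t where "0 < t" "t \<le> 1"
    "\<And>G f J x x' y D. open G \<Longrightarrow> continuous_on G (J :: real^'m::_ \<Rightarrow> real^('m::_)^('m::_)) \<Longrightarrow>
      (\<And>z. z \<in> G \<Longrightarrow> (f has_derivative (\<lambda>h. J z *v h)) (at z)) \<Longrightarrow> inj_on f G \<Longrightarrow>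
      (\<And>z h. z \<in> G \<Longrightarrow> norm (J z *v h) ^ CARD('m::_) \<le> K * \<bar>det (J z)\<bar> * norm h ^ CARD('m::_)) \<Longrightarrow>
      x \<in> G \<Longrightarrow> y \<in> G \<Longrightarrow> x' \<notin> G \<Longrightarrow> 0 < D \<Longrightarrow> ball (f x) D \<subseteq> f ` G \<Longrightarrow>
      dist (f x) (f y) \<le> t * D \<Longrightarrow> dist x y < dist x x' / 2"
proof -
  let ?n = "CARD('m)" and ?\<omega> = "unit_ball_vol (real CARD('m))"
  obtain c0 where c0: "c0 > 0" and loewner: "\<And>u u' g x x' d.
      (\<And>z. ((u :: real^'m::_ \<Rightarrow> real) has_derivative u' z) (at z)) \<Longrightarrow>
      (\<And>z h. \<bar>u' z h\<bar> \<le> g z * norm h) \<Longrightarrow> g \<in> borel_measurable borel \<Longrightarrow>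
      0 < d \<Longrightarrow> dist x x' \<le> d \<Longrightarrow>
      (\<And>\<tau>. 0 < \<tau> \<Longrightarrow> \<tau> < d / 2 \<Longrightarrow> \<exists>e. dist x e = \<tau> \<and> u e = 1) \<Longrightarrow>
      (\<And>\<tau>. 0 < \<tau> \<Longrightarrow> \<tau> < d / 2 \<Longrightarrow> \<exists>e. dist x' e = \<tau> \<and> u e = 0) \<Longrightarrow>
      ennreal c0 \<le> (\<integral>\<^sup>+z. ennreal (g z ^ DIM(real^'m::_)) \<partial>lborel)"
    using loewner_constant[where 'a = "real^'m::_"] by blast
  define M where "M = K * 16 ^ ?n * ?\<omega>"
  have M: "0 \<le> M" using K by (simp add: M_def)
  obtain N :: nat where "M / c0 < real N" using reals_Archimedean2 by blast
  moreover have "0 \<le> M / c0" using M c0 by simp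
  ultimately have N: "0 < N" "M / c0 < real N" by (cases N; simp)+
  \<comment> \<open>The left side is \<open>M * N^(1-n)\<close>, at most \<open>M / N\<close>
    because \<open>n \<ge> 2\<close>, and \<open>N\<close> was chosen to bring this below
    \<open>c0\<close>.\<close>
  have small: "K * (real N * (16 / real N) ^ ?n * ?\<omega>) < c0"
  proof -
    have "real N * real N \<le> real N ^ ?n"
      using power_increasing[OF n, of "real N"] N(1) by (simp add: power2_eq_square)
    then have "real N / real N ^ ?n \<le> real N / (real N * real N)"
      using N(1) by (intro divide_left_mono) auto
    also have "\<dots> = 1 / real N" using N(1) by simp
    finally have "M * (real N / real N ^ ?n) \<le> M * (1 / real N)" using M by (rule mult_left_mono)
    also have "\<dots> < c0" using N c0 by (simp add: field_simps)
    finally show ?thesis by (simp add: M_def power_divide mult_ac)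
  qed
  \<comment> \<open>The inner radius of the cut-off relative to \<open>D\<close>: on the ball of
    radius \<open>t * D\<close> about \<open>f x\<close> it is identically 1.\<close>
  define t where "t = 1 / (2::real) ^ Suc N"
  have t: "0 < t" "t \<le> 1/2" by (auto simp: t_def field_simps)
  show thesis
  proof (rule that[of t])
    fix G and f :: "real^'m::_ \<Rightarrow> real^'m::_" and J :: "real^'m::_ \<Rightarrow> real^('m::_)^('m::_)" and x x' y and D :: real
    assume G: "open G" and J: "continuous_on G J"
      and der: "\<And>z. z \<in> G \<Longrightarrow> (f has_derivative (\<lambda>h. J z *v h)) (at z)" and inj: "inj_on f G"
      and qc: "\<And>z h. z \<in> G \<Longrightarrow> norm (J z *v h) ^ ?n \<le> K * \<bar>det (J z)\<bar> * norm h ^ ?n"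
      and x: "x \<in> G" and y: "y \<in> G" and x': "x' \<notin> G" and D: "0 < D" and ball: "ball (f x) D \<subseteq> f ` G"
      and xy: "dist (f x) (f y) \<le> t * D"
    show "dist x y < dist x x' / 2"
    proof (rule ccontr)
      assume far: "\<not> dist x y < dist x x' / 2"
      define d where "d = dist x x'"
      have d: "0 < d" using x x' by (auto simp: d_def)
      have contf: "continuous_on G f"
        using der has_derivative_continuous continuous_at_imp_continuous_on by blast
      obtain f1 where f1: "homeomorphism G (f ` G) f f1"
        using invariance_of_domain_homeomorphism[OF G contf _ inj] by auto
      then have f1f: "\<And>z. z \<in> G \<Longrightarrow> f1 (f z) = z" and ff1: "\<And>w. w \<in> f ` G \<Longrightarrow> f (f1 w) = w"
        and f1G: "\<And>w. w \<in> f ` G \<Longrightarrow> f1 w \<in> G"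
        and f1c: "continuous_on (f ` G) f1"
        unfolding homeomorphism_def by auto
      obtain v v' V where
        v: "\<And>w. ((v :: real^'m::_ \<Rightarrow> real) has_derivative v' w) (at w)" "\<And>w h. \<bar>v' w h\<bar> \<le> V w * norm h"
        and V: "V \<in> borel_measurable borel" "\<And>w. 0 \<le> V w"
        and VI: "(\<integral>\<^sup>+w. ennreal (V w ^ DIM(real^'m::_)) \<partial>lborel) \<le>
          ennreal (real N * (16 / real N) ^ DIM(real^'m::_) * unit_ball_vol (real DIM(real^'m::_)))"
        and v1: "\<And>w. dist (f x) w \<le> D / 2 ^ Suc N \<Longrightarrow> v w = 1"
        and v0: "\<And>w. D / 2 \<le> dist (f x) w \<Longrightarrow> v w = 0"
        using log_cutoff[OF D N(1), of "f x"] by blast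
      have "DIM(real^'m::_) = ?n" by simp
      note VI = VI[unfolded this]
      have sub: "cball (f x) (D / 2) \<subseteq> f ` G" using ball D by force
      have v0': "v w = 0" if "w \<notin> cball (f x) (D / 2)" for w using that by (intro v0) auto
      have VI': "(\<integral>\<^sup>+w. ennreal (V w ^ ?n) \<partial>lborel) < \<infinity>"
        using VI by (rule le_less_trans) simp
      let ?u = "\<lambda>z. if z \<in> G then v (f z) else 0"
      obtain u' g where ug: "\<And>z. (?u has_derivative u' z) (at z)"
        "\<And>z h. \<bar>u' z h\<bar> \<le> g z * norm h" "g \<in> borel_measurable borel"
        "(\<integral>\<^sup>+z. ennreal (g z ^ ?n) \<partial>lborel) \<le> ennreal K * (\<integral>\<^sup>+w. ennreal (V w ^ ?n) \<partial>lborel)"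
        using cutoff_composition_energy[OF G J der inj K qc v V VI' compact_cball sub v0'] by blast
      have "(\<integral>\<^sup>+z. ennreal (g z ^ ?n) \<partial>lborel) \<le> ennreal K * ennreal (real N * (16 / real N) ^ ?n * ?\<omega>)"
        using ug(4) VI by (meson mult_left_mono order_trans zero_le)
      also have "\<dots> = ennreal (K * (real N * (16 / real N) ^ ?n * ?\<omega>))"
        using K by (simp add: ennreal_mult')
      also have "\<dots> < ennreal c0" using small c0 by (simp add: ennreal_lessI)
      finally have less: "(\<integral>\<^sup>+z. ennreal (g z ^ ?n) \<partial>lborel) < ennreal c0" .
      \<comment> \<open>\<open>E\<close> is connected and contains \<open>y\<close> because
        \<open>f y\<close> lies in the ball of radius \<open>t * D\<close>. As \<open>y\<close> is
        far from \<open>x\<close>, \<open>E\<close> meets every sphere about \<open>x\<close> of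
        radius below \<open>d / 2\<close>.\<close>
      define E where "E = f1 ` cball (f x) (t * D)"
      have subt: "cball (f x) (t * D) \<subseteq> cball (f x) (D / 2)" using t D by (intro subset_cball) auto
      have "connected E"
        unfolding E_def by (intro connected_continuous_image continuous_on_subset[OF f1c]) (use subt sub in auto)
      have xE: "x \<in> E" unfolding E_def by (rule image_eqI[of _ _ "f x"]) (use f1f x t D in auto)
      have yE: "y \<in> E" unfolding E_def by (rule image_eqI[of _ _ "f y"]) (use f1f y xy in auto)
      have uE: "?u e = 1" if "e \<in> E" for e
      proof -
        obtain w where w: "w \<in> cball (f x) (t * D)" "e = f1 w" using \<open>e \<in> E\<close> unfolding E_def by blast
        then have "w \<in> f ` G" using subt sub by blast
        then show ?thesis using w v1[of w] ff1 f1G by (simp add: t_def)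
      qed
      define T where "T = f1 ` cball (f x) (D / 2)"
      have Tcpt: "compact T" unfolding T_def by (intro compact_continuous_image continuous_on_subset[OF f1c sub]) auto
      have TG: "T \<subseteq> G" using f1G sub by (auto simp: T_def)
      have "cball (f x) (D / 2) homeomorphic T"
        unfolding T_def
      proof (rule homeomorphic_compact[OF compact_cball continuous_on_subset[OF f1c sub] refl])
        show "inj_on f1 (cball (f x) (D / 2))" by (rule inj_on_inverseI[of _ f]) (use ff1 sub in blast)
      qed
      then have "T homeomorphic cball (f x) (D / 2)" by (rule homeomorphic_sym[THEN iffD1])
      then have connT: "connected (- T)"
        by (rule connected_complement_homeomorphic_convex_compact) (use n in auto)
      have uT: "?u e = 0" if "e \<in> - T" for e
      proof (cases "e \<in> G")
        case True
        then have "f e \<notin> cball (f x) (D / 2)" using that f1f[OF True] unfolding T_def by (metis ComplD imageI)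
        then show ?thesis using v0' by simp
      qed simp
      \<comment> \<open>A bounded set and a ball cannot cover the space. So the complement of
        \<open>T\<close>, connected and containing \<open>x'\<close>, meets every sphere about
        \<open>x'\<close>.\<close>
      have farT: "\<exists>q\<in>- T. \<tau> \<le> dist x' q" for \<tau>
      proof (rule ccontr)
        assume "\<not> (\<exists>q\<in>- T. \<tau> \<le> dist x' q)"
        then have "UNIV \<subseteq> T \<union> ball x' \<tau>" by force
        then have "bounded (UNIV :: (real^'m::_) set)"
          using compact_imp_bounded[OF Tcpt] by (metis bounded_Un bounded_ball bounded_subset)
        then show False by simp
      qed
      have "ennreal c0 \<le> (\<integral>\<^sup>+z. ennreal (g z ^ DIM(real^'m::_)) \<partial>lborel)"
      proof (rule loewner[OF ug(1-3) d])
        show "dist x x' \<le> d" by (simp add: d_def)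
        show "\<exists>e. dist x e = \<tau> \<and> ?u e = 1" if \<tau>: "0 < \<tau>" "\<tau> < d / 2" for \<tau>
        proof -
          have "dist x x \<le> \<tau>" "\<tau> \<le> dist x y" using \<tau> far by (auto simp: d_def)
          then obtain e where "e \<in> E" "dist x e = \<tau>"
            using connected_meets_sphere[OF \<open>connected E\<close> xE yE] by blast
          then show ?thesis using uE by blast
        qed
        show "\<exists>e. dist x' e = \<tau> \<and> ?u e = 0" if \<tau>: "0 < \<tau>" "\<tau> < d / 2" for \<tau>
        proof -
          obtain q where "q \<in> - T" "\<tau> \<le> dist x' q" using farT by blast
          then obtain e where "e \<in> - T" "dist x' e = \<tau>"
            using connected_meets_sphere[OF connT, of x' q x' \<tau>] \<tau> x' TG by auto
          then show ?thesis using uT by blast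
        qed
      qed
      then show False using less by simp
    qed
  qed (use t in auto)
qed

section \<open>Transfer to an arbitrary finite index type\<close>

typedef 'a wo_index = "UNIV :: 'a set" ..
instantiation wo_index :: (finite) "{finite, wellorder}"
begin
text \<open>The order is pulled back from an enumeration; working on a copy of the type avoids a
  clash with an order it may already carry.\<close>

definition "x \<le> (y :: 'a wo_index) \<longleftrightarrow> to_nat_on UNIV x \<le> to_nat_on UNIV y"
definition "x < (y :: 'a wo_index) \<longleftrightarrow> to_nat_on UNIV x < to_nat_on UNIV y"
instance
proof
  have fin: "finite (UNIV :: 'a wo_index set)"
    unfolding type_definition.univ[OF type_definition_wo_index] by simp
  show "finite (UNIV :: 'a wo_index set)" by (rule fin)
  have inj: "to_nat_on UNIV x = to_nat_on UNIV y \<longleftrightarrow> x = y" for x y :: "'a wo_index"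
    using inj_on_to_nat_on[OF countable_finite[OF fin]] by (simp add: inj_eq)
  fix x y z :: "'a wo_index"
  show "(x < y) = (x \<le> y \<and> \<not> y \<le> x)" "x \<le> x" "x \<le> y \<or> y \<le> x"
    by (auto simp: less_eq_wo_index_def less_wo_index_def)
  show "x \<le> z" if "x \<le> y" "y \<le> z" using that by (simp add: less_eq_wo_index_def)
  show "x = y" if "x \<le> y" "y \<le> x"
    by (rule iffD1[OF inj antisym]) (use that in \<open>unfold less_eq_wo_index_def\<close>)
  show "P a" if "\<And>x. (\<And>y. y < x \<Longrightarrow> P y) \<Longrightarrow> P x" for P and a :: "'a wo_index"
  proof (rule measure_induct_rule[of "to_nat_on UNIV" P a])
    show "P x" if "\<And>y. to_nat_on UNIV y < to_nat_on UNIV x \<Longrightarrow> P y" for x :: "'a wo_index"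
      using \<open>\<And>x. (\<And>y. y < x \<Longrightarrow> P y) \<Longrightarrow> P x\<close>[of x] that unfolding less_wo_index_def by blast
  qed
qed
end

text \<open>In the Leibniz formula, conjugation by \<open>r\<close> maps the permutations of one
  index set bijectively to those of the other and preserves signs.\<close>

lemma det_reindex:
  fixes A :: "real^'n^'n" and r :: "'m::finite \<Rightarrow> 'n::finite"
  assumes r: "bij r"
  shows "det (\<chi> i j. A $ r i $ r j) = det A"
proof -
  let ?c = "\<lambda>p x. if x \<in> (UNIV::'n set) then r (p (inv r x)) else x"
  have bij: "bij_betw ?c {p. p permutes UNIV} {p. p permutes UNIV}"
    using bij_betw_permutations[OF r] .
  have "det A = (\<Sum>p | p permutes (UNIV::'m set). of_int (sign (?c p)) * (\<Prod>i\<in>UNIV. A $ i $ ?c p i))"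
    unfolding det_def by (rule sum.reindex_bij_betw[OF bij, symmetric])
  also have "\<dots> = (\<Sum>p | p permutes (UNIV::'m set). of_int (sign p) * (\<Prod>i\<in>UNIV. A $ r i $ r (p i)))"
  proof (rule sum.cong[OF refl])
    fix p :: "'m \<Rightarrow> 'm" assume p: "p \<in> {p. p permutes UNIV}"
    have "?c p = map_permutation UNIV r p"
      using bij_is_surj[OF r] by (auto simp: map_permutation_def fun_eq_iff)
    then have "sign (?c p) = sign p"
      using sign_map_permutation[of r UNIV p] p r by (auto simp: bij_def)
    moreover have "(\<Prod>i\<in>UNIV. A $ i $ ?c p i) = (\<Prod>i\<in>UNIV. A $ r i $ ?c p (r i))"
      by (rule prod.reindex_bij_betw[OF r, symmetric])
    moreover have "?c p (r i) = r (p i)" for i using r by (simp add: bij_def)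
    ultimately show "of_int (sign (?c p)) * (\<Prod>i\<in>UNIV. A $ i $ ?c p i) = of_int (sign p) * (\<Prod>i\<in>UNIV. A $ r i $ r (p i))"
      by simp
  qed
  also have "\<dots> = det (\<chi> i j. A $ r i $ r j)" by (simp add: det_def)
  finally show ?thesis by simp
qed

text \<open>The change of variables formula of the library is only available for index types of class
  \<open>wellorder\<close>; permuting the coordinates transfers its consequence to every finite index type.\<close>

lemma quasiconformal_egg_yolk:
  fixes K :: real
  assumes n: "CARD('n::finite) \<ge> 2" and K: "0 \<le> K"
  obtains t where "0 < t" "t \<le> 1"
    "\<And>G f J x x' y D. open G \<Longrightarrow> continuous_on G (J :: real^'n::_ \<Rightarrow> real^('n::_)^('n::_)) \<Longrightarrow>
      (\<And>z. z \<in> G \<Longrightarrow> (f has_derivative (\<lambda>h. J z *v h)) (at z)) \<Longrightarrow> inj_on f G \<Longrightarrow>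
      (\<And>z h. z \<in> G \<Longrightarrow> norm (J z *v h) ^ CARD('n::_) \<le> K * \<bar>det (J z)\<bar> * norm h ^ CARD('n::_)) \<Longrightarrow>
      x \<in> G \<Longrightarrow> y \<in> G \<Longrightarrow> x' \<notin> G \<Longrightarrow> 0 < D \<Longrightarrow> ball (f x) D \<subseteq> f ` G \<Longrightarrow>
      dist (f x) (f y) \<le> t * D \<Longrightarrow> dist x y < dist x x' / 2"
proof -
  have card: "CARD('n wo_index) = CARD('n)"
    by (rule type_definition.card[OF type_definition_wo_index])
  obtain t where t: "0 < t" "t \<le> 1" and yolk: "\<And>G f J x x' y D. open G \<Longrightarrow> continuous_on G (J :: real^'n wo_index \<Rightarrow> real^'n wo_index^'n wo_index) \<Longrightarrow>
      (\<And>z. z \<in> G \<Longrightarrow> (f has_derivative (\<lambda>h. J z *v h)) (at z)) \<Longrightarrow> inj_on f G \<Longrightarrow>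
      (\<And>z h. z \<in> G \<Longrightarrow> norm (J z *v h) ^ CARD('n) \<le> K * \<bar>det (J z)\<bar> * norm h ^ CARD('n)) \<Longrightarrow>
      x \<in> G \<Longrightarrow> y \<in> G \<Longrightarrow> x' \<notin> G \<Longrightarrow> 0 < D \<Longrightarrow> ball (f x) D \<subseteq> f ` G \<Longrightarrow>
      dist (f x) (f y) \<le> t * D \<Longrightarrow> dist x y < dist x x' / 2"
    using quasiconformal_egg_yolk_wellorder[where 'm = "'n wo_index" and K = K] n K unfolding card by blast
  define r :: "'n wo_index \<Rightarrow> 'n" where "r = Rep_wo_index"
  have r: "bij r"
    unfolding r_def bij_def using Rep_wo_index_inject type_definition.Rep_range[OF type_definition_wo_index]
    by (auto simp: inj_on_def)
  define P :: "real^'n \<Rightarrow> real^'n wo_index" where "P x = (\<chi> i. x $ r i)" for x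
  define Q :: "real^'n wo_index \<Rightarrow> real^'n" where "Q y = (\<chi> j. y $ inv r j)" for y
  have PQ: "P (Q y) = y" and QP: "Q (P x) = x" for x y
    using r by (auto simp: P_def Q_def vec_eq_iff bij_def surj_f_inv_f)
  have linP: "linear P" and linQ: "linear Q" by (auto intro!: linearI simp: P_def Q_def vec_eq_iff)
  have normP: "norm (P x) = norm x" for x
  proof -
    have "(\<Sum>i\<in>UNIV. (norm (x $ r i))\<^sup>2) = (\<Sum>j\<in>UNIV. (norm (x $ j))\<^sup>2)"
      by (rule sum.reindex_bij_betw[OF r])
    then show ?thesis by (simp add: norm_vec_def L2_set_def P_def)
  qed
  have normQ: "norm (Q y) = norm y" for y using normP[of "Q y"] PQ by simp
  have distP: "dist (P a) (P b) = dist a b" for a b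
    using normP[of "a - b"] linear_diff[OF linP] by (simp add: dist_norm)
  have blP: "bounded_linear P" and blQ: "bounded_linear Q"
    using linP linQ by (simp_all add: linear_conv_bounded_linear)
  show thesis
  proof (rule that[OF t])
    fix G and f :: "real^'n \<Rightarrow> real^'n" and J :: "real^'n \<Rightarrow> real^'n^'n" and x x' y and D :: real
    assume G: "open G" and J: "continuous_on G J"
      and der: "\<And>z. z \<in> G \<Longrightarrow> (f has_derivative (\<lambda>h. J z *v h)) (at z)" and inj: "inj_on f G"
      and qc: "\<And>z h. z \<in> G \<Longrightarrow> norm (J z *v h) ^ CARD('n) \<le> K * \<bar>det (J z)\<bar> * norm h ^ CARD('n)"
      and x: "x \<in> G" and y: "y \<in> G" and x': "x' \<notin> G" and D: "0 < D" and ball: "ball (f x) D \<subseteq> f ` G"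
      and xy: "dist (f x) (f y) \<le> t * D"
    \<comment> \<open>The map in renamed coordinates. Rows and columns of its derivative
      \<open>A\<close> are renamed by the same bijection, so the determinant is unchanged, and
      renaming preserves all norms.\<close>
    define F where "F y = P (f (Q y))" for y
    define A where "A y = (\<chi> i j. J (Q y) $ r i $ r j)" for y
    have A: "A y *v h = P (J (Q y) *v Q h)" for y h
    proof -
      have "(\<Sum>j\<in>UNIV. J (Q y) $ r i $ r j * h $ j) = (\<Sum>j\<in>UNIV. J (Q y) $ r i $ j * h $ inv r j)" for i
        using sum.reindex_bij_betw[OF r, of "\<lambda>j. J (Q y) $ r i $ j * h $ inv r j"] r
        by (simp add: bij_def)
      then show ?thesis by (simp add: vec_eq_iff A_def P_def Q_def matrix_vector_mult_def)
    qed
    have imP: "P ` G = Q -` G" using PQ QP by (auto simp: image_iff) metis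
    have QG: "Q z \<in> G" if "z \<in> P ` G" for z using that QP by auto
    have "dist (P x) (P y) < dist (P x) (P x') / 2"
    proof (rule yolk[where G = "P ` G" and f = F and J = A and D = D])
      have "continuous_on UNIV Q" using linear_continuous_on[OF blQ] .
      then show "open (P ` G)" unfolding imP using G by (rule open_vimage[rotated])
      have "continuous_on (P ` G) (\<lambda>y. J (Q y))"
        by (rule continuous_on_compose2[OF J linear_continuous_on[OF blQ]]) (use QP in auto)
      then show "continuous_on (P ` G) A" unfolding A_def by (intro continuous_intros)
      show "(F has_derivative (\<lambda>h. A z *v h)) (at z)" if "z \<in> P ` G" for z
        unfolding F_def A
        by (intro has_derivative_compose[OF _ bounded_linear_imp_has_derivative[OF blP]]
            has_derivative_compose[OF bounded_linear_imp_has_derivative[OF blQ]] der QG that)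
      show "inj_on F (P ` G)"
        unfolding F_def inj_on_def using inj QP by (metis (no_types, lifting) imageE inj_onD)
      show "norm (A z *v h) ^ CARD('n) \<le> K * \<bar>det (A z)\<bar> * norm h ^ CARD('n)" if "z \<in> P ` G" for z h
      proof -
        have "det (A z) = det (J (Q z))" unfolding A_def by (rule det_reindex[OF r])
        then show ?thesis using qc[OF QG[OF that], of "Q h"] by (simp add: A normP normQ)
      qed
      show "P x \<in> P ` G" "P y \<in> P ` G" "P x' \<notin> P ` G" "0 < D"
        using x y x' D QP by (auto, metis)
      show "ball (F (P x)) D \<subseteq> F ` P ` G"
      proof
        fix w assume "w \<in> ball (F (P x)) D"
        then have "Q w \<in> ball (f x) D" using distP[of "f x" "Q w"] by (simp add: F_def QP PQ)
        then obtain z where "z \<in> G" "f z = Q w" using ball by auto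
        then have "F (P z) = w" by (simp add: F_def QP PQ)
        then show "w \<in> F ` P ` G" using \<open>z \<in> G\<close> by blast
      qed
      show "dist (F (P x)) (F (P y)) \<le> t * D" using xy by (simp add: F_def QP distP)
    qed
    then show "dist x y < dist x x' / 2" by (simp add: distP)
  qed
qed

section \<open>The lower bound for the quasihyperbolic metric\<close>

lemma continuous_on_partial_curve_integral:
  assumes g: "rectifiable g" and \<rho>: "continuous_on (path_image g) \<rho>"
  shows "continuous_on {0..1} (partial_curve_integral g \<rho>)"
proof -
  let ?L = "curve_length g 0 1" and ?h = "\<lambda>s. \<rho> (arc_length_param g s)"
  have "continuous_on {0..?L} ?h"
    using continuous_on_compose2[OF \<rho> continuous_on_arc_length_param[OF g] arc_length_param_image[OF g]] .
  then have "continuous_on {0..?L} (\<lambda>x. integral {0..x} ?h)"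
    by (intro indefinite_integral_continuous_1 integrable_continuous_real)
  moreover have "curve_length g 0 ` {0..1} \<subseteq> {0..?L}"
    using curve_length_mono[OF g, of 0] curve_length_mono[OF g, of _ 1] by (auto simp: curve_length_refl)
  ultimately show ?thesis
    unfolding partial_curve_integral_def
    using continuous_on_compose2[OF _ continuous_on_curve_length[OF g]] by blast
qed

text \<open>Up to the first exit from the ball of radius \<open>t * bdist D (g a)\<close> about
  \<open>g a\<close>, the boundary distance is at most \<open>2 * bdist D (g a)\<close>, as
  \<open>t \<le> 1\<close>. The arc up to this exit has length at least
  \<open>t * bdist D (g a)\<close>, so its quasihyperbolic length is at least
  \<open>t / 2\<close>.\<close>

lemma small_qh_length_imp_close:
  assumes D: "proper_subdomain D" and g: "rectifiable g" and sub: "path_image g \<subseteq> D"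
    and ab: "0 \<le> a" "a \<le> b" "b \<le> 1" and t: "0 < t" "t \<le> 1"
    and small: "partial_curve_integral g (\<lambda>z. 1 / bdist D z) b - partial_curve_integral g (\<lambda>z. 1 / bdist D z) a < t / 2"
  shows "dist (g a) (g b) \<le> t * bdist D (g a)"
proof (rule ccontr)
  assume far: "\<not> dist (g a) (g b) \<le> t * bdist D (g a)"
  let ?\<rho> = "\<lambda>z. 1 / bdist D z" and ?d = "bdist D (g a)"
  have gD: "g s \<in> D" if "0 \<le> s" "s \<le> 1" for s using that sub by (auto simp: path_image_def)
  have d: "0 < ?d" using bdist_pos[OF D gD] ab by simp
  have \<rho>: "continuous_on (path_image g) ?\<rho>" by (rule continuous_on_inverse_bdist[OF D sub])
  have gc: "continuous_on {a..b} (\<lambda>s. dist (g a) (g s))"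
    using rectifiable_path[OF g] ab unfolding path_def
    by (intro continuous_intros) (auto intro: continuous_on_subset)
  define H where "H = {s \<in> {a..b}. t * ?d \<le> dist (g a) (g s)}"
  have "closed H" unfolding H_def
    using continuous_closed_preimage[OF gc closed_real_atLeastAtMost closed_atLeast[of "t * ?d"]]
    by (simp add: vimage_def Int_def conj_commute)
  then have cH: "compact H" unfolding H_def by (metis (no_types, lifting) H_def closed_Int_compact
        compact_Icc inf.absorb_iff1 mem_Collect_eq subsetI)
  have "b \<in> H" using far ab by (simp add: H_def)
  then obtain s where s: "s \<in> H" "\<And>r. r \<in> H \<Longrightarrow> s \<le> r"
    using compact_attains_inf[OF cH] by blast
  have sab: "a \<le> s" "s \<le> b" and sd: "t * ?d \<le> dist (g a) (g s)" using s(1) by (auto simp: H_def)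
  \<comment> \<open>A point outside the closed ball would be preceded by one at distance exactly
    \<open>t * ?d\<close>, contradicting that \<open>s\<close> is the first exit.\<close>
  have le: "dist (g a) (g r) \<le> t * ?d" if r: "a \<le> r" "r \<le> s" for r
  proof (rule ccontr)
    assume n: "\<not> dist (g a) (g r) \<le> t * ?d"
    have "continuous_on {a..r} (\<lambda>s. dist (g a) (g s))"
      using gc by (rule continuous_on_subset) (use that sab in auto)
    then obtain q where q: "a \<le> q" "q \<le> r" "dist (g a) (g q) = t * ?d"
      using IVT'[of "\<lambda>s. dist (g a) (g s)" a "t * ?d" r] n r t d by auto
    then have "q \<in> H" using that sab by (simp add: H_def)
    then have "q = r" using s(2) q that by fastforce
    then show False using q n by simp
  qed
  have "1 / (2 * ?d) \<le> ?\<rho> (g r)" if "a \<le> r" "r \<le> s" for r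
  proof -
    have "bdist D (g r) \<le> ?d + t * ?d"
      using bdist_le_add_dist[of D "g r" "g a"] le[OF that] by (simp add: dist_commute)
    also have "\<dots> \<le> 2 * ?d" using t d by simp
    finally show ?thesis using bdist_pos[OF D gD, of r] that ab sab by (intro divide_left_mono) auto
  qed
  then have "1 / (2 * ?d) * curve_length g a s \<le> partial_curve_integral g ?\<rho> s - partial_curve_integral g ?\<rho> a"
    using ab sab by (intro partial_curve_integral_increment(2)[OF g \<rho>]) auto
  moreover have "0 * curve_length g s b \<le> partial_curve_integral g ?\<rho> b - partial_curve_integral g ?\<rho> s"
    using ab sab by (intro partial_curve_integral_increment(2)[OF g \<rho>]) (auto simp: bdist_def infdist_nonneg)
  moreover have "1 / (2 * ?d) * (t * ?d) \<le> 1 / (2 * ?d) * curve_length g a s"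
    using d sd dist_le_curve_length[OF rectifiable_bdd[OF g], of a s] ab sab by (intro mult_left_mono) auto
  moreover have "1 / (2 * ?d) * (t * ?d) = t / 2" using d by simp
  ultimately show False using small by simp
qed

text \<open>If \<open>h\<close> moves points of small relative distance by quasihyperbolic distance at most \<open>1\<close>,
  cutting a curve into pieces of quasihyperbolic length \<open>t/4\<close> shows that \<open>h\<close> is Lipschitz in
  the large.\<close>

lemma qh_large_scale_lipschitz:
  assumes D: "proper_subdomain D" and D': "proper_subdomain D'" and h: "h \<in> D' \<rightarrow> D" and t: "0 < t" "t \<le> 1"
    and step: "\<And>p q. p \<in> D' \<Longrightarrow> q \<in> D' \<Longrightarrow> dist p q \<le> t * bdist D' p \<Longrightarrow> qh_dist D (h p) (h q) \<le> 1"
    and pq: "p \<in> D'" "q \<in> D'"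
  shows "t / 4 * qh_dist D (h p) (h q) \<le> qh_dist D' p q + t / 2"
proof -
  \<comment> \<open>Strictly below the threshold \<open>t / 2\<close> of the closeness
    lemma.\<close>
  let ?q = "t / 4"
  have curve: "?q * qh_dist D (h p) (h q) - t / 2 \<le> curve_integral g (\<lambda>z. 1 / bdist D' z)"
    if g: "g \<in> joining_curves D' p q" for g
  proof -
    let ?I = "partial_curve_integral g (\<lambda>z. 1 / bdist D' z)"
    have rg: "rectifiable g" and sub: "path_image g \<subseteq> D'" and ends: "g 0 = p" "g 1 = q"
      using g by (auto simp: joining_curves_def pathstart_def pathfinish_def)
    have gD: "g s \<in> D'" if "0 \<le> s" "s \<le> 1" for s using that sub by (auto simp: path_image_def)
    have hD: "h (g s) \<in> D" if "0 \<le> s" "s \<le> 1" for s using gD[OF that] h by auto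
    have near: "qh_dist D (h (g a)) (h (g b)) \<le> 1" if "0 \<le> a" "a \<le> b" "b \<le> 1" "?I b - ?I a \<le> ?q" for a b
      using small_qh_length_imp_close[OF D' rg sub that(1-3) t] that t by (intro step gD) auto
    \<comment> \<open>The base case \<open>m = 0\<close> still counts one step for the remaining
      arc, whence \<open>m + 1\<close>.\<close>
    have chain: "qh_dist D (h (g a)) (h (g 1)) \<le> real m + 1"
      if "0 \<le> a" "a \<le> 1" "?I 1 - ?I a \<le> real m * ?q" for a m
      using that
    proof (induction m arbitrary: a)
      case 0
      then show ?case using near[of a 1] t by simp
    next
      case (Suc m)
      show ?case
      proof (cases "?I 1 - ?I a \<le> ?q")
        case True
        then show ?thesis using near[of a 1] Suc.prems by simp
      next
        case False
        have "continuous_on {a..1} ?I"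
          using continuous_on_partial_curve_integral[OF rg continuous_on_inverse_bdist[OF D' sub]]
          by (rule continuous_on_subset) (use Suc.prems in auto)
        then obtain b where b: "a \<le> b" "b \<le> 1" "?I b = ?I a + ?q"
          using IVT'[of ?I a "?I a + ?q" 1] False Suc.prems t by auto
        have "?I 1 - ?I b \<le> real m * ?q" using Suc.prems(3) b(3) by (simp add: algebra_simps)
        then have "qh_dist D (h (g b)) (h (g 1)) \<le> real m + 1" using Suc b by simp
        moreover have "qh_dist D (h (g a)) (h (g b)) \<le> 1" using near[of a b] Suc.prems b by simp
        moreover have "qh_dist D (h (g a)) (h (g 1)) \<le> qh_dist D (h (g a)) (h (g b)) + qh_dist D (h (g b)) (h (g 1))"
          using Suc.prems b by (intro qh_dist_triangle[OF D] hD) auto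
        ultimately show ?thesis by simp
      qed
    qed
    \<comment> \<open>Rounding up costs one more step: there are at most
      \<open>?I 1 / ?q + 2\<close> steps, and \<open>2 * ?q\<close> is the additive constant
      \<open>t / 2\<close>.\<close>
    define m where "m = nat \<lceil>?I 1 / ?q\<rceil>"
    have I: "0 \<le> ?I 1" using curve_integral_qh_nonneg[OF D' g] by simp
    have m: "?I 1 / ?q \<le> real m" "real m \<le> ?I 1 / ?q + 1"
      using I t by (auto simp: m_def)
    have "?I 1 - ?I 0 \<le> real m * ?q" using m(1) t by (simp add: field_simps)
    then have "qh_dist D (h p) (h q) \<le> real m + 1" using chain[of 0 m] ends by simp
    then have "?q * qh_dist D (h p) (h q) \<le> ?q * (?I 1 / ?q + 2)" using m(2) t by (intro mult_left_mono) auto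
    also have "\<dots> = ?I 1 + t / 2" using t by (simp add: algebra_simps)
    finally show ?thesis by simp
  qed
  have "?q * qh_dist D (h p) (h q) - t / 2 \<le> qh_dist D' p q"
    unfolding qh_dist_eq[of D']
    by (rule cINF_greatest[OF joining_curves_nonempty[OF D' pq]]) (rule curve)
  then show ?thesis by simp
qed

section \<open>From an inequality almost everywhere to all points\<close>

lemma formal_deriv_eq_jacobian:
  fixes f :: "real^'n \<Rightarrow> real^'n"
  assumes "C1_on G f" "x \<in> G"
  shows "formal_deriv f x = jacobian f (at x)"
proof -
  have "partial_deriv f j x = jacobian f (at x) *v axis j 1" for j
  proof -
    have l: "((\<lambda>t. x + t *\<^sub>R axis j 1) has_derivative (\<lambda>t. t *\<^sub>R axis j 1)) (at 0)"
      by (auto intro!: derivative_eq_intros)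
    have "(f has_derivative (\<lambda>h. jacobian f (at x) *v h)) (at (x + 0 *\<^sub>R axis j 1))"
      using C1_on_has_derivative[OF assms] by simp
    from has_derivative_compose[OF l this]
    have "((\<lambda>t. f (x + t *\<^sub>R axis j 1)) has_vector_derivative jacobian f (at x) *v axis j 1) (at 0)"
      by (simp add: has_vector_derivative_def matrix_vector_mult_scaleR)
    then show ?thesis unfolding partial_deriv_def by (rule vector_derivative_at)
  qed
  then show ?thesis
    by (simp add: formal_deriv_def matrix_vector_mult_basis column_def vec_eq_iff)
qed

text \<open>For a \<open>C\<^sup>1\<close> map the quasiconformality inequality holds everywhere: for fixed \<open>h\<close> it fails
  on an open set.\<close>

lemma quasiconformal_jacobian_bound:
  fixes f :: "real^'n \<Rightarrow> real^'n"
  assumes G: "open G" and f: "C1_on G f" and qc: "quasiconformal K G G' f" and z: "z \<in> G"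
  shows "norm (jacobian f (at z) *v h) ^ CARD('n) \<le> K * \<bar>det (jacobian f (at z))\<bar> * norm h ^ CARD('n)"
proof (rule ccontr)
  let ?n = "CARD('n)" and ?J = "\<lambda>z. jacobian f (at z)"
  assume n: "\<not> ?thesis"
  define S where "S = {z \<in> G. 0 < norm (?J z *v h) ^ ?n - K * \<bar>det (?J z)\<bar> * norm h ^ ?n}"
  have J: "continuous_on G ?J" using f by (simp add: C1_on_def)
  have "continuous_on G (\<lambda>z. det (?J z))" unfolding det_def using J by (intro continuous_intros)
  moreover have "continuous_on G (\<lambda>z. ?J z *v h)"
    unfolding matrix_vector_mult_def using J by (intro continuous_intros)
  ultimately have "continuous_on G (\<lambda>z. norm (?J z *v h) ^ ?n - K * \<bar>det (?J z)\<bar> * norm h ^ ?n)"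
    by (intro continuous_intros)
  from continuous_open_preimage[OF this G open_greaterThan[of 0]]
  have "open S" by (simp add: S_def vimage_def Int_def)
  have "z \<in> S" using n z by (simp add: S_def)
  have K: "1 \<le> K" and AE: "AE x in lebesgue_on G. onorm ((*v) (formal_deriv f x)) ^ ?n \<le> K * det (formal_deriv f x)"
    using qc unfolding quasiconformal_def by auto
  have "AE x in lebesgue. x \<in> G \<longrightarrow> onorm ((*v) (formal_deriv f x)) ^ ?n \<le> K * det (formal_deriv f x)"
    using AE G by (subst (asm) AE_restrict_space_iff) auto
  then obtain N where N: "{x \<in> space lebesgue. \<not> (x \<in> G \<longrightarrow> onorm ((*v) (formal_deriv f x)) ^ ?n \<le> K * det (formal_deriv f x))} \<subseteq> N"
    "emeasure lebesgue N = 0" "N \<in> sets lebesgue"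
    by (rule AE_E)
  \<comment> \<open>Where the inequality for \<open>h\<close> fails, the one for the operator norm
    fails as well.\<close>
  have "S \<subseteq> N"
  proof
    fix x assume x: "x \<in> S"
    have "\<not> onorm ((*v) (?J x)) ^ ?n \<le> K * det (?J x)"
    proof
      assume le: "onorm ((*v) (?J x)) ^ ?n \<le> K * det (?J x)"
      have "norm (?J x *v h) ^ ?n \<le> (onorm ((*v) (?J x)) * norm h) ^ ?n"
        by (intro power_mono onorm matrix_vector_mul_bounded_linear) simp
      also have "\<dots> \<le> K * det (?J x) * norm h ^ ?n"
        unfolding power_mult_distrib using le by (intro mult_right_mono) auto
      also have "\<dots> \<le> K * \<bar>det (?J x)\<bar> * norm h ^ ?n"
        using K by (intro mult_right_mono mult_left_mono) auto
      finally show False using x by (simp add: S_def)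
    qed
    then show "x \<in> N" using N(1) x formal_deriv_eq_jacobian[OF f, of x] by (auto simp: S_def)
  qed
  then have "negligible S"
    using N by (meson negligible_iff_null_sets negligible_subset null_setsI)
  then show False using open_not_negligible[OF \<open>open S\<close>] \<open>z \<in> S\<close> by blast
qed

text \<open>With \<open>x'\<close> a point outside \<open>G\<close> at distance
  \<open>bdist G x\<close> and \<open>D\<close> the boundary distance of \<open>f x\<close>, the
  distortion estimate says that image points at distance at most \<open>t * D\<close> come from
  points at quasihyperbolic distance at most 1. So the inverse of \<open>f\<close> is Lipschitz in
  the large.\<close>

lemma quasiconformal_qh_lower_bound:
  fixes f :: "real^'n \<Rightarrow> real^'n"
  assumes n: "CARD('n) \<ge> 2" and G: "proper_subdomain G" "proper_subdomain (f ` G)"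
    and f: "C1_on G f" and qc: "quasiconformal K G G' f"
  obtains t where "0 < t"
    "\<And>x y. x \<in> G \<Longrightarrow> y \<in> G \<Longrightarrow> t / 4 * qh_dist G x y \<le> qh_dist (f ` G) (f x) (f y) + t / 2"
proof -
  have oG: "open G" using proper_subdomainD[OF G(1)] by simp
  have K: "0 \<le> K" using qc by (simp add: quasiconformal_def)
  obtain h where "homeomorphism G G' f h" using qc unfolding quasiconformal_def by blast
  then have "h (f x) = x" if "x \<in> G" for x using that unfolding homeomorphism_def by simp
  then have inj: "inj_on f G" by (rule inj_on_inverseI)
  have J: "continuous_on G (\<lambda>z. jacobian f (at z))" using f by (simp add: C1_on_def)
  obtain t where t: "0 < t" "t \<le> 1" and yolk: "\<And>G f J x x' y D. open G \<Longrightarrow> continuous_on G (J :: real^'n \<Rightarrow> real^'n^'n) \<Longrightarrow>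
      (\<And>z. z \<in> G \<Longrightarrow> (f has_derivative (\<lambda>h. J z *v h)) (at z)) \<Longrightarrow> inj_on f G \<Longrightarrow>
      (\<And>z h. z \<in> G \<Longrightarrow> norm (J z *v h) ^ CARD('n) \<le> K * \<bar>det (J z)\<bar> * norm h ^ CARD('n)) \<Longrightarrow>
      x \<in> G \<Longrightarrow> y \<in> G \<Longrightarrow> x' \<notin> G \<Longrightarrow> 0 < D \<Longrightarrow> ball (f x) D \<subseteq> f ` G \<Longrightarrow>
      dist (f x) (f y) \<le> t * D \<Longrightarrow> dist x y < dist x x' / 2"
    using quasiconformal_egg_yolk[OF n K] by blast
  have step: "qh_dist G x y \<le> 1" if xy: "x \<in> G" "y \<in> G" "dist (f x) (f y) \<le> t * bdist (f ` G) (f x)" for x y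
  proof -
    obtain x' where x': "x' \<notin> G" "dist x x' = bdist G x" using bdist_attained[OF G(1)] by blast
    have "dist x y < dist x x' / 2"
      using xy x'(1) bdist_pos[OF G(2)] ball_bdist_subset[OF G(2)]
      by (intro yolk[OF oG J C1_on_has_derivative[OF f] inj quasiconformal_jacobian_bound[OF oG f qc],
            where D = "bdist (f ` G) (f x)"]) auto
    then show ?thesis using x' by (intro qh_dist_le_1[OF G(1) xy(1)]) simp
  qed
  have inv: "inv_into G f (f x) = x" if "x \<in> G" for x using inj that by simp
  have "t / 4 * qh_dist G x y \<le> qh_dist (f ` G) (f x) (f y) + t / 2" if xy: "x \<in> G" "y \<in> G" for x y
  proof -
    have "inv_into G f \<in> f ` G \<rightarrow> G" using inv by auto
    moreover have "qh_dist G (inv_into G f p) (inv_into G f q) \<le> 1"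
      if "p \<in> f ` G" "q \<in> f ` G" "dist p q \<le> t * bdist (f ` G) p" for p q
      using that step inv by auto
    ultimately show ?thesis
      using qh_large_scale_lipschitz[OF G(1) G(2) _ t, of "inv_into G f" "f x" "f y"] inv xy by simp
  qed
  then show thesis using that t(1) by blast
qed

theorem theorem3p3:
  fixes f :: "real^'n \<Rightarrow> real^'n" and G G' :: "(real^'n) set" and c :: real
  assumes "CARD('n) \<ge> 2"
    and "proper_subdomain G"
    and "G' = f ` G"
    and "proper_subdomain G'"
    and "f \<in> OC1 G"
    and "weak_uniform_bounded c G G' f"
  shows "(\<exists>L>0. \<forall>x\<in>G. \<forall>y\<in>G. qh_dist G' (f x) (f y) \<le> L * qh_dist G x y) \<and>
         (\<forall>K. quasiconformal K G G' f \<longrightarrow>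
              pseudo_isometry G (qh_dist G) (f ` G) (qh_dist (f ` G)) f)"
proof (intro conjI allI impI)
  show lip: "\<exists>L>0. \<forall>x\<in>G. \<forall>y\<in>G. qh_dist G' (f x) (f y) \<le> L * qh_dist G x y"
    by (rule qh_lipschitz[OF assms(2,4,3,5,6)])
  fix K assume qc: "quasiconformal K G G' f"
  obtain L where L: "L > 0" "\<And>x y. x \<in> G \<Longrightarrow> y \<in> G \<Longrightarrow> qh_dist (f ` G) (f x) (f y) \<le> L * qh_dist G x y"
    using lip assms(3) by blast
  have "C1_on G f" using assms(5) by (simp add: OC1_def)
  then obtain t where t: "0 < t" "\<And>x y. x \<in> G \<Longrightarrow> y \<in> G \<Longrightarrow>
      t / 4 * qh_dist G x y \<le> qh_dist (f ` G) (f x) (f y) + t / 2"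
    using quasiconformal_qh_lower_bound[OF assms(1,2) _ _ qc] assms(3,4) by blast
  \<comment> \<open>One \<open>a\<close> has to serve both bounds: \<open>a \<ge> L\<close> for the
    upper one, and \<open>a \<ge> 4 / t\<close> for \<open>inverse a \<le> t / 4\<close> in the
    lower one.\<close>
  define a where "a = max L (4 / t)"
  have a: "0 < a" "L \<le> a" "4 / t \<le> a" using L(1) by (auto simp: a_def)
  have inv: "inverse a \<le> t / 4" using le_imp_inverse_le[OF a(3)] t(1) by simp
  have "inverse a * qh_dist G x y - t / 2 \<le> qh_dist (f ` G) (f x) (f y) \<and>
      qh_dist (f ` G) (f x) (f y) \<le> a * qh_dist G x y" if xy: "x \<in> G" "y \<in> G" for x y
  proof -
    have "0 \<le> qh_dist G x y" by (rule qh_dist_nonneg[OF assms(2) xy])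
    then have "inverse a * qh_dist G x y \<le> t / 4 * qh_dist G x y" "L * qh_dist G x y \<le> a * qh_dist G x y"
      using mult_right_mono[OF inv] mult_right_mono[OF a(2)] by blast+
    then show ?thesis using t(2)[OF xy] L(2)[OF xy] by linarith
  qed
  then show "pseudo_isometry G (qh_dist G) (f ` G) (qh_dist (f ` G)) f"
    unfolding pseudo_isometry_def using a(1) t(1) by (intro conjI exI[of _ a] exI[of _ "t / 2"]) auto
qed

end
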